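(* Let $\beta>1$ be an algebraic integer with $\mathrm{M}(\beta)<\Theta$. Then the formal decomposition of the monic minimal polynomial $$P_\beta(X)=P_\beta^*(X)=U_\beta(X)\times f_\beta(X)$$ holds, where the Parry Upper function has the form $f_\beta(X)=G_{\mathrm{dyg}(\beta)}(X)+X^{m_1}+X^{m_2}+X^{m_3}+\cdots$ (finite or infinite sum) with $m_0:=\mathrm{dyg}(\beta)$ and $m_{q+1}-m_q\ge\mathrm{dyg}(\beta)-1$ for $q\ge0$, and $U_\beta(X)\in\mathbb{Z}[[X]]$ is an invertible formal series (the quotient of $P_\beta$ by $f_\beta$). Specializing $X$ to a complex variable $z$ gives the identity of analytic functions $P_\beta(z)=U_\beta(z)\times f_\beta(z)$: on $\mathbb{C}$ if $\beta$ is a Parry number, with $U_\beta$ and $f_\beta$ both meromorphic; on $|z|<1$ if $\beta$ is not a Parry number, with $|z|=1$ a natural boundary for both $U_\beta$ and $f_\beta$. In both cases the domain of holomorphy of $U_\beta(z)$ contains the open disc $D(0,\theta_{\mathrm{dyg}(\beta)-1})$.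
   Context: $\mathrm{M}$ is the Mahler measure; $\Theta=1.3247\ldots$ is the smallest Pisot number. $P^*(X)=X^{\deg P}P(1/X)$ is the reciprocal polynomial. For $n\ge2$, $G_n(z)=-1+z+z^n$ and $\theta_n$ is its unique root in $(0,1)$; for real $1<\beta\le(1+\sqrt5)/2$, $\mathrm{dyg}(\beta)$ is the unique $n\ge3$ with $\theta_n^{-1}\le\beta<\theta_{n-1}^{-1}$. For real $\beta>1$, $T_\beta(x)=\{\beta x\}$, $t_i=\lfloor\beta T_\beta^{i-1}(1)\rfloor$, $d_\beta(1)=0.t_1t_2\ldots$, and the Parry Upper function is $f_\beta(z)=-1+\sum_{i\ge1}t_iz^i$. $\beta$ is a Parry number if $d_\beta(1)$ is finite or eventually periodic. *)

theory Defs
  imports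
    "HOL-Complex_Analysis.Complex_Analysis"
    "HOL-Computational_Algebra.Computational_Algebra"
    "Berlekamp_Zassenhaus.Mahler_Measure"
begin

text \<open>
  For an algebraic integer \<open>x\<close> the minimal polynomial over the rationals has integer coefficients,
  so it can be described as the monic integer polynomial that vanishes at \<open>x\<close> and has least degree
  among all nonzero \<^emph>\<open>rational\<close> polynomials vanishing at \<open>x\<close>.  For other \<open>x\<close> the value is unspecified.
\<close>
definition min_int_poly :: "real \<Rightarrow> int poly" where
  "min_int_poly x = (THE p. lead_coeff p = 1 \<and> poly (map_poly of_int p) x = 0 \<and>
     (\<forall>q :: rat poly. q \<noteq> 0 \<and> poly (map_poly of_rat q) x = 0 \<longrightarrow> degree p \<le> degree q))"

definition Mahler :: "real \<Rightarrow> real" where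
  "Mahler x = mahler_measure (min_int_poly x)"

definition pisot_number :: "real \<Rightarrow> bool" where
  "pisot_number x \<longleftrightarrow> 1 < x \<and> algebraic_int x \<and>
     (\<forall>z :: complex. poly (map_poly of_int (min_int_poly x)) z = 0 \<and> z \<noteq> of_real x \<longrightarrow> norm z < 1)"

definition smallest_pisot :: real where
  "smallest_pisot = (LEAST x. pisot_number x)"

definition trinomial :: "nat \<Rightarrow> 'a :: comm_ring_1 poly" where
  "trinomial n = [:- 1, 1:] + Polynomial.monom 1 n"

definition theta :: "nat \<Rightarrow> real" where
  "theta n = (THE x. 0 < x \<and> x < 1 \<and> poly (trinomial n) x = 0)"

definition dyg :: "real \<Rightarrow> nat" where
  "dyg \<beta> = (THE n. 3 \<le> n \<and> inverse (theta n) \<le> \<beta> \<and> \<beta> < inverse (theta (n - 1)))"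

definition beta_transform :: "real \<Rightarrow> real \<Rightarrow> real" where
  "beta_transform \<beta> x = frac (\<beta> * x)"

text \<open>The digits are indexed from \<open>1\<close>; \<open>renyi_digit \<beta> 0\<close> has no meaning and is never used.\<close>
definition renyi_digit :: "real \<Rightarrow> nat \<Rightarrow> int" where
  "renyi_digit \<beta> i = \<lfloor>\<beta> * (beta_transform \<beta> ^^ (i - 1)) 1\<rfloor>"

definition parry_upper :: "real \<Rightarrow> int fps" where
  "parry_upper \<beta> = Abs_fps (\<lambda>i. if i = 0 then - 1 else renyi_digit \<beta> i)"

definition parry_number :: "real \<Rightarrow> bool" where
  "parry_number \<beta> \<longleftrightarrow>
     (\<exists>N. \<forall>i>N. renyi_digit \<beta> i = 0) \<or>
     (\<exists>N p. 0 < p \<and> (\<forall>i>N. renyi_digit \<beta> (i + p) = renyi_digit \<beta> i))"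

definition complex_fps :: "int fps \<Rightarrow> complex fps" where
  "complex_fps F = Abs_fps (\<lambda>n. of_int (fps_nth F n))"

text \<open>
  \<open>F\<close> is meromorphic on the open unit disc and has no meromorphic continuation across any point of
  the unit circle.  Excluding meromorphic and excluding holomorphic continuation at every point of
  the circle are equivalent, since the poles of a meromorphic continuation near a point of the
  circle are isolated; the meromorphic formulation suits functions which may themselves have poles
  in the disc.
\<close>
definition unit_circle_natural_boundary :: "(complex \<Rightarrow> complex) \<Rightarrow> bool" where
  "unit_circle_natural_boundary F \<longleftrightarrow> F meromorphic_on ball 0 1 \<and>
     (\<forall>w r. norm w = 1 \<and> 0 < r \<longrightarrow>
        \<not> (\<exists>g. g meromorphic_on ball w r \<and>
               (\<forall>\<^sub>F z in cosparse (ball w r \<inter> ball 0 1). g z = F z)))"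

end

theory Submission
  imports Defs
begin

text \<open>
  Reciprocity of the minimal polynomial \<open>P\<close> is Smyth's theorem. If \<open>P\<close> is not reciprocal and
  \<open>\<bar>P(0)\<bar> = 1\<close>, then \<open>P(0) P / P\<^sup>* = f / g\<close> with \<open>f\<close> and \<open>g\<close> products of Blaschke factors over the zeros
  inside and outside the unit disc, \<open>f(0) = g(0) = c = 1 / M\<close>, and \<open>f / g = 1 + a\<^sub>k z\<^sup>k + \<dots>\<close> is an
  integer power series. Comparing coefficients under the contractivity constraints on \<open>f\<close> and \<open>g\<close>
  gives \<open>c\<^sup>3 + c\<^sup>2 \<le> 1\<close>, that is \<open>M\<^sup>3 \<ge> M + 1\<close>, which also identifies the smallest Pisot number as the
  real root of \<open>X\<^sup>3 - X - 1\<close>.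

  The form of the Parry Upper function follows from the orbit of \<open>1\<close>: after a digit \<open>1\<close> the remainder is
  at most \<open>\<beta> - 1\<close>, and it takes at least \<open>dyg \<beta> - 1\<close> multiplications by \<open>\<beta>\<close> to reach \<open>1\<close> again.

  The natural boundary is Szego's theorem on power series with finitely many distinct
  coefficients. If the coefficients are not eventually periodic, there are indices \<open>M\<^sub>j\<close>, \<open>N\<^sub>j\<close> whose
  \<open>j\<close> preceding coefficients agree while the coefficients at \<open>M\<^sub>j\<close> and \<open>N\<^sub>j\<close> differ. If the function
  continued across an arc, the differences of the corresponding shifted series would form a normal
  family on a domain across the arc tending to \<open>0\<close> outside the unit disc, hence everywhere,
  contradicting their values at the origin.

  The quotient \<open>P / f\<^sub>\<beta>\<close> has no pole in \<open>\<bar>z\<bar> < 1 / \<beta>\<close>, because the digits are nonnegative and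
  \<open>\<Sum>t\<^sub>i \<beta>\<^sup>-\<^sup>i \<le> 1\<close>.
\<close>

section \<open>Contractive power series and Smyth's inequality\<close>

text \<open>
  These are the expansions of the analytic functions bounded by \<open>1\<close> on the unit disc (Schur functions),
  expressed through the truncated Toeplitz operators so that no analysis is needed.
\<close>
definition contractive :: "'a :: real_normed_field fps \<Rightarrow> bool" where
  "contractive f \<longleftrightarrow>
     (\<forall>h N. (\<Sum>n\<le>N. (norm (fps_nth (f * h) n))\<^sup>2) \<le> (\<Sum>n\<le>N. (norm (fps_nth h n))\<^sup>2))"

lemma contractive_mult:
  assumes "contractive f" "contractive g"
  shows "contractive (f * g)"
  using assms unfolding contractive_def mult.assoc by (meson order_trans)

lemma contractive_const:
  assumes "norm a \<le> 1"
  shows "contractive (fps_const a)"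
  unfolding contractive_def
proof (intro allI sum_mono)
  fix h :: "'a fps" and n
  have "norm a * norm (fps_nth h n) \<le> 1 * norm (fps_nth h n)"
    using assms by (intro mult_right_mono) auto
  thus "(norm (fps_nth (fps_const a * h) n))\<^sup>2 \<le> (norm (fps_nth h n))\<^sup>2"
    by (simp add: norm_mult power_mono)
qed

lemma contractive_prod_list:
  assumes "\<And>x. x \<in> set xs \<Longrightarrow> contractive (f x)"
  shows "contractive (\<Prod>x\<leftarrow>xs. f x)"
  using assms
proof (induction xs)
  case Nil
  show ?case using contractive_const[of 1] by simp
next
  case (Cons x xs)
  thus ?case by (simp add: contractive_mult)
qed

text \<open>Writing \<open>y\<close> for \<open>f * h\<close>, the coefficient recurrence makes the
  energy loss telescope: the deficit over the indices below \<open>N\<close>, times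
  \<open>1 - |a|^2\<close>, is the single square \<open>|y_N + a h_N|^2\<close>.\<close>

lemma contractive_blaschke:
  fixes f :: "complex fps"
  assumes a: "norm a < 1"
    and f: "f * (1 - fps_const (cnj a) * fps_X) = fps_X - fps_const a"
  shows "contractive f"
  unfolding contractive_def
proof (intro allI)
  fix h :: "complex fps" and N
  define y where "y = f * h"
  have "y * (1 - fps_const (cnj a) * fps_X) = (fps_X - fps_const a) * h"
    unfolding y_def using f by (metis mult.assoc mult.commute)
  hence eq: "fps_nth (y * (1 - fps_const (cnj a) * fps_X)) n = fps_nth ((fps_X - fps_const a) * h) n" for n
    by simp
  have eq0: "fps_nth y 0 + a * fps_nth h 0 = 0"
    using eq[of 0] by (simp add: algebra_simps)
  have eqS: "fps_nth y (Suc n) + a * fps_nth h (Suc n) = cnj a * fps_nth y n + fps_nth h n" for n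
    using eq[of "Suc n"] by (simp add: algebra_simps)
  have id: "(norm (cnj a * z + x))\<^sup>2 - (norm (z + a * x))\<^sup>2 = (1 - (norm a)\<^sup>2) * ((norm x)\<^sup>2 - (norm z)\<^sup>2)"
    for x z
    unfolding cmod_power2 by (simp add: algebra_simps power2_eq_square)
  have key: "(1 - (norm a)\<^sup>2) * (\<Sum>n<N. (norm (fps_nth h n))\<^sup>2 - (norm (fps_nth y n))\<^sup>2) =
        (norm (fps_nth y N + a * fps_nth h N))\<^sup>2" for N
  proof (induction N)
    case 0
    show ?case using eq0 by simp
  next
    case (Suc N)
    show ?case
      using Suc id[of "fps_nth y N" "fps_nth h N"] unfolding eqS
      by (simp add: algebra_simps)
  qed
  have "0 \<le> (1 - (norm a)\<^sup>2) * (\<Sum>n<Suc N. (norm (fps_nth h n))\<^sup>2 - (norm (fps_nth y n))\<^sup>2)"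
    unfolding key by simp
  moreover have "0 < 1 - (norm a)\<^sup>2"
    using a by (simp add: power_less_one_iff)
  ultimately have "0 \<le> (\<Sum>n<Suc N. (norm (fps_nth h n))\<^sup>2 - (norm (fps_nth y n))\<^sup>2)"
    by (simp add: zero_le_mult_iff)
  thus "(\<Sum>n\<le>N. (norm (fps_nth (f * h) n))\<^sup>2) \<le> (\<Sum>n\<le>N. (norm (fps_nth h n))\<^sup>2)"
    by (simp only: lessThan_Suc_atMost sum_subtractf y_def)
qed

text \<open>Real parts commute with multiplication by a real test series. This replaces complex
  Blaschke products by real series without disturbing their quotient, which has integer
  coefficients.\<close>

lemma contractive_Re:
  assumes "contractive f"
  shows "contractive (Abs_fps (\<lambda>n. Re (fps_nth f n)))"
  unfolding contractive_def
proof (intro allI)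
  fix h :: "real fps" and N
  define h' where "h' = Abs_fps (\<lambda>n. complex_of_real (fps_nth h n))"
  have "fps_nth (Abs_fps (\<lambda>n. Re (fps_nth f n)) * h) n = Re (fps_nth (f * h') n)" for n
    by (simp add: fps_mult_nth h'_def)
  hence "(\<Sum>n\<le>N. (norm (fps_nth (Abs_fps (\<lambda>n. Re (fps_nth f n)) * h) n))\<^sup>2)
      \<le> (\<Sum>n\<le>N. (norm (fps_nth (f * h') n))\<^sup>2)"
    by (intro sum_mono) (simp add: cmod_power2)
  also have "\<dots> \<le> (\<Sum>n\<le>N. (norm (fps_nth h' n))\<^sup>2)"
    using assms unfolding contractive_def by blast
  finally show "(\<Sum>n\<le>N. (norm (fps_nth (Abs_fps (\<lambda>n. Re (fps_nth f n)) * h) n))\<^sup>2)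
      \<le> (\<Sum>n\<le>N. (norm (fps_nth h n))\<^sup>2)"
    by (simp add: h'_def)
qed

text \<open>The form used with explicit test vectors: outputs outside \<open>S\<close> are discarded
  squares, while the input energy is exact because \<open>h\<close> is supported on
  \<open>T\<close>.\<close>

lemma contractiveD:
  fixes f h :: "real fps"
  assumes f: "contractive f" and "finite S" "finite T"
    and h: "\<And>n. n \<notin> T \<Longrightarrow> fps_nth h n = 0"
  shows "(\<Sum>n\<in>S. (fps_nth (f * h) n)\<^sup>2) \<le> (\<Sum>n\<in>T. (fps_nth h n)\<^sup>2)"
proof -
  define N where "N = Max (insert 0 (S \<union> T))"
  have N: "S \<subseteq> {..N}" "T \<subseteq> {..N}"
    using assms(2,3) by (auto simp: N_def)
  have "(\<Sum>n\<in>S. (fps_nth (f * h) n)\<^sup>2) \<le> (\<Sum>n\<le>N. (fps_nth (f * h) n)\<^sup>2)"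
    using N by (intro sum_mono2) auto
  also have "\<dots> \<le> (\<Sum>n\<le>N. (fps_nth h n)\<^sup>2)"
    using f unfolding contractive_def by (simp add: power2_abs)
  also have "\<dots> = (\<Sum>n\<in>T. (fps_nth h n)\<^sup>2)"
    using N h by (intro sum.mono_neutral_right) auto
  finally show ?thesis .
qed

text \<open>
  A pair \<open>F + H\<close>, \<open>F - H\<close> of contractive series makes the block operator with rows \<open>(F, H)\<close>, \<open>(H, F)\<close>
  a contraction; unlike separate bounds for the two series, this uses that they agree up to \<open>H\<close>.
\<close>
lemma contractive_pairD:
  fixes f g p q :: "real fps"
  assumes fg: "contractive f" "contractive g"
    and F: "f = F + H" "g = F - H"
    and fin: "finite S" "finite S'" "finite T" "finite T'"
    and p: "\<And>n. n \<notin> T \<Longrightarrow> fps_nth p n = 0"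
    and q: "\<And>n. n \<notin> T' \<Longrightarrow> fps_nth q n = 0"
  shows "(\<Sum>n\<in>S. (fps_nth (F * p + H * q) n)\<^sup>2) + (\<Sum>n\<in>S'. (fps_nth (F * q + H * p) n)\<^sup>2) \<le>
         (\<Sum>n\<in>T. (fps_nth p n)\<^sup>2) + (\<Sum>n\<in>T'. (fps_nth q n)\<^sup>2)"
proof -
  define U where "U = S \<union> S' \<union> T \<union> T'"
  have U: "finite U" using fin by (auto simp: U_def)
  define A B where "A = F * p + H * q" and "B = F * q + H * p"
  have fp: "f * (p + q) = A + B" and gp: "g * (p - q) = A - B"
    by (simp_all add: F A_def B_def algebra_simps)
  have "(\<Sum>n\<in>U. (fps_nth (f * (p + q)) n)\<^sup>2) \<le> (\<Sum>n\<in>U. (fps_nth (p + q) n)\<^sup>2)"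
    using p q by (intro contractiveD fg U) (auto simp: U_def)
  moreover have "(\<Sum>n\<in>U. (fps_nth (g * (p - q)) n)\<^sup>2) \<le> (\<Sum>n\<in>U. (fps_nth (p - q) n)\<^sup>2)"
    using p q by (intro contractiveD fg U) (auto simp: U_def)
  ultimately have "(\<Sum>n\<in>U. (fps_nth A n)\<^sup>2) + (\<Sum>n\<in>U. (fps_nth B n)\<^sup>2) \<le>
      (\<Sum>n\<in>U. (fps_nth p n)\<^sup>2) + (\<Sum>n\<in>U. (fps_nth q n)\<^sup>2)"
    unfolding fp gp
    by (simp add: power2_sum power2_diff sum.distrib sum_subtractf)
  moreover have "(\<Sum>n\<in>S. (fps_nth A n)\<^sup>2) \<le> (\<Sum>n\<in>U. (fps_nth A n)\<^sup>2)"
    "(\<Sum>n\<in>S'. (fps_nth B n)\<^sup>2) \<le> (\<Sum>n\<in>U. (fps_nth B n)\<^sup>2)"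
    using U by (auto intro!: sum_mono2 simp: U_def)
  moreover have "(\<Sum>n\<in>U. (fps_nth p n)\<^sup>2) = (\<Sum>n\<in>T. (fps_nth p n)\<^sup>2)"
     "(\<Sum>n\<in>U. (fps_nth q n)\<^sup>2) = (\<Sum>n\<in>T'. (fps_nth q n)\<^sup>2)"
    using p q U by (auto intro!: sum.mono_neutral_right simp: U_def)
  ultimately show ?thesis unfolding A_def B_def by linarith
qed

lemma contractive_coeff_bound:
  fixes f :: "real fps"
  assumes f: "contractive f" and "0 < k"
  shows "\<bar>fps_nth f k\<bar> \<le> 1 - (fps_nth f 0)\<^sup>2"
proof -
  define c b where "c = fps_nth f 0" and "b = fps_nth f k"
  \<comment> \<open>\<open>1 \<plusminus> c X\<^sup>k\<close> is the vector on which the truncated operator is isometric in the extremal case.\<close>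
  have *: "(b + u * c)\<^sup>2 \<le> 1" if u: "u\<^sup>2 = c\<^sup>2" for u
  proof -
    define h where "h = 1 + fps_const u * fps_X ^ k"
    have "(\<Sum>n\<in>{0,k}. (fps_nth (f * h) n)\<^sup>2) \<le> (\<Sum>n\<in>{0,k}. (fps_nth h n)\<^sup>2)"
      by (intro contractiveD f) (auto simp: h_def)
    moreover have "f * h = f + fps_const u * (f * fps_X ^ k)"
      by (simp add: h_def algebra_simps)
    ultimately show ?thesis
      using \<open>0 < k\<close> u by (simp add: fps_X_power_mult_right_nth c_def b_def h_def)
  qed
  from *[of c] *[of "-c"] have "\<bar>b + c\<^sup>2\<bar> \<le> 1" "\<bar>b - c\<^sup>2\<bar> \<le> 1"
    by (simp_all add: power2_eq_square abs_square_le_1[unfolded power2_eq_square])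
  thus ?thesis by (simp add: c_def b_def)
qed

text \<open>
  The multipliers \<open>1 + u X\<^sup>k \<plusminus> c X\<^sup>2\<^sup>k\<close> are the extremal vectors of the Schur--Pick conditions on
  the coefficients at \<open>0\<close>, \<open>k\<close>, \<open>2 k\<close>.
\<close>
lemma contractive_coeff_double_bound:
  fixes f :: "real fps"
  assumes f: "contractive f" and "0 < k"
  defines "c \<equiv> fps_nth f 0" and "b \<equiv> fps_nth f k"
  assumes c: "0 < c" "c < 1"
  shows "fps_nth f (2 * k) \<le> 1 - c\<^sup>2 - b\<^sup>2 / (1 - c)"
    and "b\<^sup>2 / (1 + c) - (1 - c\<^sup>2) \<le> fps_nth f (2 * k)"
proof -
  define x where "x = fps_nth f (2 * k)"
  have *: "c\<^sup>2 + (b + u * c)\<^sup>2 + (x + u * b + v * c)\<^sup>2 \<le> 1 + u\<^sup>2 + v\<^sup>2" for u v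
  proof -
    define h where "h = 1 + fps_const u * fps_X ^ k + fps_const v * fps_X ^ (2 * k)"
    have "(\<Sum>n\<in>{0,k,2*k}. (fps_nth (f * h) n)\<^sup>2) \<le> (\<Sum>n\<in>{0,k,2*k}. (fps_nth h n)\<^sup>2)"
      by (intro contractiveD f) (auto simp: h_def)
    moreover have "f * h = f + fps_const u * (f * fps_X ^ k) + fps_const v * (f * fps_X ^ (2 * k))"
      by (simp add: h_def algebra_simps)
    ultimately show ?thesis
      using \<open>0 < k\<close> by (simp add: fps_X_power_mult_right_nth c_def b_def x_def h_def)
  qed
  define u where "u = b / (1 - c)"
  have "b + u * c = u" using c by (simp add: u_def field_simps)
  with *[of u c] have "(x + u * b + c\<^sup>2)\<^sup>2 \<le> 1" by (simp add: power2_eq_square)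
  hence "\<bar>x + u * b + c\<^sup>2\<bar> \<le> 1" by (simp only: abs_square_le_1)
  thus "fps_nth f (2 * k) \<le> 1 - c\<^sup>2 - b\<^sup>2 / (1 - c)"
    by (simp add: x_def u_def power2_eq_square)
  define u where "u = - b / (1 + c)"
  have "b + u * c = - u" using c by (simp add: u_def field_simps)
  with *[of u "-c"] have "(x + u * b - c\<^sup>2)\<^sup>2 \<le> 1" by (simp add: power2_eq_square)
  hence "\<bar>x + u * b - c\<^sup>2\<bar> \<le> 1" by (simp only: abs_square_le_1)
  thus "b\<^sup>2 / (1 + c) - (1 - c\<^sup>2) \<le> fps_nth f (2 * k)"
    by (simp add: x_def u_def power2_eq_square)
qed

section \<open>Smyth's coefficient comparison\<close>

lemma fps_mult_sparse_nth:
  fixes g a :: "'a :: comm_ring_1 fps"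
  assumes "0 < k" "k < n" "n \<le> 2 * k"
    and a0: "fps_nth a 0 = 1"
    and a: "\<And>i. \<lbrakk>0 < i; i < n; i \<noteq> k\<rbrakk> \<Longrightarrow> fps_nth a i = 0"
  shows "fps_nth (g * a) n = fps_nth g n + fps_nth g (n - k) * fps_nth a k + fps_nth g 0 * fps_nth a n"
proof -
  have "fps_nth (g * a) n = (\<Sum>i=0..n. fps_nth g i * fps_nth a (n - i))"
    by (simp add: fps_mult_nth)
  also have "\<dots> = (\<Sum>i\<in>{n, n - k, 0}. fps_nth g i * fps_nth a (n - i))"
  proof (intro sum.mono_neutral_right ballI)
    fix i assume "i \<in> {0..n} - {n, n - k, 0}"
    hence "fps_nth a (n - i) = 0" using assms(1-3) by (intro a) auto
    thus "fps_nth g i * fps_nth a (n - i) = 0" by simp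
  qed auto
  finally show ?thesis using assms by simp
qed

lemma fps_mult_first_nth:
  fixes g a :: "'a :: comm_ring_1 fps"
  assumes "0 < n" and a0: "fps_nth a 0 = 1"
    and a: "\<And>i. \<lbrakk>0 < i; i < n\<rbrakk> \<Longrightarrow> fps_nth a i = 0"
  shows "fps_nth (g * a) n = fps_nth g n + fps_nth g 0 * fps_nth a n"
proof -
  have "fps_nth (g * a) n = (\<Sum>i=0..n. fps_nth g i * fps_nth a (n - i))"
    by (simp add: fps_mult_nth)
  also have "\<dots> = (\<Sum>i\<in>{n, 0}. fps_nth g i * fps_nth a (n - i))"
    using assms by (intro sum.mono_neutral_right) auto
  finally show ?thesis using assms by simp
qed

text \<open>Here the quotient of \<open>f\<close> by \<open>g\<close> starts
  \<open>1 + X^k + a X^l\<close> with \<open>l\<close> strictly between \<open>k\<close> and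
  \<open>2 k\<close>. A first test vector shows that the common coefficient \<open>x\<close> is
  small; a second one then leaves no room for a term \<open>c a\<close> of size at least
  \<open>c\<close>.\<close>

lemma smyth_early_second_term:
  fixes f g :: "real fps" and a c x :: real
  assumes f: "contractive f" and g: "contractive g"
    and kl: "k < l" "l < 2 * k"
    and eq: "\<And>i. i < k \<Longrightarrow> fps_nth f i = fps_nth g i"
    and c: "fps_nth f 0 = c" "0 < c" "c < 1"
    and fk: "fps_nth f k = fps_nth g k + c"
    and x: "fps_nth g (l - k) = x"
    and fl: "fps_nth f l = fps_nth g l + x + c * a"
    and a: "1 \<le> \<bar>a\<bar>"
  shows "c ^ 3 + c\<^sup>2 \<le> 1"
proof (rule ccontr)
  assume contra: "\<not> c ^ 3 + c\<^sup>2 \<le> 1"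
  define j where "j = l - k"
  have j: "0 < j" "j < k" "l = k + j" using kl by (auto simp: j_def)
  \<comment> \<open>The half-sum carries the common part; the half-difference \<open>H\<close>
    starts only at \<open>k\<close>, with coefficient \<open>c / 2\<close>.\<close>
  define F H where "F = fps_const (1/2) * (f + g)" and "H = fps_const (1/2) * (f - g)"
  have FH: "f = F + H" "g = F - H"
    by (rule fps_ext; simp only: F_def H_def fps_add_nth fps_sub_nth fps_mult_left_const_nth;
        simp add: field_simps)+
  have F: "fps_nth F i = fps_nth g i" and H: "fps_nth H i = 0" if "i < k" for i
    using eq[OF that] by (simp_all add: F_def H_def)
  have F0: "fps_nth F 0 = c" using F[of 0] eq[of 0] c j by simp
  have Fj: "fps_nth F j = x" using F[OF j(2)] x by (simp add: j_def)
  have Hk: "fps_nth H k = c / 2" using fk by (simp add: H_def)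
  define w where "w = 1 - c\<^sup>2"
  have "\<bar>fps_nth f k\<bar> \<le> w" "\<bar>fps_nth g k\<bar> \<le> w"
    using contractive_coeff_bound[OF f, of k] contractive_coeff_bound[OF g, of k] eq[of 0] c j
    by (auto simp: w_def)
  hence w: "c / 2 \<le> w" using fk by linarith
  hence w0: "w > 0" using c by linarith

  \<comment> \<open>The common coefficient \<open>x\<close> must be small, since the coefficients at \<open>k\<close> differ by as much as \<open>c\<close>.\<close>
  have x2: "x\<^sup>2 \<le> w * (w - c / 2)"
  proof -
    \<comment> \<open>\<open>s\<close> solves \<open>x + c^2 s = s\<close>. Three outputs
      \<open>c\<close>, \<open>s\<close>, \<open>s c\<close> of the test vector then cancel against
      equal inputs, which leaves \<open>(c / 2 + s x + c^2)^2 \<le> 1\<close>.\<close>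
    define s where "s = x / w"
    have xs: "x = w * s" using w0 by (simp add: s_def)
    define p where "p = 1 + fps_const (c * s) * fps_X ^ j"
    define q where "q = fps_const s * fps_X ^ (k - j) + fps_const c * fps_X ^ k"
    have "(\<Sum>n\<in>{0,j}. (fps_nth (F * p + H * q) n)\<^sup>2) + (\<Sum>n\<in>{k-j,k}. (fps_nth (F * q + H * p) n)\<^sup>2) \<le>
         (\<Sum>n\<in>{0,j}. (fps_nth p n)\<^sup>2) + (\<Sum>n\<in>{k-j,k}. (fps_nth q n)\<^sup>2)"
      by (intro contractive_pairD[OF f g FH]) (auto simp: p_def q_def)
    moreover have e1: "F * p + H * q = F + fps_const (c * s) * (F * fps_X ^ j) +
        fps_const s * (H * fps_X ^ (k - j)) + fps_const c * (H * fps_X ^ k)"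
      by (simp add: p_def q_def algebra_simps)
    have "fps_nth (F * p + H * q) 0 = c" "fps_nth (F * p + H * q) j = x + c * s * c"
      unfolding e1 using j F0 Fj H by (simp_all add: fps_X_power_mult_right_nth)
    moreover have e2: "F * q + H * p = H + fps_const (c * s) * (H * fps_X ^ j) +
        fps_const s * (F * fps_X ^ (k - j)) + fps_const c * (F * fps_X ^ k)"
      by (simp add: p_def q_def algebra_simps)
    have "fps_nth (F * q + H * p) (k - j) = s * c" "fps_nth (F * q + H * p) k = c / 2 + s * x + c * c"
      unfolding e2 using j F0 Fj Hk H by (simp_all add: fps_X_power_mult_right_nth)
    moreover have "fps_nth p 0 = 1" "fps_nth p j = c * s" "fps_nth q (k - j) = s" "fps_nth q k = c"
      using j by (simp_all add: p_def q_def)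
    ultimately have "c\<^sup>2 + (x + c * s * c)\<^sup>2 + (s * c)\<^sup>2 + (c / 2 + s * x + c * c)\<^sup>2 \<le>
        1 + (c * s)\<^sup>2 + s\<^sup>2 + c\<^sup>2"
      using j by simp
    moreover have "x + c * s * c = s" by (simp add: xs w_def algebra_simps power2_eq_square)
    ultimately have "(c / 2 + s * x + c * c)\<^sup>2 \<le> 1" by (simp add: power_mult_distrib)
    hence "\<bar>c / 2 + s * x + c * c\<bar> \<le> 1" by (simp only: abs_square_le_1)
    hence "s * x \<le> w - c / 2" by (simp add: w_def power2_eq_square)
    hence "w * (s * x) \<le> w * (w - c / 2)" using w0 by (intro mult_left_mono) auto
    thus ?thesis by (simp add: xs power2_eq_square)
  qed

  define E where "E = x + c * a / 2"
  define v where "v = c * E / w" \<comment> \<open>maximises \<open>(E + v c)\<^sup>2 - v\<^sup>2\<close>\<close>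
  have main: "c\<^sup>2 + (c\<^sup>2 + (E + v * c)\<^sup>2) \<le> 1 + ((1/2)\<^sup>2 + v\<^sup>2)"
  proof -
    \<comment> \<open>The weight \<open>1/2\<close> raises the output at \<open>k\<close> from
      \<open>c / 2\<close> to \<open>c\<close> and completes the \<open>x / 2\<close> of
      \<open>H\<close> at \<open>l\<close> to \<open>x\<close>, so that the output at
      \<open>l\<close> is \<open>E + v c\<close>.\<close>
    define q where "q = fps_const (1/2) * fps_X ^ k + fps_const v * fps_X ^ l"
    have "(\<Sum>n\<in>{0}. (fps_nth (F * 1 + H * q) n)\<^sup>2) + (\<Sum>n\<in>{k,l}. (fps_nth (F * q + H * 1) n)\<^sup>2) \<le>
         (\<Sum>n\<in>{0}. (fps_nth (1::real fps) n)\<^sup>2) + (\<Sum>n\<in>{k,l}. (fps_nth q n)\<^sup>2)"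
      by (intro contractive_pairD[OF f g FH]) (auto simp: q_def)
    moreover have e1: "F * 1 + H * q = F + fps_const (1/2) * (H * fps_X ^ k) + fps_const v * (H * fps_X ^ l)"
      by (simp add: q_def algebra_simps)
    have "fps_nth (F * 1 + H * q) 0 = c"
      unfolding e1 using j F0 H by (simp add: fps_X_power_mult_right_nth)
    moreover have e2: "F * q + H * 1 = H + fps_const (1/2) * (F * fps_X ^ k) + fps_const v * (F * fps_X ^ l)"
      by (simp add: q_def algebra_simps)
    have Hl: "fps_nth H l = x / 2 + c * a / 2" using fl by (simp add: H_def)
    have "fps_nth (F * q + H * 1) k = c" "fps_nth (F * q + H * 1) l = E + v * c"
      unfolding e2 using j F0 Fj Hk Hl by (simp_all add: fps_X_power_mult_right_nth E_def)
    moreover have "fps_nth q k = 1 / 2" "fps_nth q l = v"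
      using j by (simp_all add: q_def)
    ultimately show ?thesis
      using j by simp
  qed
  have "(E + v * c)\<^sup>2 - v\<^sup>2 = E\<^sup>2 / w"
  proof -
    define r where "r = E / w"
    have E: "E = w * r" and v: "v = c * r" using w0 by (simp_all add: r_def v_def)
    have "E + v * c = r" unfolding E v by (simp add: w_def algebra_simps power2_eq_square)
    hence "(E + v * c)\<^sup>2 - v\<^sup>2 = w * r\<^sup>2"
      by (simp add: v w_def algebra_simps power2_eq_square)
    also have "\<dots> = E\<^sup>2 / w" using w0 by (simp add: E power2_eq_square)
    finally show ?thesis .
  qed
  moreover have "c\<^sup>2 + (c\<^sup>2 + (E + v * c)\<^sup>2) \<le> 1 + (1 / 4 + v\<^sup>2)"
    using main by (simp add: power_divide)
  ultimately have le: "2 * c\<^sup>2 + E\<^sup>2 / w \<le> 5 / 4" by linarith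

  \<comment> \<open>The constant is just below the root 0.75487... of \<open>c^3 + c^2 = 1\<close>.
    It yields the decimal bounds for \<open>c^2\<close>, \<open>w\<close>, \<open>x\<close> and
    \<open>E\<close> in turn; the resulting lower bound for \<open>2 c^2 + E^2 / w\<close> exceeds
    5/4 by less than 0.01.\<close>
  have c1: "c > 0.7548"
  proof (rule ccontr)
    assume "\<not> c > 0.7548"
    hence "c ^ 3 \<le> 0.7548 ^ 3" "c\<^sup>2 \<le> 0.7548\<^sup>2" using c by (auto intro!: power_mono)
    hence "c ^ 3 + c\<^sup>2 \<le> 0.7548 ^ 3 + 0.7548\<^sup>2" by linarith
    also have "\<dots> \<le> 1" by (simp add: power2_eq_square power3_eq_cube)
    finally show False using contra by simp
  qed
  have c2: "c\<^sup>2 \<ge> 0.5697"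
  proof -
    have "c\<^sup>2 \<ge> 0.7548\<^sup>2" using c1 by (intro power_mono) auto
    thus ?thesis by (simp add: power2_eq_square)
  qed
  have "w \<le> 0.4303" using c2 by (simp add: w_def)
  have "x\<^sup>2 \<le> 0.4303 * 0.0529"
  proof -
    have "w * (w - c / 2) \<le> 0.4303 * 0.0529"
      using w w0 c1 \<open>w \<le> 0.4303\<close> by (intro mult_mono) auto
    thus ?thesis using x2 by linarith
  qed
  also have "\<dots> \<le> 0.1513\<^sup>2" by (simp add: power2_eq_square)
  finally have "\<bar>x\<bar> \<le> 0.1513" by (simp add: abs_le_square_iff[symmetric])
  moreover have "\<bar>c * a / 2\<bar> \<ge> 0.3774"
  proof -
    have "c * 1 \<le> c * \<bar>a\<bar>" using a c by (intro mult_left_mono) auto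
    moreover have "\<bar>c * a / 2\<bar> = c * \<bar>a\<bar> / 2" using c by (simp add: abs_mult)
    ultimately show ?thesis using c1 by linarith
  qed
  ultimately have "\<bar>E\<bar> \<ge> 0.2261" unfolding E_def by linarith
  hence "0.2261\<^sup>2 \<le> \<bar>E\<bar>\<^sup>2" by (intro power_mono) auto
  hence "0.0511 \<le> E\<^sup>2" by (simp add: power2_eq_square)
  hence "0.0511 / 0.4303 \<le> E\<^sup>2 / w"
    using w0 \<open>w \<le> 0.4303\<close> by (intro frac_le) auto
  with le c2 show False by simp
qed

text \<open>No second term before \<open>2 k\<close>: the upper Schur bound for one series at
  \<open>2 k\<close> is played against the lower bound for the other, and the sign of
  \<open>a\<close> decides which is which.\<close>

lemma smyth_late_second_term:
  fixes f g :: "real fps" and a :: int and c :: real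
  assumes f: "contractive f" and g: "contractive g" and "0 < k"
    and c: "fps_nth f 0 = c" "fps_nth g 0 = c" "0 < c" "c < 1"
    and fk: "fps_nth f k = fps_nth g k + c"
    and f2k: "fps_nth f (2 * k) = fps_nth g (2 * k) + fps_nth g k + c * of_int a"
  shows "c ^ 3 + c\<^sup>2 \<le> 1"
proof -
  \<comment> \<open>Both signs of \<open>a\<close> lead to this inequality: \<open>b\<close> is the
    coefficient of \<open>f\<close> at \<open>k\<close> if \<open>a \<ge> 1\<close>, and minus the
    coefficient of \<open>g\<close> at \<open>k\<close> if \<open>a \<le> 0\<close>.\<close>
  have key: "c ^ 3 + c\<^sup>2 \<le> 1"
    if "b + b\<^sup>2 / (1 - c) + (c - b)\<^sup>2 / (1 + c) \<le> 2 * (1 - c\<^sup>2)" "c - (1 - c\<^sup>2) \<le> b" for b :: real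
  proof (cases "0 < c\<^sup>2 + c - 1")
    case True
    define w where "w = 1 - c\<^sup>2"
    have w: "w > 0" "w = (1 - c) * (1 + c)"
      using c by (auto simp: w_def power2_eq_square power_less_one_iff algebra_simps abs_square_less_1[unfolded power2_eq_square])
    have "w * (b + b\<^sup>2 / (1 - c) + (c - b)\<^sup>2 / (1 + c)) \<le> w * (2 * w)"
      using that(1) w unfolding w_def by (intro mult_left_mono) auto
    moreover have "w * (b\<^sup>2 / (1 - c)) = (1 + c) * b\<^sup>2" "w * ((c - b)\<^sup>2 / (1 + c)) = (1 - c) * (c - b)\<^sup>2"
      using c unfolding w(2) by auto
    ultimately have "w * b + (1 + c) * b\<^sup>2 + (1 - c) * (c - b)\<^sup>2 \<le> 2 * w\<^sup>2"
      by (simp add: distrib_left power2_eq_square)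
    hence 1: "2 * b\<^sup>2 + (1 - c)\<^sup>2 * b + c\<^sup>2 * (1 - c) - 2 * w\<^sup>2 \<le> 0"
      by (simp add: w_def algebra_simps power2_eq_square)
    \<comment> \<open>The quadratic in \<open>1\<close> increases for positive \<open>b\<close>, so
      it is still at most 0 at the least admissible value \<open>c^2 + c - 1\<close>, where it
      factors as \<open>(c + 1) (c^3 + c^2 - 1)\<close>.\<close>
    have b: "c\<^sup>2 + c - 1 \<le> b" using that(2) by simp
    have "(c\<^sup>2 + c - 1)\<^sup>2 \<le> b\<^sup>2" using b True by (intro power_mono) auto
    moreover have "(1 - c)\<^sup>2 * (c\<^sup>2 + c - 1) \<le> (1 - c)\<^sup>2 * b" using b by (intro mult_left_mono) auto
    ultimately have "2 * (c\<^sup>2 + c - 1)\<^sup>2 + (1 - c)\<^sup>2 * (c\<^sup>2 + c - 1) + c\<^sup>2 * (1 - c) - 2 * w\<^sup>2 \<le> 0"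
      using 1 by linarith
    moreover have "2 * (c\<^sup>2 + c - 1)\<^sup>2 + (1 - c)\<^sup>2 * (c\<^sup>2 + c - 1) + c\<^sup>2 * (1 - c) - 2 * w\<^sup>2 =
        (c + 1) * (c ^ 3 + c\<^sup>2 - 1)"
      unfolding w_def by (simp add: algebra_simps power2_eq_square power3_eq_cube)
    ultimately have "c ^ 3 + c\<^sup>2 - 1 \<le> 0" using c by (simp add: mult_le_0_iff)
    thus ?thesis by simp
  next
    case False
    have "c ^ 3 \<le> c ^ 1" using c by (intro power_decreasing) auto
    thus ?thesis using False by simp
  qed
  define b where "b = fps_nth f k"
  have gk: "fps_nth g k = b - c" using fk by (simp add: b_def)
  have bd: "\<bar>b\<bar> \<le> 1 - c\<^sup>2" "\<bar>b - c\<bar> \<le> 1 - c\<^sup>2"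
    using contractive_coeff_bound[OF f \<open>0 < k\<close>] contractive_coeff_bound[OF g \<open>0 < k\<close>] c gk
    by (auto simp: b_def)
  note F = contractive_coeff_double_bound[OF f \<open>0 < k\<close>, unfolded c(1), OF c(3,4), folded b_def]
  note G = contractive_coeff_double_bound[OF g \<open>0 < k\<close>, unfolded c(2) gk, OF c(3,4)]
  have sq: "(c - b)\<^sup>2 = (b - c)\<^sup>2" by (simp add: power2_commute)
  show ?thesis
  proof (cases "a \<ge> 1")
    case True
    have "c * 1 \<le> c * real_of_int a" using True c by (intro mult_left_mono) auto
    with F(1) G(2) f2k gk show ?thesis
      using bd by (intro key[of b]) (auto simp: sq)
  next
    case False
    have "c * real_of_int a \<le> c * 0" using False c by (intro mult_left_mono) auto
    with F(2) G(1) f2k gk show ?thesis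
      using bd by (intro key[of "c - b"]) (auto simp: sq)
  qed
qed

text \<open>If the first nonconstant coefficient of \<open>A\<close> is at least 2, the bound
  \<open>1 - c^2\<close> at index \<open>k\<close> suffices. If it is 1, either a nonzero
  coefficient strictly between \<open>k\<close> and \<open>2 k\<close> or the comparison at
  \<open>2 k\<close> decides.\<close>

lemma smyth_core_pos:
  fixes f g :: "real fps" and A :: "int fps" and c :: real
  assumes f: "contractive f" and g: "contractive g"
    and c: "fps_nth f 0 = c" "fps_nth g 0 = c" "0 < c" "c < 1"
    and fg: "f = g * Abs_fps (\<lambda>n. of_int (fps_nth A n))"
    and A0: "fps_nth A 0 = 1" and "0 < k" and Ak: "1 \<le> fps_nth A k"
    and A: "\<And>i. \<lbrakk>0 < i; i < k\<rbrakk> \<Longrightarrow> fps_nth A i = 0"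
  shows "c ^ 3 + c\<^sup>2 \<le> 1"
proof (cases "fps_nth A k = 1")
  case Ak: True
  define a where "a = Abs_fps (\<lambda>n. real_of_int (fps_nth A n))"
  have first: "fps_nth f n = fps_nth g n + c * fps_nth a n" if "0 < n" "n \<le> k" for n
    unfolding fg a_def[symmetric] c(2)[symmetric]
    using A0 A that by (intro fps_mult_first_nth) (auto simp: a_def)
  have eq: "fps_nth f i = fps_nth g i" if "i < k" for i
    using first[of i] A[of i] c that by (cases "i = 0") (auto simp: a_def)
  have fk: "fps_nth f k = fps_nth g k + c"
    using first[of k] Ak \<open>0 < k\<close> by (simp add: a_def)
  have sparse: "fps_nth f n = fps_nth g n + fps_nth g (n - k) + c * fps_nth a n"
    if "k < n" "n \<le> 2 * k" "\<And>i. k < i \<Longrightarrow> i < n \<Longrightarrow> fps_nth A i = 0" for n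
  proof -
    have "fps_nth a i = 0" if "0 < i" "i < n" "i \<noteq> k" for i
      using that A[of i] \<open>\<And>i. k < i \<Longrightarrow> i < n \<Longrightarrow> fps_nth A i = 0\<close>[of i] by (cases "i < k") (auto simp: a_def)
    from fps_mult_sparse_nth[OF \<open>0 < k\<close> that(1,2) _ this, of g] show ?thesis
      using A0 Ak c by (simp add: fg a_def)
  qed
  show ?thesis
  proof (cases "\<exists>l. k < l \<and> l < 2 * k \<and> fps_nth A l \<noteq> 0")
    case True
    define l where "l = (LEAST l. k < l \<and> l < 2 * k \<and> fps_nth A l \<noteq> 0)"
    have l: "k < l" "l < 2 * k" "fps_nth A l \<noteq> 0"
      using LeastI_ex[OF True] by (auto simp: l_def)
    have min: "fps_nth A i = 0" if "k < i" "i < l" for i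
      using not_less_Least[of i "\<lambda>l. k < l \<and> l < 2 * k \<and> fps_nth A l \<noteq> 0"] that l
      by (auto simp: l_def)
    have "1 \<le> \<bar>fps_nth A l\<bar>" using l(3) by linarith
    hence "1 \<le> \<bar>fps_nth a l\<bar>" by (simp add: a_def)
    thus ?thesis
      using sparse[OF l(1) less_imp_le[OF l(2)] min]
      by (intro smyth_early_second_term[OF f g l(1,2) eq c(1,3,4) fk refl, of "fps_nth a l"]) auto
  next
    case False
    thus ?thesis
      using sparse[of "2 * k"] \<open>0 < k\<close>
      by (intro smyth_late_second_term[OF f g \<open>0 < k\<close> c fk, of "fps_nth A (2 * k)"]) (auto simp: a_def)
  qed
next
  case False
  hence "2 \<le> fps_nth A k" using Ak by linarith
  hence "c * 2 \<le> c * real_of_int (fps_nth A k)" using c by (intro mult_left_mono) auto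
  moreover have "fps_nth f k = fps_nth g k + fps_nth g 0 * of_int (fps_nth A k)"
    unfolding fg using fps_mult_first_nth[of k "Abs_fps (\<lambda>n. of_int (fps_nth A n))" g] A0 A \<open>0 < k\<close> by simp
  moreover have "fps_nth f k \<le> 1 - c\<^sup>2" "- fps_nth g k \<le> 1 - c\<^sup>2"
    using contractive_coeff_bound[OF f \<open>0 < k\<close>] contractive_coeff_bound[OF g \<open>0 < k\<close>] c
    by (simp_all add: abs_le_iff)
  ultimately have "2 * c \<le> 2 - 2 * c\<^sup>2"
    unfolding c by linarith
  moreover have "c ^ 3 \<le> c ^ 1" using c by (intro power_decreasing) auto
  ultimately show ?thesis by simp
qed

lemma smyth_core:
  fixes f g :: "real fps" and A :: "int fps" and c :: real
  assumes f: "contractive f" and g: "contractive g"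
    and c: "fps_nth f 0 = c" "fps_nth g 0 = c" "0 < c"
    and fg: "f = g * Abs_fps (\<lambda>n. of_int (fps_nth A n))"
    and A0: "fps_nth A 0 = 1" and "A \<noteq> 1"
  shows "c ^ 3 + c\<^sup>2 \<le> 1"
proof -
  have ex: "\<exists>k. 0 < k \<and> fps_nth A k \<noteq> 0"
  proof (rule ccontr)
    assume "\<not> ?thesis"
    hence "fps_nth A n = fps_nth 1 n" for n using A0 by (metis fps_one_nth gr0I)
    hence "A = 1" by (rule fps_ext)
    thus False using \<open>A \<noteq> 1\<close> by simp
  qed
  define k where "k = (LEAST k. 0 < k \<and> fps_nth A k \<noteq> 0)"
  have k: "0 < k" "fps_nth A k \<noteq> 0" using LeastI_ex[OF ex] by (auto simp: k_def)
  have A: "fps_nth A i = 0" if "0 < i" "i < k" for i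
    using not_less_Least[of i "\<lambda>k. 0 < k \<and> fps_nth A k \<noteq> 0"] that by (auto simp: k_def)
  have fk: "fps_nth f k = fps_nth g k + fps_nth g 0 * of_int (fps_nth A k)"
    unfolding fg using fps_mult_first_nth[of k "Abs_fps (\<lambda>n. of_int (fps_nth A n))" g] A0 A k(1) by simp
  \<comment> \<open>A nonzero integer at \<open>k\<close> makes the coefficients of \<open>f\<close>
    and \<open>g\<close> there differ by at least \<open>c\<close>, while each is at most
    \<open>1 - c^2\<close> in modulus.\<close>
  have c1: "c < 1"
  proof -
    have "1 \<le> \<bar>fps_nth A k\<bar>" using k(2) by linarith
    hence "1 \<le> \<bar>real_of_int (fps_nth A k)\<bar>" by (metis of_int_1_le_iff of_int_abs)
    hence "c * 1 \<le> c * \<bar>real_of_int (fps_nth A k)\<bar>"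
      using c by (intro mult_left_mono) auto
    hence "c \<le> \<bar>fps_nth f k - fps_nth g k\<bar>" using fk c by (simp add: abs_mult)
    hence "c \<le> 2 * (1 - c\<^sup>2)"
      using contractive_coeff_bound[OF f k(1)] contractive_coeff_bound[OF g k(1)] c by auto
    hence "c\<^sup>2 < 1" using c by simp
    thus ?thesis using c by (simp add: abs_square_less_1)
  qed
  show ?thesis
  proof (cases "fps_nth A k > 0")
    case True
    thus ?thesis using smyth_core_pos[OF f g c c1 fg A0 k(1) _ A] by auto
  next
    case False
    \<comment> \<open>Passing to the inverse of \<open>A\<close> exchanges \<open>f\<close> and
      \<open>g\<close> and flips the sign of the first nonconstant coefficient.\<close>
    define B where "B = fps_left_inverse A 1"
    have BA: "B * A = 1" unfolding B_def using A0 by (intro fps_left_inverse) auto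
    have B0: "fps_nth B 0 = 1" using arg_cong[OF BA, of "\<lambda>F. fps_nth F 0"] A0 by simp
    have Bn: "fps_nth B n = - fps_nth A n" if "0 < n" "n \<le> k" for n
      using fps_mult_first_nth[of n A B] that A A0 B0 BA by simp
    have "Abs_fps (\<lambda>n. real_of_int (fps_nth A n)) * Abs_fps (\<lambda>n. of_int (fps_nth B n)) =
        Abs_fps (\<lambda>n. of_int (fps_nth (B * A) n))"
      by (subst mult.commute, rule fps_ext) (simp add: fps_mult_nth)
    also have "\<dots> = 1" by (rule fps_ext) (simp add: BA)
    finally have "g = f * Abs_fps (\<lambda>n. of_int (fps_nth B n))"
      unfolding fg mult.assoc by simp
    from smyth_core_pos[OF g f c(2,1,3) c1 this B0 k(1)] show ?thesis
      using Bn k A False by auto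
  qed
qed

section \<open>Blaschke products of an integer polynomial\<close>

lemma complex_fps_nth [simp]: "fps_nth (complex_fps F) n = of_int (fps_nth F n)"
  by (simp add: complex_fps_def)

lemma complex_fps_mult: "complex_fps (F * G) = complex_fps F * complex_fps G"
  by (rule fps_ext) (simp add: fps_mult_nth)

lemma complex_fps_of_poly: "complex_fps (fps_of_poly p) = fps_of_poly (map_poly of_int p)"
  by (rule fps_ext) (simp add: coeff_map_poly)

lemma complex_fps_const: "complex_fps (fps_const c) = fps_const (of_int c)"
  by (rule fps_ext) simp

lemma fps_unit_inverse_ex:
  fixes F :: "'a :: comm_ring_1 fps"
  assumes "e * fps_nth F 0 = 1"
  obtains G where "G * F = 1"
  using fps_left_inverse[of e F] assms by blast

lemma cnj_fps_mult:
  "Abs_fps (\<lambda>n. cnj (fps_nth (F * G) n)) =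
   Abs_fps (\<lambda>n. cnj (fps_nth F n)) * Abs_fps (\<lambda>n. cnj (fps_nth G n))"
  by (rule fps_ext) (simp add: fps_mult_nth)

lemma cnj_fps_prod_list:
  "Abs_fps (\<lambda>n. cnj (fps_nth (\<Prod>x\<leftarrow>xs. F x) n)) = (\<Prod>x\<leftarrow>xs. Abs_fps (\<lambda>n. cnj (fps_nth (F x) n)))"
proof (induction xs)
  case Nil
  show ?case by (simp, rule fps_ext) simp
qed (simp add: cnj_fps_mult)

lemma contractive_blaschke_inside:
  fixes a :: complex
  assumes "norm a \<le> 1"
  shows "contractive ((fps_X - fps_const a) * inverse (1 - fps_const (cnj a) * fps_X))"
proof -
  define K where "K = 1 - fps_const (cnj a) * fps_X"
  have K: "inverse K * K = 1"
    by (rule inverse_mult_eq_1) (simp add: K_def)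
  show ?thesis
  proof (cases "norm a = 1")
    \<comment> \<open>On the circle numerator and denominator are proportional, and the factor
      collapses to the constant \<open>- a\<close>.\<close>
    case True
    hence "a * cnj a = 1" by (simp add: complex_norm_square[symmetric])
    hence "fps_X - fps_const a = fps_const (- a) * K"
      by (intro fps_ext) (simp add: K_def algebra_simps)
    hence "(fps_X - fps_const a) * inverse K = fps_const (- a)"
      using K by (simp add: mult.assoc mult.commute)
    thus ?thesis using contractive_const[of "-a"] True by (simp add: K_def)
  next
    case False
    thus ?thesis
      using assms K unfolding K_def[symmetric]
      by (intro contractive_blaschke[of a]) (auto simp: K_def[symmetric] mult.assoc)
  qed
qed

text \<open>Up to the unimodular constant \<open>a / cnj a\<close> this is the Blaschke factor of
  the reflected point \<open>1 / cnj a\<close>, which lies inside the disc.\<close>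

lemma contractive_blaschke_outside:
  fixes a :: complex
  assumes "norm a > 1"
  shows "contractive ((1 - fps_const (cnj a) * fps_X) * inverse (fps_X - fps_const a))"
proof -
  have a0: "a \<noteq> 0" using assms by auto
  define K L where "K = 1 - fps_const (cnj a) * fps_X" and "L = fps_X - fps_const a"
  have L: "inverse L * L = 1"
    by (rule inverse_mult_eq_1) (use a0 in \<open>simp add: L_def\<close>)
  define b where "b = 1 / cnj a"
  have "norm b < 1" using assms by (simp add: b_def norm_divide divide_less_eq)
  have 1: "1 - fps_const (cnj b) * fps_X = fps_const (- 1 / a) * L"
    using a0 by (simp add: L_def b_def algebra_simps fps_const_mult[symmetric] flip: fps_const_neg)
  have 2: "fps_const (- 1 / cnj a) * K = fps_X - fps_const b"
    using a0 by (simp add: K_def b_def algebra_simps)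
  have "fps_const (a / cnj a) * (K * inverse L) * (1 - fps_const (cnj b) * fps_X) =
      fps_const (a / cnj a) * fps_const (- 1 / a) * K * (inverse L * L)"
    unfolding 1 by (simp only: ac_simps)
  also have "fps_const (a / cnj a) * fps_const (- 1 / a) = fps_const (- 1 / cnj a)"
    using a0 by simp
  also have "fps_const (- 1 / cnj a) * K * (inverse L * L) = fps_X - fps_const b"
    unfolding L 2 by simp
  finally have "contractive (fps_const (a / cnj a) * (K * inverse L))"
    by (intro contractive_blaschke[of b] \<open>norm b < 1\<close>)
  hence "contractive (fps_const (cnj a / a) * (fps_const (a / cnj a) * (K * inverse L)))"
    by (rule contractive_mult[rotated]) (use a0 in \<open>simp add: contractive_const norm_divide\<close>)
  also have "fps_const (cnj a / a) * (fps_const (a / cnj a) * (K * inverse L)) = K * inverse L"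
    using a0 by (simp add: mult.assoc[symmetric])
  finally show ?thesis by (simp add: K_def L_def)
qed

lemma fps_of_poly_prod_list: "fps_of_poly (\<Prod>x\<leftarrow>xs. f x) = (\<Prod>x\<leftarrow>xs. fps_of_poly (f x))"
  by (induction xs) (auto simp: fps_of_poly_mult)

text \<open>With \<open>L\<close> the linear factors of a polynomial and \<open>K\<close> their
  reflections, this ties the polynomial to its reciprocal. Sorting by \<open>Q\<close> decides which
  of the two is inverted, so that only series with nonzero constant term are.\<close>

lemma inner_outer_prod_list:
  fixes L K :: "'a \<Rightarrow> 'b :: field fps"
  assumes "\<And>x. x \<in> set xs \<Longrightarrow> Q x \<Longrightarrow> fps_nth (K x) 0 \<noteq> 0"
      and "\<And>x. x \<in> set xs \<Longrightarrow> \<not> Q x \<Longrightarrow> fps_nth (L x) 0 \<noteq> 0"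
  shows "(\<Prod>x\<leftarrow>xs. L x) * (\<Prod>x\<leftarrow>filter (\<lambda>x. \<not> Q x) xs. K x * inverse (L x)) =
         (\<Prod>x\<leftarrow>xs. K x) * (\<Prod>x\<leftarrow>filter Q xs. L x * inverse (K x))"
  using assms
proof (induction xs)
  case (Cons x xs)
  let ?PL = "\<Prod>x\<leftarrow>xs. L x" and ?PK = "\<Prod>x\<leftarrow>xs. K x"
  let ?O = "\<Prod>x\<leftarrow>filter (\<lambda>x. \<not> Q x) xs. K x * inverse (L x)"
  let ?I = "\<Prod>x\<leftarrow>filter Q xs. L x * inverse (K x)"
  have IH: "?PL * ?O = ?PK * ?I" using Cons by auto
  show ?case
  proof (cases "Q x")
    case True
    hence "inverse (K x) * K x = 1" using Cons.prems by (intro inverse_mult_eq_1) auto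
    have "L x * ?PL * ?O = L x * (?PL * ?O)" by (simp only: mult.assoc)
    also have "\<dots> = (inverse (K x) * K x) * (L x * (?PK * ?I))"
      unfolding \<open>inverse (K x) * K x = 1\<close> IH by simp
    also have "\<dots> = K x * ?PK * (L x * inverse (K x) * ?I)" by (simp only: ac_simps)
    finally show ?thesis using True by simp
  next
    case False
    hence "inverse (L x) * L x = 1" using Cons.prems by (intro inverse_mult_eq_1) auto
    have "L x * ?PL * (K x * inverse (L x) * ?O) = K x * (inverse (L x) * L x) * (?PL * ?O)"
      by (simp only: ac_simps)
    also have "\<dots> = K x * ?PK * ?I" unfolding \<open>inverse (L x) * L x = 1\<close> IH by (simp add: ac_simps)
    finally show ?thesis using False by simp
  qed
qed auto

theorem smyth:
  fixes p :: "int poly"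
  assumes lc: "lead_coeff p = 1" and c0: "\<bar>Polynomial.coeff p 0\<bar> = 1"
    and nr: "reflect_poly p \<noteq> p" "reflect_poly p \<noteq> - p"
  shows "mahler_measure p + 1 \<le> mahler_measure p ^ 3"
proof -
  define P where "P = map_poly complex_of_int p"
  define rs where "rs = complex_roots_complex P"
  have lcP: "lead_coeff P = 1" using lc by (simp add: P_def)
  have P: "P = (\<Prod>a\<leftarrow>rs. [:- a, 1:])"
    using complex_roots(1)[of P] lcP by (simp add: rs_def)
  define e where "e = Polynomial.coeff p 0"
  have e: "e * e = 1" using c0 by (auto simp: e_def abs_if split: if_splits)
  have P0: "Polynomial.coeff P 0 = of_int e" by (simp add: P_def e_def coeff_map_poly)
  have rs0: "0 \<notin> set rs"
  proof
    assume "0 \<in> set rs"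
    hence "poly P 0 = 0" unfolding P by (auto simp: poly_prod_list prod_list_zero_iff image_iff)
    thus False using P0 e by (simp add: poly_0_coeff_0) 
  qed
  define L K where "L = (\<lambda>a::complex. fps_X - fps_const a)" and "K = (\<lambda>a. 1 - fps_const (cnj a) * fps_X)"
  have PL: "fps_of_poly P = (\<Prod>a\<leftarrow>rs. L a)"
  proof -
    have "fps_of_poly [:- a, 1:] = L a" for a
      unfolding L_def by (rule fps_ext) (simp add: coeff_pCons split: nat.split)
    thus ?thesis unfolding P fps_of_poly_prod_list by (simp only:)
  qed
  have PK: "fps_of_poly (reflect_poly P) = (\<Prod>a\<leftarrow>rs. K a)"
  proof -
    have "fps_of_poly (reflect_poly P) = (\<Prod>a\<leftarrow>rs. 1 - fps_const a * fps_X)"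
    proof -
      have "fps_of_poly (reflect_poly [:- a, 1:]) = 1 - fps_const a * fps_X" for a :: complex
        by (rule fps_ext) (auto simp: coeff_reflect_poly coeff_pCons split: nat.split)
      thus ?thesis
        unfolding P reflect_poly_prod_list map_map o_def fps_of_poly_prod_list by (simp only:)
    qed
    \<comment> \<open>The reciprocal polynomial has integer coefficients, so conjugating its factors
      keeps the product and produces the denominators of the Blaschke factors.\<close>
    hence "Abs_fps (\<lambda>n. cnj (fps_nth (fps_of_poly (reflect_poly P)) n)) =
        (\<Prod>a\<leftarrow>rs. Abs_fps (\<lambda>n. cnj (fps_nth (1 - fps_const a * fps_X) n)))"
      by (simp only: cnj_fps_prod_list)
    also have "(\<lambda>a. Abs_fps (\<lambda>n. cnj (fps_nth (1 - fps_const a * fps_X) n))) = K"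
      by (intro ext fps_ext) (simp add: K_def fps_X_def)
    also have "Abs_fps (\<lambda>n. cnj (fps_nth (fps_of_poly (reflect_poly P)) n)) = fps_of_poly (reflect_poly P)"
      by (rule fps_ext) (simp add: coeff_reflect_poly P_def coeff_map_poly)
    finally show ?thesis .
  qed
  define f g where "f = (\<Prod>a\<leftarrow>filter (\<lambda>a. norm a \<le> 1) rs. L a * inverse (K a))"
    and "g = (\<Prod>a\<leftarrow>filter (\<lambda>a. \<not> norm a \<le> 1) rs. K a * inverse (L a))"
  have fg: "fps_of_poly P * g = fps_of_poly (reflect_poly P) * f"
    unfolding PL PK f_def g_def
    by (rule inner_outer_prod_list) (use rs0 in \<open>auto simp: K_def L_def\<close>)
  have f: "contractive f" unfolding f_def L_def K_def
    by (intro contractive_prod_list contractive_blaschke_inside) auto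
  have g: "contractive g" unfolding g_def L_def K_def
    by (intro contractive_prod_list contractive_blaschke_outside) auto
  define M where "M = mahler_measure p"
  have M: "M = (\<Prod>a\<leftarrow>rs. max 1 (norm a))"
    using lc by (simp add: M_def mahler_measure_def mahler_measure_poly_def P_def[symmetric] rs_def lcP)
  have M0: "M > 0" unfolding M by (induction rs) (auto intro!: mult_pos_pos)
  \<comment> \<open>The constant terms of \<open>K a\<close> and \<open>L a\<close> are
    \<open>1\<close> and \<open>- a\<close>, so each root outside the disc contributes the inverse
    of its factor in the Mahler measure.\<close>
  have g0: "norm (fps_nth g 0) = 1 / M"
    unfolding g_def M
  proof (induction rs)
    case (Cons a rs)
    show ?case using Cons by (auto simp: K_def L_def norm_mult norm_inverse norm_divide divide_simps)
  qed simp
  \<comment> \<open>The unimodular \<open>u\<close> rotates the constant term of \<open>g\<close> to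
    \<open>1 / M\<close>; with the sign \<open>e\<close> in addition, \<open>f\<close> gets the same
    constant term.\<close>
  define u where "u = complex_of_real (1 / M) / fps_nth g 0"
  have "fps_nth g 0 \<noteq> 0" using g0 M0 by auto
  hence u: "u * fps_nth g 0 = of_real (1 / M)" "norm u = 1"
    using g0 M0 by (simp_all add: u_def norm_divide norm_mult)
  have f0: "fps_nth f 0 = of_int e * fps_nth g 0"
    using arg_cong[OF fg, of "\<lambda>F. fps_nth F 0"] P0 lcP by simp
  define f1 g1 where "f1 = fps_const (of_int e * u) * f" and "g1 = fps_const u * g"
  have f1: "contractive f1" and g1: "contractive g1"
    unfolding f1_def g1_def using u c0 by (auto intro!: contractive_mult contractive_const f g
      simp: norm_mult e_def simp flip: of_int_abs)
  have g10: "fps_nth g1 0 = of_real (1 / M)" using u by (simp add: g1_def)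
  have f10: "fps_nth f1 0 = of_real (1 / M)"
  proof -
    have "fps_nth f1 0 = of_int (e * e) * (u * fps_nth g 0)" by (simp add: f1_def f0)
    thus ?thesis using u e by simp
  qed
  \<comment> \<open>As \<open>p\<close> is monic, its reciprocal has constant term 1 and is
    invertible over the integers; this gives the quotient \<open>A\<close> integer
    coefficients.\<close>
  obtain B where B: "B * fps_of_poly (reflect_poly p) = 1"
    using fps_unit_inverse_ex[of 1 "fps_of_poly (reflect_poly p)"] lc by auto
  define A where "A = fps_const e * fps_of_poly p * B"
  have B0: "fps_nth B 0 = 1" using arg_cong[OF B, of "\<lambda>F. fps_nth F 0"] lc by simp
  have A0: "fps_nth A 0 = 1" using e B0 by (simp add: A_def e_def)
  have AB: "A * fps_of_poly (reflect_poly p) = fps_const e * fps_of_poly p"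
    unfolding A_def mult.assoc B by simp
  have "A \<noteq> 1"
  proof
    assume "A = 1"
    hence "fps_of_poly (reflect_poly p) = fps_of_poly (Polynomial.smult e p)"
      using AB by (simp add: fps_of_poly_smult)
    hence "reflect_poly p = Polynomial.smult e p" by (simp only: fps_of_poly_eq_iff)
    moreover have "e = 1 \<or> e = -1" using c0 by (auto simp: e_def)
    ultimately show False using nr by auto
  qed
  have rP: "complex_fps (fps_of_poly (reflect_poly p)) = fps_of_poly (reflect_poly P)"
    unfolding complex_fps_of_poly P_def
    by (rule arg_cong[of _ _ fps_of_poly], rule poly_eqI) (simp add: coeff_reflect_poly coeff_map_poly)
  have "g1 * complex_fps A * fps_of_poly (reflect_poly P) = fps_const (of_int e * u) * (fps_of_poly P * g)"
    unfolding rP[symmetric] mult.assoc complex_fps_mult[symmetric] AB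
    unfolding complex_fps_mult complex_fps_const complex_fps_of_poly P_def[symmetric] g1_def
    by (simp add: ac_simps flip: fps_const_mult)
  also have "\<dots> = f1 * fps_of_poly (reflect_poly P)"
    unfolding fg f1_def by (simp only: ac_simps)
  finally have f1g1: "f1 = g1 * complex_fps A"
    using lcP by (metis coeff_0_reflect_poly fps_of_poly_nth fps_zero_nth mult_cancel_right zero_neq_one)
  define f2 g2 where "f2 = Abs_fps (\<lambda>n. Re (fps_nth f1 n))" and "g2 = Abs_fps (\<lambda>n. Re (fps_nth g1 n))"
  have f2: "contractive f2" and g2: "contractive g2"
    unfolding f2_def g2_def by (intro contractive_Re f1 g1)+
  have "f2 = g2 * Abs_fps (\<lambda>n. of_int (fps_nth A n))"
    unfolding f2_def g2_def f1g1 by (rule fps_ext) (simp add: fps_mult_nth)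
  moreover have "fps_nth f2 0 = 1 / M" "fps_nth g2 0 = 1 / M"
    using f10 g10 by (simp_all add: f2_def g2_def)
  ultimately have "(1 / M) ^ 3 + (1 / M)\<^sup>2 \<le> 1"
    using M0 by (intro smyth_core[OF f2 g2 _ _ _ _ A0 \<open>A \<noteq> 1\<close>]) auto
  hence "M ^ 3 * ((1 / M) ^ 3 + (1 / M)\<^sup>2) \<le> M ^ 3 * 1"
    using M0 by (intro mult_left_mono) auto
  moreover have "M ^ 3 * ((1 / M) ^ 3 + (1 / M)\<^sup>2) = 1 + M"
    using M0 by (simp add: field_simps power2_eq_square power3_eq_cube)
  ultimately show ?thesis unfolding M_def[symmetric] by simp
qed

section \<open>Minimal polynomials and the smallest Pisot number\<close>

text \<open>The property behind the definite description in \<open>min_int_poly\<close>, named so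
  that existence and uniqueness can be proved for it.\<close>

definition is_min_int_poly :: "real \<Rightarrow> int poly \<Rightarrow> bool" where
  "is_min_int_poly x p \<longleftrightarrow> lead_coeff p = 1 \<and> poly (map_poly of_int p) x = 0 \<and>
     (\<forall>q :: rat poly. q \<noteq> 0 \<and> poly (map_poly of_rat q) x = 0 \<longrightarrow> degree p \<le> degree q)"

lemma rat_poly_clear_denominators:
  fixes q :: "rat poly"
  obtains d :: int and p :: "int poly" where "d \<noteq> 0" "Polynomial.smult (of_int d) q = map_poly of_int p"
proof -
  have "\<exists>d p. d \<noteq> 0 \<and> Polynomial.smult (of_int d) q = map_poly of_int p"
  proof (induction q)
    case 0
    show ?case by (intro exI[of _ 1] exI[of _ 0]) auto
  next
    case (pCons a q)
    then obtain d p where dp: "d \<noteq> 0" "Polynomial.smult (of_int d) q = map_poly of_int p" by blast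
    obtain m n where mn: "a = of_int m / of_int n" "n \<noteq> 0"
      using quotient_of_div[of a] quotient_of_denom_pos[of a] by (cases "quotient_of a") force
    have "Polynomial.smult (of_int (n * d)) (pCons a q) =
        pCons (of_int (n * d) * a) (Polynomial.smult (of_int n) (Polynomial.smult (of_int d) q))"
      by simp
    also have "\<dots> = map_poly of_int (pCons (d * m) (Polynomial.smult n p))"
      using mn unfolding dp(2) by (intro poly_eqI) (auto simp: coeff_pCons coeff_map_poly split: nat.split)
    finally show ?case using dp(1) mn(2) by (intro exI[of _ "n * d"]) auto
  qed
  thus ?thesis using that by blast
qed

lemma poly_of_rat_of_int:
  "map_poly (of_rat :: rat \<Rightarrow> 'a :: field_char_0) (map_poly of_int p) = map_poly of_int p"
  by (intro poly_eqI) (simp add: coeff_map_poly)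

lemma poly_of_int_mult:
  "map_poly of_int (p * q) = map_poly (of_int :: int \<Rightarrow> 'a :: field_char_0) p * map_poly of_int q"
  by (intro poly_eqI) (simp add: coeff_map_poly coeff_mult)

lemma poly_of_int_add:
  "map_poly of_int (p + q) = map_poly (of_int :: int \<Rightarrow> 'a :: field_char_0) p + map_poly of_int q"
  by (intro poly_eqI) (simp add: coeff_map_poly)

lemma poly_of_int_diff:
  "map_poly of_int (p - q) = map_poly (of_int :: int \<Rightarrow> 'a :: field_char_0) p - map_poly of_int q"
  by (intro poly_eqI) (simp add: coeff_map_poly)

lemma poly_of_int_smult:
  "map_poly of_int (Polynomial.smult c q) = Polynomial.smult (of_int c :: 'a :: field_char_0) (map_poly of_int q)"
  by (intro poly_eqI) (simp add: coeff_map_poly)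

lemma degree_poly_of_int: "degree (map_poly (of_int :: int \<Rightarrow> 'a :: field_char_0) p) = degree p"
  by (rule degree_map_poly) simp

lemma poly_of_int_eq_0_iff: "map_poly (of_int :: int \<Rightarrow> 'a :: field_char_0) p = 0 \<longleftrightarrow> p = 0"
  by (simp add: poly_eq_iff coeff_map_poly)

lemma is_min_int_poly_degree_le:
  assumes "is_min_int_poly x p" "q \<noteq> 0" "poly (map_poly of_int q) x = 0"
  shows "degree p \<le> degree q"
proof -
  have "map_poly rat_of_int q \<noteq> 0" "poly (map_poly of_rat (map_poly rat_of_int q)) x = 0"
    using assms(2,3) by (simp_all add: poly_of_rat_of_int poly_of_int_eq_0_iff)
  hence "degree p \<le> degree (map_poly rat_of_int q)"
    using assms(1) unfolding is_min_int_poly_def by blast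
  thus ?thesis by (simp add: degree_poly_of_int)
qed

text \<open>Two candidates share degree and leading coefficient, so their difference would vanish at
  \<open>x\<close> in smaller degree.\<close>

lemma is_min_int_poly_unique:
  assumes p: "is_min_int_poly x p" and q: "is_min_int_poly x q"
  shows "p = q"
proof (rule ccontr)
  assume ne: "p \<noteq> q"
  have "p \<noteq> 0" "q \<noteq> 0" using p q by (auto simp: is_min_int_poly_def)
  hence deg: "degree p = degree q"
    using is_min_int_poly_degree_le[OF p, of q] is_min_int_poly_degree_le[OF q, of p] p q
    by (auto simp: is_min_int_poly_def)
  have "poly (map_poly of_int (p - q)) x = 0"
    using p q by (simp add: is_min_int_poly_def poly_of_int_diff)
  hence le: "degree p \<le> degree (p - q)"
    using ne is_min_int_poly_degree_le[OF p, of "p - q"] by auto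
  have le2: "degree (p - q) \<le> degree p" using deg degree_diff_le_max[of p q] by simp
  have "Polynomial.coeff (p - q) (degree (p - q)) = 0"
    using p q deg le le2 by (simp add: is_min_int_poly_def)
  thus False using ne by (metis leading_coeff_0_iff right_minus_eq)
qed

text \<open>Pseudo-division by a monic polynomial is division, and the remainder vanishes at
  \<open>x\<close> with too small a degree.\<close>

lemma is_min_int_poly_dvd:
  assumes p: "is_min_int_poly x p" and q: "poly (map_poly of_int q) x = 0"
  shows "p dvd q"
proof (cases "pseudo_divmod q p")
  case (Pair a r)
  have p0: "p \<noteq> 0" and lc: "lead_coeff p = 1" using p by (auto simp: is_min_int_poly_def)
  have 1: "q = p * a + r" using pseudo_divmod(1)[OF p0 Pair] lc by simp
  have "poly (map_poly of_int r) x = 0"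
    using q p unfolding 1 by (simp add: poly_of_int_add poly_of_int_mult is_min_int_poly_def)
  hence "r = 0"
    using pseudo_divmod(2)[OF p0 Pair] is_min_int_poly_degree_le[OF p, of r] by linarith
  thus ?thesis using 1 by simp
qed

text \<open>Gauss's lemma: a primitive \<open>p\<close> of least degree divides a multiple
  \<open>c P\<close> of the monic \<open>P\<close>. Comparing contents, \<open>c\<close> cancels, so
  \<open>p\<close> divides \<open>P\<close> itself and its leading coefficient is a unit.\<close>

lemma is_min_int_poly_ex:
  fixes x :: real
  assumes "algebraic_int x"
  shows "\<exists>p. is_min_int_poly x p"
proof -
  obtain P :: "int poly" where P: "poly (map_poly of_int P) x = 0" "lead_coeff P = 1"
    using assms unfolding algebraic_int_altdef_ipoly by blast
  define S where "S = {q :: int poly. q \<noteq> 0 \<and> poly (map_poly of_int q) x = 0}"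
  have "P \<in> S" using P by (auto simp: S_def)
  then obtain p0 where p0: "p0 \<in> S" "\<And>q. q \<in> S \<Longrightarrow> degree p0 \<le> degree q"
    using ex_has_least_nat[of "\<lambda>q. q \<in> S" P degree] by blast
  define p where "p = primitive_part p0"
  have eq: "p0 = Polynomial.smult (content p0) p" by (simp add: p_def)
  have c0: "content p0 \<noteq> 0" using p0(1) by (simp add: S_def)
  have pS: "p \<in> S"
  proof -
    have "poly (map_poly of_int p0) x = of_int (content p0) * poly (map_poly of_int p) x"
      by (subst eq) (simp add: poly_of_int_smult)
    thus ?thesis using p0(1) c0 by (auto simp: S_def p_def)
  qed
  have degp: "degree p \<le> degree q" if "q \<in> S" for q
    using p0(2)[OF that] by (simp add: p_def)
  have p_ne: "p \<noteq> 0" and px: "poly (map_poly of_int p) x = 0" using pS by (auto simp: S_def)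
  obtain a r where ar: "pseudo_divmod P p = (a, r)" by force
  define c where "c = lead_coeff p ^ (Suc (degree P) - degree p)"
  have c: "c \<noteq> 0" using p_ne by (simp add: c_def)
  have 1: "Polynomial.smult c P = p * a + r" using pseudo_divmod(1)[OF p_ne ar] by (simp add: c_def)
  have "poly (map_poly of_int (Polynomial.smult c P)) x = 0" using P by (simp add: poly_of_int_smult)
  hence "poly (map_poly of_int r) x = 0"
    using px unfolding 1 by (simp add: poly_of_int_add poly_of_int_mult)
  hence "r = 0"
    using pseudo_divmod(2)[OF p_ne ar] degp[of r] unfolding S_def by force
  hence 2: "Polynomial.smult c P = p * a" using 1 by simp
  have cP: "content P = 1"
    by (metis P(2) content_dvd_coeff is_unit_content_iff)
  have "content p = 1" using p0(1) by (simp add: p_def S_def)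
  hence "content a = normalize c"
    using arg_cong[OF 2, of content] cP by (simp add: content_mult)
  hence "[:c:] dvd a" by (simp add: const_poly_dvd_iff_dvd_content)
  then obtain b where b: "a = Polynomial.smult c b" by (auto elim!: dvdE)
  have "Polynomial.smult c P = Polynomial.smult c (p * b)" using 2 b by simp
  hence "Polynomial.smult c (P - p * b) = 0" by (simp only: smult_diff_right)
  hence "P - p * b = 0" using c by (simp only: smult_eq_0_iff) simp
  hence "P = p * b" by simp
  hence "lead_coeff p * lead_coeff b = 1" using P(2) by (simp add: lead_coeff_mult)
  hence lc: "lead_coeff p = 1 \<or> lead_coeff p = -1" by (auto simp: zmult_eq_1_iff)
  define p' where "p' = Polynomial.smult (lead_coeff p) p"
  have "is_min_int_poly x p'"
    unfolding is_min_int_poly_def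
  proof (intro conjI allI impI)
    show "lead_coeff p' = 1" using lc by (auto simp: p'_def)
    show "poly (map_poly of_int p') x = 0" using px by (simp add: p'_def poly_of_int_smult)
    fix q :: "rat poly" assume q: "q \<noteq> 0 \<and> poly (map_poly of_rat q) x = 0"
    obtain d q' where d: "d \<noteq> 0" "Polynomial.smult (of_int d) q = map_poly of_int q'"
      using rat_poly_clear_denominators by blast
    have "map_poly of_int q' = map_poly (of_rat :: rat \<Rightarrow> real) (map_poly of_int q')"
      by (simp add: poly_of_rat_of_int)
    also have "\<dots> = Polynomial.smult (of_int d) (map_poly of_rat q)"
      unfolding d(2)[symmetric] by (intro poly_eqI) (simp add: coeff_map_poly of_rat_mult)
    finally have "q' \<in> S" using q d by (auto simp: S_def)
    hence "degree p \<le> degree q'" by (rule degp)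
    also have "degree q' = degree q" using d by (metis degree_poly_of_int degree_smult_eq of_int_eq_0_iff)
    finally show "degree p' \<le> degree q" using p_ne by (simp add: p'_def)
  qed
  thus ?thesis by blast
qed

lemma is_min_int_poly_min_int_poly:
  assumes "algebraic_int x"
  shows "is_min_int_poly x (min_int_poly x)"
proof -
  have "\<exists>!p. is_min_int_poly x p"
    using is_min_int_poly_ex[OF assms] is_min_int_poly_unique by blast
  hence "is_min_int_poly x (THE p. is_min_int_poly x p)" by (rule theI')
  thus ?thesis by (simp add: min_int_poly_def is_min_int_poly_def)
qed

lemma is_min_int_poly_const_nonzero:
  assumes p: "is_min_int_poly x p" and "x \<noteq> 0"
  shows "Polynomial.coeff p 0 \<noteq> 0"
proof
  assume "Polynomial.coeff p 0 = 0"
  then obtain q where q: "p = [:0, 1:] * q"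
    by (cases p) auto
  have "p \<noteq> 0" using p by (auto simp: is_min_int_poly_def)
  hence "q \<noteq> 0" using q by auto
  have "poly (map_poly of_int p) x = x * poly (map_poly of_int q) x"
    unfolding q poly_of_int_mult poly_mult by (simp add: map_poly_pCons)
  hence "poly (map_poly of_int q) x = 0" using p \<open>x \<noteq> 0\<close> by (simp add: is_min_int_poly_def)
  from is_min_int_poly_degree_le[OF p \<open>q \<noteq> 0\<close> this] show False
    using \<open>q \<noteq> 0\<close> by (simp add: q degree_mult_eq)
qed

text \<open>Reflection preserves the sum of the coefficients, so antireciprocity forces the value 0
  at 1; then \<open>X - 1\<close> could be divided out.\<close>

lemma is_min_int_poly_not_antireciprocal:
  assumes p: "is_min_int_poly x p" and "x \<noteq> 1"
  shows "reflect_poly p \<noteq> - p"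
proof
  assume eq: "reflect_poly p = - p"
  have p0: "p \<noteq> 0" using p by (auto simp: is_min_int_poly_def)
  have "poly (reflect_poly p) 1 = poly p 1"
    unfolding poly_altdef using degree_reflect_poly_le[of p]
  proof -
    have "(\<Sum>i\<le>degree (reflect_poly p). Polynomial.coeff (reflect_poly p) i * 1 ^ i) =
          (\<Sum>i\<le>degree p. Polynomial.coeff (reflect_poly p) i * 1 ^ i)"
      using degree_reflect_poly_le[of p] by (intro sum.mono_neutral_left) (auto simp: coeff_eq_0)
    also have "\<dots> = (\<Sum>i\<le>degree p. Polynomial.coeff p (degree p - i) * 1 ^ i)"
      by (intro sum.cong) (auto simp: coeff_reflect_poly)
    also have "\<dots> = (\<Sum>i\<le>degree p. Polynomial.coeff p i * 1 ^ i)"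
      by (rule sum.reindex_bij_witness[of _ "\<lambda>i. degree p - i" "\<lambda>i. degree p - i"]) auto
    finally show "(\<Sum>i\<le>degree (reflect_poly p). Polynomial.coeff (reflect_poly p) i * 1 ^ i) =
      (\<Sum>i\<le>degree p. Polynomial.coeff p i * 1 ^ i)" .
  qed
  hence "poly p 1 = 0" using eq by simp
  hence "[:- 1, 1:] dvd p" by (simp add: poly_eq_0_iff_dvd)
  then obtain q where q: "p = [:- 1, 1:] * q" by (rule dvdE)
  have "q \<noteq> 0" using p0 q by auto
  have "poly (map_poly of_int p) x = (x - 1) * poly (map_poly of_int q) x"
    unfolding q poly_of_int_mult poly_mult by (simp add: map_poly_pCons)
  hence "poly (map_poly of_int q) x = 0" using p \<open>x \<noteq> 1\<close> by (simp add: is_min_int_poly_def)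
  from is_min_int_poly_degree_le[OF p \<open>q \<noteq> 0\<close> this] show False
    using \<open>q \<noteq> 0\<close> by (simp add: q degree_mult_eq del: mult_pCons_left)
qed

section \<open>Complex roots and the Mahler measure\<close>

lemma poly_of_int_of_real:
  "poly (map_poly of_int q) (complex_of_real x) = of_real (poly (map_poly of_int q) x)"
  by (simp add: poly_altdef degree_poly_of_int coeff_map_poly)

lemma pderiv_of_int:
  "pderiv (map_poly of_int q) = map_poly (of_int :: int \<Rightarrow> 'a :: field_char_0) (pderiv q)"
  by (intro poly_eqI) (simp add: coeff_pderiv coeff_map_poly)

lemma linear_power_count_dvd:
  "[:- x, 1:] ^ count_list xs x dvd (\<Prod>a\<leftarrow>xs. [:- a, 1 :: 'a :: idom:])"
proof (induction xs)
  case (Cons a xs)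
  show ?case
  proof (cases "a = x")
    case True
    thus ?thesis using mult_dvd_mono[OF dvd_refl[of "[:- x, 1:]"] Cons] by simp
  next
    case False
    thus ?thesis using dvd_mult[OF Cons, of "[:- a, 1:]"] by simp
  qed
qed simp

lemma complex_roots_int_monic:
  assumes "lead_coeff p = 1"
  shows "map_poly of_int p = (\<Prod>a\<leftarrow>complex_roots_int p. [:- a, 1:])"
    and "poly (map_poly of_int p) z = 0 \<longleftrightarrow> z \<in> set (complex_roots_int p)"
    and "mahler_measure p = (\<Prod>a\<leftarrow>complex_roots_int p. max 1 (norm a))"
    and "of_int \<bar>Polynomial.coeff p 0\<bar> = (\<Prod>a\<leftarrow>complex_roots_int p. norm a)"
proof -
  show 1: "map_poly of_int p = (\<Prod>a\<leftarrow>complex_roots_int p. [:- a, 1:])"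
    using complex_roots_int(1)[of p] assms by simp
  show "poly (map_poly of_int p) z = 0 \<longleftrightarrow> z \<in> set (complex_roots_int p)"
    unfolding 1 by (auto simp: poly_prod_list prod_list_zero_iff image_iff)
  show "mahler_measure p = (\<Prod>a\<leftarrow>complex_roots_int p. max 1 (norm a))"
    using assms by (simp add: mahler_measure_def mahler_measure_poly_def complex_roots_int_def)
  have "poly (map_poly of_int p) 0 = (\<Prod>a\<leftarrow>complex_roots_int p. - a)"
    unfolding 1 poly_prod_list by (simp add: o_def)
  hence "norm (complex_of_int (Polynomial.coeff p 0)) = norm (\<Prod>a\<leftarrow>complex_roots_int p. - a)"
    by (simp add: poly_0_coeff_0 coeff_map_poly)
  thus "of_int \<bar>Polynomial.coeff p 0\<bar> = (\<Prod>a\<leftarrow>complex_roots_int p. norm a)"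
    by (simp only: prod_cmod norm_minus_cancel norm_of_int of_int_abs)
qed

lemma prod_list_max_norm_ge:
  fixes xs :: "complex list"
  shows "(\<Prod>a\<leftarrow>xs. norm a) \<le> (\<Prod>a\<leftarrow>xs. max 1 (norm a))"
    and "x \<in> set xs \<Longrightarrow> norm x \<le> (\<Prod>a\<leftarrow>xs. max 1 (norm a))"
proof -
  have nn: "0 \<le> (\<Prod>a\<leftarrow>xs. norm a)" for xs :: "complex list"
    by (induction xs) auto
  show "(\<Prod>a\<leftarrow>xs. norm a) \<le> (\<Prod>a\<leftarrow>xs. max 1 (norm a))"
    by (induction xs) (auto intro!: mult_mono nn)
  have ge1: "1 \<le> (\<Prod>a\<leftarrow>xs. max 1 (norm a))" for xs :: "complex list"
  proof (induction xs)
    case (Cons a xs)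
    have "1 * 1 \<le> max 1 (norm a) * (\<Prod>a\<leftarrow>xs. max 1 (norm a))"
      using Cons by (intro mult_mono) auto
    thus ?case by simp
  qed simp
  show "norm x \<le> (\<Prod>a\<leftarrow>xs. max 1 (norm a))" if "x \<in> set xs" using that
  proof (induction xs)
    case (Cons a xs)
    show ?case
    proof (cases "x = a")
      case True
      have "norm a * 1 \<le> max 1 (norm a) * (\<Prod>a\<leftarrow>xs. max 1 (norm a))"
        using ge1[of xs] by (intro mult_mono) auto
      thus ?thesis using True by simp
    next
      case False
      have "1 * norm x \<le> max 1 (norm a) * (\<Prod>a\<leftarrow>xs. max 1 (norm a))"
        using Cons False by (intro mult_mono) auto
      thus ?thesis by simp
    qed
  qed simp
qed

text \<open>Smyth's theorem covers constant coefficients of modulus 1. Otherwise the constant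
  coefficient, a product of roots up to sign, forces a Mahler measure of at least 2, where the cubic
  inequality is immediate.\<close>

lemma mahler_measure_nonreciprocal:
  assumes p: "is_min_int_poly x p" and x: "x > 1"
  shows "reflect_poly p = p \<or> mahler_measure p + 1 \<le> mahler_measure p ^ 3"
proof (cases "\<bar>Polynomial.coeff p 0\<bar> = 1")
  case True
  thus ?thesis
    using smyth[of p] is_min_int_poly_not_antireciprocal[OF p] p x
    by (auto simp: is_min_int_poly_def)
next
  case False
  have "Polynomial.coeff p 0 \<noteq> 0" using is_min_int_poly_const_nonzero[OF p] x by simp
  hence "2 \<le> \<bar>Polynomial.coeff p 0\<bar>" using False by linarith
  hence "2 \<le> real_of_int \<bar>Polynomial.coeff p 0\<bar>" by linarith
  also have "\<dots> \<le> mahler_measure p"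
    using complex_roots_int_monic[of p] prod_list_max_norm_ge(1)[of "complex_roots_int p"] p
    by (simp add: is_min_int_poly_def)
  finally have M: "2 \<le> mahler_measure p" .
  hence "2 * 2 * mahler_measure p \<le> mahler_measure p * mahler_measure p * mahler_measure p"
    by (intro mult_mono) auto
  hence "mahler_measure p + 1 \<le> mahler_measure p ^ 3"
    using M unfolding power3_eq_cube by linarith
  thus ?thesis ..
qed

text \<open>A multiple root would also be a root of the derivative, a nonzero polynomial of smaller
  degree.\<close>

lemma is_min_int_poly_simple_root:
  assumes p: "is_min_int_poly x p"
  shows "count_list (complex_roots_int p) (of_real x) = 1"
proof -
  let ?rs = "complex_roots_int p" and ?x = "complex_of_real x"
  have lc: "lead_coeff p = 1" using p by (simp add: is_min_int_poly_def)
  have "?x \<in> set ?rs"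
    using p complex_roots_int_monic(2)[OF lc, of ?x] by (simp add: poly_of_int_of_real is_min_int_poly_def)
  hence 1: "count_list ?rs ?x > 0" by (simp add: count_list_0_iff zero_less_iff_neq_zero)
  have deg: "degree p \<noteq> 0"
  proof
    assume "degree p = 0"
    then obtain c where "p = [:c:]" by (auto elim: degree_eq_zeroE)
    thus False using p by (auto simp: is_min_int_poly_def map_poly_pCons)
  qed
  have "\<not> 2 \<le> count_list ?rs ?x"
  proof
    assume "2 \<le> count_list ?rs ?x"
    hence "[:- ?x, 1:]\<^sup>2 dvd [:- ?x, 1:] ^ count_list ?rs ?x" by (rule le_imp_power_dvd)
    also have "\<dots> dvd map_poly of_int p"
      unfolding complex_roots_int_monic(1)[OF lc] by (rule linear_power_count_dvd)
    finally obtain q where q: "map_poly complex_of_int p = [:- ?x, 1:]\<^sup>2 * q" by (rule dvdE)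
    have "poly (pderiv ([:- ?x, 1:]\<^sup>2 * q)) ?x = 0"
      by (simp only: pderiv_mult power2_eq_square mult.assoc poly_add poly_mult) simp
    hence "poly (map_poly complex_of_int (pderiv p)) ?x = 0"
      unfolding q[symmetric] pderiv_of_int .
    hence "poly (map_poly of_int (pderiv p)) x = 0" by (simp add: poly_of_int_of_real)
    moreover have "pderiv p \<noteq> 0" using deg by (simp add: pderiv_eq_0_iff)
    ultimately have "degree p \<le> degree (pderiv p)" using is_min_int_poly_degree_le[OF p] by blast
    thus False using deg by (simp add: degree_pderiv)
  qed
  thus ?thesis using 1 by linarith
qed

section \<open>Pisot numbers and the cubic X^3 - X - 1\<close>

lemma prod_list_max_norm_Pisot:
  fixes xs :: "complex list"
  assumes "\<And>a. a \<in> set xs \<Longrightarrow> a \<noteq> of_real x \<Longrightarrow> norm a < 1" "1 < x"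
  shows "(\<Prod>a\<leftarrow>xs. max 1 (norm a)) = x ^ count_list xs (of_real x)"
  using assms
proof (induction xs)
  case (Cons a xs)
  show ?case
  proof (cases "a = of_real x")
    case True
    thus ?thesis using Cons by (simp add: max_absorb2)
  next
    case False
    hence "max 1 (norm a) = 1" using Cons.prems(1)[of a] by simp
    thus ?thesis using Cons False by simp
  qed
qed simp

lemma two_valued_list:
  assumes "set xs \<subseteq> {a, b}" "a \<noteq> b"
  shows "length xs = count_list xs a + count_list xs b"
    and "(\<Prod>z\<leftarrow>xs. f z) = (f a :: 'b :: comm_monoid_mult) ^ count_list xs a * f b ^ count_list xs b"
  using assms by (induction xs) (auto simp: ac_simps)

text \<open>A Pisot number is its own Mahler measure, so the nonreciprocal case is Smyth's bound. In
  the reciprocal case the roots are closed under inversion, which leaves only \<open>x\<close> and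
  \<open>1 / x\<close>; then \<open>x\<close> is a quadratic unit and at least 2.\<close>

lemma pisot_number_lower_bound:
  assumes "pisot_number x"
  shows "1 < x" "x + 1 \<le> x ^ 3"
proof -
  define p where "p = min_int_poly x"
  show x: "1 < x" using assms by (simp add: pisot_number_def)
  have p: "is_min_int_poly x p" unfolding p_def
    using assms by (intro is_min_int_poly_min_int_poly) (simp add: pisot_number_def)
  have lc: "lead_coeff p = 1" using p by (simp add: is_min_int_poly_def)
  note rs = complex_roots_int_monic[OF lc]
  have small: "norm a < 1" if "a \<in> set (complex_roots_int p)" "a \<noteq> of_real x" for a
    using assms that rs(2) unfolding pisot_number_def p_def[symmetric] by blast
  have M: "mahler_measure p = x"
    unfolding rs(3) using prod_list_max_norm_Pisot[OF small x] is_min_int_poly_simple_root[OF p] by simp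
  show "x + 1 \<le> x ^ 3"
  proof (cases "reflect_poly p = p")
    case False
    thus ?thesis using mahler_measure_nonreciprocal[OF p x] M by auto
  next
    case True
    have c0: "Polynomial.coeff p 0 = 1" using True lc by (metis coeff_0_reflect_poly)
    have sub: "set (complex_roots_int p) \<subseteq> {of_real x, of_real (inverse x)}"
    proof
      fix a assume a: "a \<in> set (complex_roots_int p)"
      have a0: "a \<noteq> 0"
      proof
        assume "a = 0"
        with a have "poly (map_poly of_int p) (0::complex) = 0" using rs(2)[of 0] by (simp only:)
        thus False using c0 by (simp add: poly_0_coeff_0)
      qed
      have "reflect_poly (map_poly complex_of_int p) = map_poly of_int (reflect_poly p)"
        by (rule poly_eqI) (simp add: coeff_reflect_poly coeff_map_poly)
      hence "poly (map_poly of_int p) (inverse a) = 0"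
        using a a0 rs(2)[of a] poly_reflect_poly_nz[of a "map_poly of_int p"]
          poly_reflect_poly_nz[of "inverse a" "map_poly of_int p"] True
        by (simp add: True)
      hence "inverse a \<in> set (complex_roots_int p)" using rs(2) by simp
      show "a \<in> {of_real x, of_real (inverse x)}"
      proof (rule ccontr)
        assume *: "a \<notin> {of_real x, of_real (inverse x)}"
        hence "norm a < 1" using a small by auto
        hence "\<not> norm (inverse a) < 1" using a0 by (simp add: norm_inverse inverse_less_1_iff)
        hence "inverse a = of_real x" using small \<open>inverse a \<in> _\<close> by blast
        hence "a = of_real (inverse x)" by (metis inverse_inverse_eq of_real_inverse)
        thus False using * by simp
      qed
    qed
    define k where "k = count_list (complex_roots_int p) (of_real (inverse x))"
    have ne: "complex_of_real x \<noteq> of_real (inverse x)"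
    proof
      assume "complex_of_real x = of_real (inverse x)"
      hence "x = inverse x" by (simp only: of_real_eq_iff)
      thus False using x by (metis inverse_less_1_iff less_asym)
    qed
    \<comment> \<open>The constant coefficient 1 is the product of the moduli of the roots, so
      \<open>1 / x\<close> is a simple root like \<open>x\<close>.\<close>
    have "1 = x * inverse x ^ k"
      using rs(4) two_valued_list(2)[OF sub ne, of norm] c0 x is_min_int_poly_simple_root[OF p]
      by (simp add: k_def norm_inverse)
    hence "x ^ k = x ^ 1" using x by (simp add: field_simps)
    hence "k = 1" using x by (subst (asm) power_inject_exp) auto
    hence "degree p = 2"
      using two_valued_list(1)[OF sub ne] is_min_int_poly_simple_root[OF p] complex_roots_int(2)[of p]
      by (simp add: k_def)
    then obtain n :: int where "p = [:1, n, 1:]"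
      using c0 lc by (intro that[of "Polynomial.coeff p 1"] poly_eqI)
        (auto simp: coeff_pCons numeral_2_eq_2 coeff_eq_0 split: nat.split)
    hence "1 + x * (of_int n + x) = 0"
      using p by (simp add: is_min_int_poly_def map_poly_pCons)
    hence eq: "x * x = of_int (- n) * x - 1" by (simp add: algebra_simps)
    \<comment> \<open>The integer \<open>- n\<close> is the trace \<open>x + 1 / x\<close>, which
      exceeds 2 and is therefore at least 3.\<close>
    have "(x - 1) * (x - 1) > 0" using x by simp
    hence "of_int (- n) * x > 2 * x" using eq by (simp add: algebra_simps)
    hence "of_int (- n) > (2 :: real)" using x by (simp only: mult_less_cancel_right_pos)
    hence "- n \<ge> 3" by linarith
    hence "of_int (- n) \<ge> (3 :: real)" by linarith
    hence "of_int (- n) * x \<ge> 3 * x" using x by (intro mult_right_mono) auto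
    hence "x * x \<ge> 2 * x" using eq x by linarith
    hence "x \<ge> 2" using x by simp
    hence "x * x * x \<ge> 2 * 2 * x" by (intro mult_mono) auto
    thus ?thesis using x unfolding power3_eq_cube by linarith
  qed
qed

text \<open>The other zeros of the cubic satisfy \<open>z^2 + r z + r^2 - 1 = 0\<close>, with
  negative discriminant \<open>4 - 3 r^2\<close>, so they are conjugate with squared modulus
  \<open>r^2 - 1 < 1\<close>. The minimal polynomial divides the cubic, so its zeros are among
  these.\<close>

lemma cubic_pisot_number:
  fixes r :: real
  assumes r: "1 < r" "r < 4 / 3" and eq: "r ^ 3 = r + 1"
  shows "pisot_number r"
proof -
  define q :: "int poly" where "q = [:-1, -1, 0, 1:]"
  have q_root: "poly (map_poly of_int q) r = 0"
    using eq by (simp add: q_def map_poly_pCons power3_eq_cube algebra_simps)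
  have alg: "algebraic_int r"
    unfolding algebraic_int_altdef_ipoly using q_root by (intro exI[of _ q]) (simp add: q_def)
  have p: "is_min_int_poly r (min_int_poly r)" by (rule is_min_int_poly_min_int_poly[OF alg])
  obtain s where s: "q = min_int_poly r * s" using is_min_int_poly_dvd[OF p q_root] by (rule dvdE)
  have r2: "r * r < 16 / 9"
  proof -
    have "r * r < 4 / 3 * (4 / 3)" using r by (intro mult_strict_mono) auto
    thus ?thesis by simp
  qed
  show ?thesis
    unfolding pisot_number_def
  proof (intro conjI allI impI r(1) alg)
    fix z :: complex
    assume z: "poly (map_poly of_int (min_int_poly r)) z = 0 \<and> z \<noteq> of_real r"
    have "poly (map_poly of_int q) z = 0" unfolding s poly_of_int_mult using z by simp
    hence zz: "z ^ 3 = z + 1" by (simp add: q_def map_poly_pCons power3_eq_cube algebra_simps)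
    have "(z - of_real r) * (z * z + of_real r * z + of_real (r * r - 1)) =
        (z ^ 3 - z - 1) - of_real (r ^ 3 - r - 1)"
      by (simp add: power3_eq_cube algebra_simps)
    hence "z * z + of_real r * z + of_real (r * r - 1) = 0"
      using zz eq z by simp
    hence re: "Re z * Re z - Im z * Im z + r * Re z + (r * r - 1) = 0"
      and im: "Im z * (2 * Re z + r) = 0"
      by (simp_all add: complex_eq_iff algebra_simps)
    have "Im z \<noteq> 0"
    proof
      assume "Im z = 0"
      hence "(2 * Re z + r) * (2 * Re z + r) + 3 * (r * r) - 4 = 0"
        using re by (simp add: algebra_simps)
      moreover have "0 \<le> (2 * Re z + r) * (2 * Re z + r)" by simp
      moreover have "4 < 3 * (r * r)"
      proof -
        \<comment> \<open>On this range \<open>t (t^2 - 1)\<close> increases; it is 1 at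
          \<open>r\<close> but only 0.897 at 1.3.\<close>
        have "r \<ge> 1.3"
        proof (rule ccontr)
          assume "\<not> r \<ge> 1.3"
          have "1 * 1 \<le> r * r" using r by (intro mult_mono) auto
          have "r * (r * r - 1) \<le> 1.3 * (1.3 * 1.3 - 1)"
            using r \<open>\<not> r \<ge> 1.3\<close> \<open>1 * 1 \<le> r * r\<close>
            by (intro mult_mono diff_mono) auto
          moreover have "r * (r * r - 1) = 1" using eq by (simp add: power3_eq_cube algebra_simps)
          ultimately show False by simp
        qed
        hence "r * r \<ge> 1.3 * 1.3" by (intro mult_mono) auto
        thus ?thesis by simp
      qed
      ultimately show False by linarith
    qed
    hence a: "Re z = - r / 2" using im by simp
    have "Re z * Re z + Im z * Im z = r * r - 1"
      using re unfolding a by (simp add: algebra_simps)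
    hence "(norm z)\<^sup>2 < 1" 
      unfolding cmod_power2 using r2 by (simp add: power2_eq_square)
    thus "norm z < 1" by (simp add: abs_square_less_1)
  qed
qed

text \<open>The cubic has a root below 4/3, which is a Pisot number. Any Pisot number
  \<open>y\<close> has \<open>y (y^2 - 1) \<ge> 1\<close>, so monotonicity puts it at or above that
  root.\<close>

lemma smallest_pisot_cubic:
  "smallest_pisot < 4 / 3" "smallest_pisot ^ 3 = smallest_pisot + 1"
proof -
  have "\<exists>r\<ge>1. r \<le> 4 / 3 \<and> r ^ 3 - r - 1 = (0::real)"
    by (intro IVT') (auto intro!: continuous_intros simp: power3_eq_cube)
  then obtain r :: real where r: "1 \<le> r" "r \<le> 4 / 3" "r ^ 3 - r - 1 = 0" by blast
  have "r \<noteq> 1" "r \<noteq> 4 / 3"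
  proof -
    show "r \<noteq> 1" using r(3) by auto
    have "(4 / 3) ^ 3 - 4 / 3 - 1 \<noteq> (0::real)" by (simp add: power3_eq_cube)
    thus "r \<noteq> 4 / 3" using r(3) by metis
  qed
  hence r': "1 < r" "r < 4 / 3" "r ^ 3 = r + 1" using r by auto
  have "smallest_pisot = r"
    unfolding smallest_pisot_def
  proof (rule Least_equality)
    show "pisot_number r" by (rule cubic_pisot_number[OF r'])
    fix y assume "pisot_number y"
    note y = pisot_number_lower_bound[OF this]
    show "r \<le> y"
    proof (rule ccontr)
      assume "\<not> r \<le> y"
      hence "y * (y * y - 1) < r * (r * r - 1)"
        using y(1) r'(1) mult_strict_mono[of y r y r] less_1_mult[of y y]
        by (intro mult_strict_mono) auto
      moreover have "r * (r * r - 1) = 1" using r' by (simp add: power3_eq_cube algebra_simps)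
      ultimately show False using y(2) by (simp add: power3_eq_cube algebra_simps)
    qed
  qed
  thus "smallest_pisot < 4 / 3" "smallest_pisot ^ 3 = smallest_pisot + 1"
    using r' by auto
qed

text \<open>\<beta> is one of the roots, so it is at most its Mahler measure. Below the root of the
  cubic \<open>t^3 < t + 1\<close>, which rules out the nonreciprocal alternative.\<close>

lemma small_Mahler_imp_reciprocal:
  assumes \<beta>: "1 < \<beta>" "algebraic_int \<beta>" and M: "Mahler \<beta> < smallest_pisot"
  shows "reflect_poly (min_int_poly \<beta>) = min_int_poly \<beta>" "\<beta> < 4 / 3"
proof -
  define p where "p = min_int_poly \<beta>"
  have p: "is_min_int_poly \<beta> p" unfolding p_def by (rule is_min_int_poly_min_int_poly[OF \<beta>(2)])
  have lc: "lead_coeff p = 1" using p by (simp add: is_min_int_poly_def)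
  note rs = complex_roots_int_monic[OF lc]
  have "of_real \<beta> \<in> set (complex_roots_int p)"
    using rs(2)[of "of_real \<beta>"] p by (simp add: poly_of_int_of_real is_min_int_poly_def)
  hence "norm (complex_of_real \<beta>) \<le> mahler_measure p" unfolding rs(3) by (rule prod_list_max_norm_ge)
  hence le: "\<beta> \<le> mahler_measure p" using \<beta> by simp
  have lt: "mahler_measure p < smallest_pisot" using M by (simp add: Mahler_def p_def)
  show "\<beta> < 4 / 3" using le lt smallest_pisot_cubic(1) by linarith
  define y where "y = mahler_measure p"
  have y: "1 < y" "y < smallest_pisot" using le lt \<beta> by (auto simp: y_def)
  have "y * (y * y - 1) < smallest_pisot * (smallest_pisot * smallest_pisot - 1)"
    using y mult_strict_mono[of y smallest_pisot y smallest_pisot] less_1_mult[of y y]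
    by (intro mult_strict_mono) auto
  also have "\<dots> = 1" using smallest_pisot_cubic(2) by (simp add: power3_eq_cube algebra_simps)
  finally have "\<not> y + 1 \<le> y ^ 3" by (simp add: power3_eq_cube algebra_simps)
  thus "reflect_poly (min_int_poly \<beta>) = min_int_poly \<beta>"
    using mahler_measure_nonreciprocal[OF p \<beta>(1)] by (auto simp: y_def p_def)
qed

section \<open>Renyi expansions\<close>

lemma poly_trinomial: "poly (trinomial n) x = x ^ n + x - 1"
  by (simp add: trinomial_def poly_monom)

lemma trinomial_root_unique:
  fixes x y :: real
  assumes "0 < x" "0 \<le> y" "x ^ n + x = y ^ n + y"
  shows "x = y"
  using assms power_mono[of x y n] power_mono[of y x n] by (cases x y rule: linorder_cases) auto

lemma theta_root:
  assumes "n \<ge> 1"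
  shows "0 < theta n" "theta n < 1" "theta n ^ n + theta n = 1"
proof -
  have "\<exists>x\<ge>0. x \<le> 1 \<and> x ^ n + x = (1::real)"
    using assms by (intro IVT') (auto intro!: continuous_intros simp: power_0_left)
  then obtain x :: real where x: "0 \<le> x" "x \<le> 1" "x ^ n + x = 1" by blast
  have "0 ^ n + 0 \<noteq> (1::real)" "1 ^ n + 1 \<noteq> (1::real)" using assms by (simp_all add: power_0_left)
  hence "x \<noteq> 0" "x \<noteq> 1" using x(3) by metis+
  hence x': "0 < x \<and> x < 1 \<and> poly (trinomial n) x = 0" using x by (simp add: poly_trinomial)
  have "0 < theta n \<and> theta n < 1 \<and> poly (trinomial n) (theta n) = 0"
    unfolding theta_def
  proof (rule theI[of _ x])
    show "0 < x \<and> x < 1 \<and> poly (trinomial n) x = 0" by (rule x')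
  next
    fix y :: real assume "0 < y \<and> y < 1 \<and> poly (trinomial n) y = 0"
    hence y: "0 < y" "y ^ n + y = x ^ n + x" using x(3) by (simp_all add: poly_trinomial)
    show "y = x" by (rule trinomial_root_unique[OF y(1) x(1) y(2)])
  qed
  thus "0 < theta n" "theta n < 1" "theta n ^ n + theta n = 1" by (auto simp: poly_trinomial)
qed

lemma le_theta_iff:
  assumes "n \<ge> 1" "0 < y"
  shows "y \<le> theta n \<longleftrightarrow> y ^ n + y \<le> 1"
proof
  assume "y \<le> theta n"
  hence "y ^ n \<le> theta n ^ n" using assms by (intro power_mono) auto
  thus "y ^ n + y \<le> 1" using \<open>y \<le> theta n\<close> theta_root[OF assms(1)] by linarith
next
  assume *: "y ^ n + y \<le> 1"
  show "y \<le> theta n"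
  proof (rule ccontr)
    assume "\<not> y \<le> theta n"
    moreover from this have "theta n ^ n \<le> y ^ n"
      using theta_root[OF assms(1)] by (intro power_mono) auto
    ultimately show False using * theta_root[OF assms(1)] by linarith
  qed
qed

text \<open>In terms of \<open>y = 1 / \<beta>\<close>, the condition
  \<open>inverse (theta n) \<le> \<beta>\<close> reads \<open>y ^ n + y \<le> 1\<close>. It persists
  as \<open>n\<close> grows, and \<open>dyg \<beta>\<close> is the least such
  \<open>n\<close>.\<close>

lemma dyg_bounds:
  assumes \<beta>: "1 < \<beta>" "\<beta> < 4 / 3"
  defines "y \<equiv> inverse \<beta>"
  shows "3 \<le> dyg \<beta>" and "y ^ dyg \<beta> + y \<le> 1" and "theta (dyg \<beta> - 1) < y"
    and "\<And>k. y ^ k + y \<le> 1 \<Longrightarrow> dyg \<beta> \<le> k"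
proof -
  have y: "0 < y" "y < 1" "3 / 4 < y" using \<beta> by (auto simp: y_def field_simps)
  have iff: "inverse (theta n) \<le> \<beta> \<longleftrightarrow> y ^ n + y \<le> 1" if "n \<ge> 1" for n
  proof -
    have "inverse (theta n) \<le> \<beta> \<longleftrightarrow> y \<le> theta n"
      using theta_root(1)[OF that] \<beta> by (simp add: y_def field_simps)
    thus ?thesis using le_theta_iff[OF that y(1)] by simp
  qed
  define Q where "Q = (\<lambda>n. y ^ n + y \<le> 1)"
  have "\<exists>n. y ^ n < 1 - y" using y by (intro real_arch_pow_inv) auto
  hence ex: "\<exists>n. Q n" unfolding Q_def by (metis add.commute le_diff_eq less_imp_le)
  have mono: "Q n'" if "Q n" "n \<le> n'" for n n'
    
  proof -
    have "y ^ n' \<le> y ^ n" using y that(2) by (intro power_decreasing) auto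
    thus ?thesis using that(1) by (simp add: Q_def)
  qed
  \<comment> \<open>For \<open>y > 3/4\<close> already \<open>y^2 + y > 1\<close>, so the least
    exponent is in the range \<open>n \<ge> 3\<close> to which \<open>dyg\<close> is
    restricted.\<close>
  have "\<not> Q 2"
  proof -
    have "3 / 4 * (3 / 4) \<le> y * y" using y by (intro mult_mono) auto
    thus ?thesis using y by (simp add: Q_def power2_eq_square)
  qed
  define N where "N = (LEAST n. Q n)"
  have N: "Q N" "\<And>k. Q k \<Longrightarrow> N \<le> k" unfolding N_def using ex by (auto intro: LeastI_ex Least_le)
  have "3 \<le> N" using mono[OF N(1), of 2] \<open>\<not> Q 2\<close> by linarith
  have char: "3 \<le> n \<and> inverse (theta n) \<le> \<beta> \<and> \<beta> < inverse (theta (n - 1)) \<longleftrightarrow> n = N" for n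
  proof (cases "3 \<le> n")
    case True
    hence n1: "1 \<le> n" "1 \<le> n - 1" by auto
    have "(inverse (theta n) \<le> \<beta> \<and> \<beta> < inverse (theta (n - 1))) \<longleftrightarrow> Q n \<and> \<not> Q (n - 1)"
      unfolding not_le[symmetric] iff[OF n1(1)] iff[OF n1(2)] Q_def ..
    also have "\<dots> \<longleftrightarrow> n = N"
    proof
      assume "Q n \<and> \<not> Q (n - 1)"
      hence "N \<le> n" "\<not> N \<le> n - 1" using N mono[of N "n - 1"] by auto
      thus "n = N" by linarith
    next
      assume "n = N"
      thus "Q n \<and> \<not> Q (n - 1)" using N(1) N(2)[of "n - 1"] True by auto
    qed
    finally show ?thesis using True by simp
  qed (use \<open>3 \<le> N\<close> in auto)
  have dyg: "dyg \<beta> = N" unfolding dyg_def char by simp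
  show "3 \<le> dyg \<beta>" "y ^ dyg \<beta> + y \<le> 1" "\<And>k. y ^ k + y \<le> 1 \<Longrightarrow> dyg \<beta> \<le> k"
    using N \<open>3 \<le> N\<close> by (auto simp: dyg Q_def)
  have "\<not> Q (N - 1)" using N(2)[of "N - 1"] \<open>3 \<le> N\<close> by auto
  thus "theta (dyg \<beta> - 1) < y"
    using le_theta_iff[OF _ y(1), of "N - 1"] \<open>3 \<le> N\<close> by (simp add: dyg Q_def not_le)
qed

section \<open>The orbit of 1 and its digits\<close>

context
  fixes \<beta> :: real
  assumes \<beta>: "1 < \<beta>" "\<beta> < 4 / 3"
begin

lemma orbit_Suc:
  "(beta_transform \<beta> ^^ Suc i) 1 = \<beta> * (beta_transform \<beta> ^^ i) 1 - renyi_digit \<beta> (Suc i)"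
  by (simp add: renyi_digit_def beta_transform_def frac_def)

lemma orbit_bounds: "0 \<le> (beta_transform \<beta> ^^ i) 1" "(beta_transform \<beta> ^^ i) 1 \<le> 1"
    "0 < i \<Longrightarrow> (beta_transform \<beta> ^^ i) 1 < 1"
  by (cases i; simp add: beta_transform_def frac_lt_1 less_imp_le)+

lemma renyi_digit_cases: "0 < i \<Longrightarrow> renyi_digit \<beta> i = 0 \<or> renyi_digit \<beta> i = 1"
proof -
  assume "0 < i"
  have "\<beta> * (beta_transform \<beta> ^^ (i - 1)) 1 \<le> \<beta> * 1"
    using \<beta> orbit_bounds by (intro mult_left_mono) auto
  hence "\<beta> * (beta_transform \<beta> ^^ (i - 1)) 1 < 2" using \<beta> by linarith
  moreover have "0 \<le> \<beta> * (beta_transform \<beta> ^^ (i - 1)) 1"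
    using \<beta> orbit_bounds by simp
  ultimately have "0 \<le> renyi_digit \<beta> i" "renyi_digit \<beta> i < 2"
    unfolding renyi_digit_def by (auto simp: floor_less_iff)
  thus ?thesis by auto
qed

lemma renyi_digit_1: "renyi_digit \<beta> 1 = 1"
  using \<beta> by (auto simp: renyi_digit_def floor_eq_iff)

lemma orbit_1: "(beta_transform \<beta> ^^ 1) 1 = \<beta> - 1"
  using orbit_Suc[of 0] renyi_digit_1 by simp

lemma orbit_gap:
  assumes "\<And>k. i < k \<Longrightarrow> k \<le> i + d \<Longrightarrow> renyi_digit \<beta> k = 0"
  shows "(beta_transform \<beta> ^^ (i + d)) 1 = \<beta> ^ d * (beta_transform \<beta> ^^ i) 1"
  using assms
proof (induction d)
  case (Suc d)
  thus ?case using orbit_Suc[of "i + d"] by simp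
qed simp

text \<open>Dividing the hypothesis by \<open>\<beta> ^ Suc d\<close> gives the inequality whose
  least exponent is \<open>dyg \<beta>\<close>.\<close>

lemma dyg_le_of_power:
  assumes "1 \<le> \<beta> ^ d * (\<beta> - 1)"
  shows "dyg \<beta> \<le> Suc d"
proof (rule dyg_bounds(4)[OF \<beta>])
  have "inverse \<beta> ^ Suc d * 1 \<le> inverse \<beta> ^ Suc d * (\<beta> ^ d * (\<beta> - 1))"
    using assms \<beta> by (intro mult_left_mono) auto
  also have "\<dots> = (inverse \<beta> ^ d * \<beta> ^ d) * (inverse \<beta> * (\<beta> - 1))" by (simp add: ac_simps)
  also have "inverse \<beta> ^ d * \<beta> ^ d = 1" using \<beta> by (simp add: power_mult_distrib[symmetric])
  also have "inverse \<beta> * (\<beta> - 1) = 1 - inverse \<beta>" using \<beta> by (simp add: field_simps)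
  finally show "inverse \<beta> ^ Suc d + inverse \<beta> \<le> 1" by simp
qed

text \<open>A digit 1 leaves an orbit point of at most \<open>\<beta> - 1\<close>, so
  \<open>d\<close> zeros followed by a 1 require
  \<open>1 \<le> \<beta> ^ Suc d * (\<beta> - 1)\<close>; hence the distance \<open>d + 1\<close> is
  at least \<open>dyg \<beta> - 1\<close>.\<close>

lemma dyg_le_of_digits:
  assumes i: "0 < i" "i < j" "renyi_digit \<beta> i = 1" "renyi_digit \<beta> j = 1"
  shows "i + (dyg \<beta> - 1) \<le> j"
proof -
  \<comment> \<open>The next digit 1 after \<open>i\<close> replaces \<open>j\<close>, so that only
    zeros lie between and the orbit is multiplied by \<beta> at each step.\<close>
  define j' where "j' = (LEAST k. i < k \<and> renyi_digit \<beta> k = 1)"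
  have j': "i < j'" "renyi_digit \<beta> j' = 1" "j' \<le> j"
    using LeastI[of "\<lambda>k. i < k \<and> renyi_digit \<beta> k = 1" j] i
    by (auto simp: j'_def intro: Least_le)
  have zero: "renyi_digit \<beta> k = 0" if "i < k" "k < j'" for k
    using not_less_Least[of k "\<lambda>k. i < k \<and> renyi_digit \<beta> k = 1"] that renyi_digit_cases[of k]
    by (auto simp: j'_def)
  define d where "d = j' - 1 - i"
  have d: "j' = Suc (i + d)" using j'(1) by (simp add: d_def)
  have "(beta_transform \<beta> ^^ (i + d)) 1 = \<beta> ^ d * (beta_transform \<beta> ^^ i) 1"
    by (intro orbit_gap zero) (auto simp: d)
  moreover have "1 \<le> \<beta> * (beta_transform \<beta> ^^ (i + d)) 1"
    using j'(2) by (simp add: renyi_digit_def d floor_eq_iff)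
  moreover have "(beta_transform \<beta> ^^ i) 1 \<le> \<beta> - 1"
  proof -
    obtain i' where i': "i = Suc i'" using i(1) by (cases i) auto
    have "\<beta> * (beta_transform \<beta> ^^ i') 1 \<le> \<beta> * 1"
      using \<beta> orbit_bounds by (intro mult_left_mono) auto
    thus ?thesis using orbit_Suc[of i'] i(3) by (simp only: i')
  qed
  hence "\<beta> * (\<beta> ^ d * (beta_transform \<beta> ^^ i) 1) \<le> \<beta> * (\<beta> ^ d * (\<beta> - 1))"
    using \<beta> by (intro mult_left_mono) auto
  ultimately have "1 \<le> \<beta> ^ Suc d * (\<beta> - 1)" by simp
  from dyg_le_of_power[OF this] show ?thesis using d j'(3) by linarith
qed

text \<open>After the first digit the orbit point is exactly \<open>\<beta> - 1\<close>, so the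
  threshold works in both directions: the second digit 1 appears precisely when the inequality
  defining \<open>dyg \<beta>\<close> first holds.\<close>

lemma renyi_digit_dyg:
  shows "renyi_digit \<beta> (dyg \<beta>) = 1" and "\<And>k. 1 < k \<Longrightarrow> k < dyg \<beta> \<Longrightarrow> renyi_digit \<beta> k = 0"
proof -
  let ?n = "dyg \<beta>"
  have n: "3 \<le> ?n" by (rule dyg_bounds(1)[OF \<beta>])
  show zero: "renyi_digit \<beta> k = 0" if k: "1 < k" "k < ?n" for k
  proof (rule ccontr)
    assume "renyi_digit \<beta> k \<noteq> 0"
    hence ex: "\<exists>k. 1 < k \<and> renyi_digit \<beta> k = 1" using renyi_digit_cases[of k] k by auto
    define j where "j = (LEAST k. 1 < k \<and> renyi_digit \<beta> k = 1)"
    have j: "1 < j" "renyi_digit \<beta> j = 1" using LeastI_ex[OF ex] by (auto simp: j_def)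
    have "j \<le> k" using \<open>renyi_digit \<beta> k \<noteq> 0\<close> renyi_digit_cases[of k] k
      by (auto simp: j_def intro!: Least_le)
    have zero: "renyi_digit \<beta> i = 0" if "1 < i" "i < j" for i
      using not_less_Least[of i "\<lambda>k. 1 < k \<and> renyi_digit \<beta> k = 1"] that renyi_digit_cases[of i]
      by (auto simp: j_def)
    define d where "d = j - 2"
    have d: "j = Suc (1 + d)" using j(1) by (simp add: d_def)
    have "(beta_transform \<beta> ^^ (1 + d)) 1 = \<beta> ^ d * (beta_transform \<beta> ^^ 1) 1"
      by (intro orbit_gap zero) (auto simp: d)
    moreover have "1 \<le> \<beta> * (beta_transform \<beta> ^^ (1 + d)) 1"
      using j(2) by (simp add: renyi_digit_def d floor_eq_iff)
    ultimately have "1 \<le> \<beta> ^ Suc d * (\<beta> - 1)" unfolding orbit_1 by simp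
    from dyg_le_of_power[OF this] show False using d \<open>j \<le> k\<close> k by linarith
  qed
  define d where "d = ?n - 2"
  have d: "?n = Suc (1 + d)" using n by (simp add: d_def)
  have "(beta_transform \<beta> ^^ (1 + d)) 1 = \<beta> ^ d * (beta_transform \<beta> ^^ 1) 1"
    by (intro orbit_gap zero) (auto simp: d)
  hence *: "\<beta> * (beta_transform \<beta> ^^ (1 + d)) 1 = \<beta> ^ Suc d * (\<beta> - 1)"
    unfolding orbit_1 by simp
  have "inverse \<beta> ^ ?n \<le> 1 - inverse \<beta>" using dyg_bounds(2)[OF \<beta>] by simp
  hence "\<beta> ^ ?n * inverse \<beta> ^ ?n \<le> \<beta> ^ ?n * (1 - inverse \<beta>)"
    using \<beta> by (intro mult_left_mono) auto
  moreover have "\<beta> ^ ?n * inverse \<beta> ^ ?n = 1" using \<beta> by (simp add: power_mult_distrib[symmetric])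
  moreover have "\<beta> ^ ?n * (1 - inverse \<beta>) = \<beta> ^ Suc d * (\<beta> - 1)"
    using \<beta> by (subst d) (simp add: field_simps)
  ultimately have "1 \<le> \<beta> * (beta_transform \<beta> ^^ (1 + d)) 1" unfolding * by linarith
  hence "1 \<le> renyi_digit \<beta> ?n" by (subst d) (simp add: renyi_digit_def le_floor_iff)
  thus "renyi_digit \<beta> ?n = 1" using renyi_digit_cases[of ?n] n by auto
qed

lemma parry_upper_nth:
  "fps_nth (parry_upper \<beta>) i = (if i = 0 then - 1 else renyi_digit \<beta> i)"
  by (simp add: parry_upper_def)

lemma parry_upper_minus_trinomial_nth:
  "fps_nth (parry_upper \<beta> - fps_of_poly (trinomial (dyg \<beta>))) i =
     (if i \<in> {i. dyg \<beta> < i \<and> renyi_digit \<beta> i = 1} then 1 else 0)"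
  using dyg_bounds(1)[OF \<beta>] renyi_digit_1 renyi_digit_dyg renyi_digit_cases[of i]
  by (cases i "dyg \<beta>" rule: linorder_cases; cases "i = 0"; cases "i = 1")
    (auto simp: parry_upper_nth trinomial_def coeff_pCons split: nat.splits)

lemma sum_fps_X_power_nth:
  "finite A \<Longrightarrow> fps_nth (\<Sum>i\<in>A. fps_X ^ i :: int fps) k = (if k \<in> A then 1 else 0)"
  by (simp add: fps_sum_nth)

lemma parry_upper_form:
  "\<exists>m :: nat \<Rightarrow> nat. m 0 = dyg \<beta> \<and>
     ((\<exists>N. (\<forall>q<N. m q + (dyg \<beta> - 1) \<le> m (q + 1)) \<and>
           parry_upper \<beta> = fps_of_poly (trinomial (dyg \<beta>)) + (\<Sum>q=1..N. fps_X ^ m q)) \<or>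
      (\<forall>q. m q + (dyg \<beta> - 1) \<le> m (q + 1)) \<and>
      (\<lambda>q. fps_X ^ m (q + 1)) sums (parry_upper \<beta> - fps_of_poly (trinomial (dyg \<beta>))))"
proof -
  \<comment> \<open>\<open>S\<close> has least element \<open>dyg \<beta>\<close>, so the
    enumeration starts with the exponent of the trinomial and the later values are the additional
    exponents.\<close>
  define S where "S = {i. dyg \<beta> \<le> i \<and> renyi_digit \<beta> i = 1}"
  define m where "m = enumerate S"
  have n: "3 \<le> dyg \<beta>" by (rule dyg_bounds(1)[OF \<beta>])
  have nS: "dyg \<beta> \<in> S" using renyi_digit_dyg by (simp add: S_def)
  have m0: "m 0 = dyg \<beta>"
    using nS by (auto simp: m_def enumerate_0 S_def intro!: Least_equality)
  have gap: "i + (dyg \<beta> - 1) \<le> j" if "i \<in> S" "j \<in> S" "i < j" for i j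
    using dyg_le_of_digits[of i j] that n by (auto simp: S_def)
  have nth: "fps_nth (parry_upper \<beta> - fps_of_poly (trinomial (dyg \<beta>))) i =
      (if i \<in> S - {dyg \<beta>} then 1 else 0)" for i
    unfolding parry_upper_minus_trinomial_nth by (auto simp: S_def)
  show ?thesis
  proof (cases "finite S")
    case True
    define N where "N = card S - 1"
    have "card S > 0" using True nS by (metis card_gt_0_iff empty_iff)
    hence card: "card S = Suc N" by (simp add: N_def)
    have bij: "bij_betw m {..<card S} S" unfolding m_def by (rule finite_bij_enumerate[OF True])
    have "bij_betw m ({..<card S} - {0}) (S - {dyg \<beta>})"
      by (intro bij_betw_DiffI bij) (simp_all add: nS m0 card bij_betw_def)
    also have "{..<card S} - {0} = {1..N}" by (auto simp: card)
    finally have "(\<Sum>q=1..N. fps_X ^ m q :: int fps) = (\<Sum>i\<in>S - {dyg \<beta>}. fps_X ^ i)"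
      by (rule sum.reindex_bij_betw)
    also have "\<dots> = parry_upper \<beta> - fps_of_poly (trinomial (dyg \<beta>))"
      using True by (intro fps_ext) (simp only: nth sum_fps_X_power_nth finite_Diff)
    finally have eq: "parry_upper \<beta> = fps_of_poly (trinomial (dyg \<beta>)) + (\<Sum>q=1..N. fps_X ^ m q)"
      by simp
    \<comment> \<open>Only for \<open>q < N\<close> are both values elements of \<open>S\<close>;
      beyond that the enumeration of a finite set has no meaning.\<close>
    have "m q + (dyg \<beta> - 1) \<le> m (q + 1)" if "q < N" for q
      using that True card unfolding m_def
      by (intro gap finite_enumerate_in_set finite_enumerate_step[of S q, simplified]) auto
    with m0 eq show ?thesis by blast
  next
    case False
    have sm: "m q < m (Suc q)" for q unfolding m_def using False by (intro enumerate_step)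
    have mS: "m q \<in> S" for q unfolding m_def using False by (intro enumerate_in_set)
    have 1: "m q + (dyg \<beta> - 1) \<le> m (q + 1)" for q
      using gap[OF mS mS sm[of q]] by simp
    have inj: "inj m" by (rule strict_mono_imp_inj_on[of m UNIV]) (use sm in \<open>simp add: strict_mono_Suc_iff\<close>)
    have le: "q \<le> m q" for q unfolding m_def using False by (intro le_enumerate)
    have "(\<lambda>q. fps_X ^ m (q + 1) :: int fps) sums (parry_upper \<beta> - fps_of_poly (trinomial (dyg \<beta>)))"
      unfolding sums_def tendsto_fps_iff
    proof
      fix i
      \<comment> \<open>Convergence is coefficientwise. Since \<open>q \<le> m q\<close>, an
        exponent equal to \<open>i\<close> already occurs among the first \<open>Q > i\<close>
        summands.\<close>
      show "\<forall>\<^sub>F Q in sequentially. fps_nth (\<Sum>q<Q. fps_X ^ m (q + 1)) i =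
              fps_nth (parry_upper \<beta> - fps_of_poly (trinomial (dyg \<beta>))) i"
        using eventually_gt_at_top[of i]
      proof eventually_elim
        case (elim Q)
        have "inj_on (\<lambda>q. m (q + 1)) {..<Q}" using inj by (auto simp: inj_on_def dest: injD)
        hence "(\<Sum>q<Q. fps_X ^ m (q + 1) :: int fps) = (\<Sum>k\<in>(\<lambda>q. m (q + 1)) ` {..<Q}. fps_X ^ k)"
          by (simp add: sum.reindex)
        moreover have "i \<in> (\<lambda>q. m (q + 1)) ` {..<Q} \<longleftrightarrow> i \<in> S - {dyg \<beta>}"
        proof
          assume "i \<in> (\<lambda>q. m (q + 1)) ` {..<Q}"
          then obtain q where q: "i = m (Suc q)" by auto
          have "m 0 \<noteq> m (Suc q)" using inj by (auto dest: injD)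
          thus "i \<in> S - {dyg \<beta>}" using q mS m0 by auto
        next
          assume i: "i \<in> S - {dyg \<beta>}"
          obtain q where q: "i = m q" using enumerate_Ex[of S i] False i by (auto simp: m_def)
          have "q \<noteq> 0" using i q m0 by (intro notI) auto
          moreover have "q \<le> i" using le q by simp
          ultimately show "i \<in> (\<lambda>q. m (q + 1)) ` {..<Q}"
            using elim q by (intro image_eqI[of _ _ "q - 1"]) auto
        qed
        ultimately show ?case by (simp only: nth sum_fps_X_power_nth finite_imageI finite_lessThan)
      qed
    qed
    with m0 1 show ?thesis by blast
  qed
qed

text \<open>The expansion of 1 in base \<beta> with its remainder; as the orbit is nonnegative, it
  bounds every partial sum by 1.\<close>

lemma sum_renyi_digits:
  "(\<Sum>i=1..N. of_int (renyi_digit \<beta> i) * inverse \<beta> ^ i) = 1 - inverse \<beta> ^ N * (beta_transform \<beta> ^^ N) 1"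
proof (induction N)
  case (Suc N)
  have "inverse \<beta> ^ Suc N * (beta_transform \<beta> ^^ Suc N) 1 =
      (inverse \<beta> * \<beta>) * (inverse \<beta> ^ N * (beta_transform \<beta> ^^ N) 1) - inverse \<beta> ^ Suc N * renyi_digit \<beta> (Suc N)"
    unfolding orbit_Suc by (simp only: power_Suc right_diff_distrib ac_simps)
  also have "inverse \<beta> * \<beta> = 1" using \<beta> by simp
  finally show ?case using Suc by simp
qed simp

end

section \<open>Natural boundaries\<close>

text \<open>Pigeonhole: two windows of length \<open>j\<close> agree, since there are finitely many
  words of that length. If each window determined the next term, the sequence would repeat from
  there on.\<close>

lemma divergent_continuations_ex:
  fixes a :: "nat \<Rightarrow> 'a"
  assumes fin: "finite (range a)" and np: "\<not> (\<exists>N p. 0 < p \<and> (\<forall>i>N. a (i + p) = a i))"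
  shows "\<exists>M N. j \<le> M \<and> j \<le> N \<and> (\<forall>i. 1 \<le> i \<and> i \<le> j \<longrightarrow> a (M - i) = a (N - i)) \<and> a M \<noteq> a N"
proof (rule ccontr)
  assume "\<not> ?thesis"
  hence det: "a M = a N" if "j \<le> M" "j \<le> N" "\<And>i. 1 \<le> i \<Longrightarrow> i \<le> j \<Longrightarrow> a (M - i) = a (N - i)" for M N
    using that by blast
  define W where "W = (\<lambda>N. map (\<lambda>i. a (N - i)) [1..<Suc j])"
  have "W ` {j..} \<subseteq> {xs. set xs \<subseteq> range a \<and> length xs = j}" by (auto simp: W_def)
  hence "finite (W ` {j..})" using finite_lists_length_eq[OF fin] by (rule finite_subset)
  hence "\<not> inj_on W {j..}" using finite_imageD infinite_Ici by blast
  then obtain M0 N0 where MN0: "j \<le> M0" "j \<le> N0" "M0 \<noteq> N0" "W M0 = W N0"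
    by (auto simp: inj_on_def)
  obtain M N where MN: "j \<le> M" "M < N" "W M = W N"
    using MN0 by (cases M0 N0 rule: linorder_cases) auto
  have W: "a (M - i) = a (N - i)" if "1 \<le> i" "i \<le> j" for i
    using MN(3) that unfolding W_def by (auto simp: map_eq_conv)
  have eq: "a (M + k) = a (N + k)" for k
  proof (induction k rule: less_induct)
    case (less k)
    show ?case
    proof (rule det)
      fix i assume i: "1 \<le> i" "i \<le> j"
      show "a (M + k - i) = a (N + k - i)"
      proof (cases "i \<le> k")
        case True
        thus ?thesis using less[of "k - i"] i by simp
      next
        case False
        hence "M + k - i = M - (i - k)" "N + k - i = N - (i - k)" by auto
        thus ?thesis using W[of "i - k"] False i by simp
      qed
    qed (use MN in auto)
  qed
  have "a (i + (N - M)) = a i" if "i > M" for i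
  proof -
    have "M + (i - M) = i" "N + (i - M) = i + (N - M)" using that MN by auto
    thus ?thesis using eq[of "i - M"] by simp
  qed
  thus False using np MN by (metis zero_less_diff)
qed

lemma norm_sum_geometric_le:
  fixes z :: complex and c :: "nat \<Rightarrow> complex"
  assumes z: "norm z < 1" and c: "\<And>k. norm (c k) \<le> C" and "finite A" "\<And>k. k \<in> A \<Longrightarrow> j \<le> k"
  shows "norm (\<Sum>k\<in>A. c k * z ^ k) \<le> C * norm z ^ j / (1 - norm z)"
proof -
  have C: "0 \<le> C" using c[of 0] norm_ge_zero[of "c 0"] by linarith
  have "norm (\<Sum>k\<in>A. c k * z ^ k) \<le> (\<Sum>k\<in>A. C * norm z ^ k)"
    using c by (intro sum_norm_le) (auto simp: norm_mult norm_power intro!: mult_right_mono)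
  also have "\<dots> = (\<Sum>i\<in>(\<lambda>k. k - j) ` A. C * norm z ^ (i + j))"
  proof -
    have "inj_on (\<lambda>k. k - j) A"
      by (rule inj_onI) (metis assms(4) le_add_diff_inverse2)
    thus ?thesis by (simp add: sum.reindex assms(4))
  qed
  also have "\<dots> = C * norm z ^ j * (\<Sum>i\<in>(\<lambda>k. k - j) ` A. norm z ^ i)"
    by (simp add: sum_distrib_left power_add mult_ac)
  also have "(\<Sum>i\<in>(\<lambda>k. k - j) ` A. norm z ^ i) \<le> (\<Sum>i. norm z ^ i)"
    using z assms(3) by (intro sum_le_suminf summable_geometric) auto
  also have "(\<Sum>i. norm z ^ i) = 1 / (1 - norm z)" using z by (intro suminf_geometric) auto
  finally show ?thesis using C by (simp add: mult_left_mono)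
qed

lemma norm_less_conv_radius:
  assumes "1 \<le> fps_conv_radius F" "norm z < 1"
  shows "ereal (norm z) < fps_conv_radius F"
proof -
  have "ereal (norm z) < 1" using assms(2) by simp
  thus ?thesis using assms(1) by (rule less_le_trans)
qed

lemma holomorphic_on_eval_fps_unit_ball:
  fixes F :: "complex fps"
  assumes "1 \<le> fps_conv_radius F"
  shows "eval_fps F holomorphic_on ball 0 1"
  using norm_less_conv_radius[OF assms] by (intro holomorphic_on_eval_fps) (auto simp: in_eball_iff)

text \<open>
  On the circle \<open>\<bar>z - w\<bar> = \<rho>\<close> the quadratic vanishes exactly at the two points of the unit circle
  and to the same order as \<open>\<bar>z\<bar>\<^sup>2 - 1\<close>; multiplying by it compensates bounds that blow up like
  \<open>1 / \<bar>\<bar>z\<bar> - 1\<bar>\<close>.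
\<close>
lemma riesz_quadratic:
  fixes w z :: complex
  assumes w: "norm w = 1" and z: "norm (z - w) = \<rho>"
  shows "norm ((z - w)\<^sup>2 + (of_real \<rho>)\<^sup>2 * w * z) = \<rho> * \<bar>(norm z)\<^sup>2 - 1\<bar>"
proof -
  define u where "u = z - w"
  have zu: "z = u + w" by (simp add: u_def)
  have ww: "w * cnj w = 1" using w by (simp add: complex_norm_square[symmetric])
  have uu: "(of_real \<rho>)\<^sup>2 = u * cnj u"
    unfolding complex_norm_square[symmetric] by (simp add: z u_def)
  have "(z - w)\<^sup>2 + (of_real \<rho>)\<^sup>2 * w * z = u * w * (u * cnj u + (u * cnj w + cnj u * w)) + u * u * (1 - w * cnj w)"
    unfolding uu zu by (simp add: power2_eq_square algebra_simps)
  also have "u * cnj u + (u * cnj w + cnj u * w) = (u + w) * cnj (u + w) - w * cnj w"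
    by (simp add: algebra_simps)
  also have "\<dots> = z * cnj z - 1" unfolding ww zu ..
  also have "\<dots> = of_real ((norm z)\<^sup>2 - 1)"
    by (simp only: of_real_diff complex_norm_square of_real_1)
  finally have "(z - w)\<^sup>2 + (of_real \<rho>)\<^sup>2 * w * z = u * w * of_real ((norm z)\<^sup>2 - 1)"
    using ww by simp
  thus ?thesis using w z by (simp only: norm_mult norm_of_real) (simp add: u_def)
qed

text \<open>Continuing the series across the arc continues all its shifts. Riesz's quadratic turns
  the bounds on the two sides of the circle into one bound independent of the shift, which yields
  the normal family.\<close>

lemma szego_holomorphic:
  fixes a :: "nat \<Rightarrow> complex"
  assumes fin: "finite (range a)" and np: "\<not> (\<exists>N p. 0 < p \<and> (\<forall>i>N. a (i + p) = a i))"
    and w: "norm w = 1" and r: "0 < r" and g: "g holomorphic_on ball w r"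
    and eq: "\<And>z. z \<in> ball w r \<Longrightarrow> norm z < 1 \<Longrightarrow> (\<lambda>n. a n * z ^ n) sums g z"
  shows False
proof -
  obtain C where C: "\<And>n. norm (a n) \<le> C"
    using finite_imp_bounded[OF fin] by (auto simp: bounded_iff)
  have C0: "0 \<le> C" using C[of 0] norm_ge_zero[of "a 0"] by linarith
  \<comment> \<open>Radius at most 1/2 keeps the closed disc around \<open>w\<close> away from 0 and
    inside norm 3/2; radius at most \<open>r / 2\<close> makes \<open>g\<close> bounded on
    it.\<close>
  define \<rho> where "\<rho> = min (r / 2) (1 / 2)"
  have \<rho>: "0 < \<rho>" "\<rho> < r" "\<rho> \<le> 1 / 2" using r by (auto simp: \<rho>_def)
  have sub: "cball w \<rho> \<subseteq> ball w r" using \<rho> by auto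
  have znorm: "norm z \<le> 3 / 2" "norm z \<ge> 1 / 2" if "z \<in> cball w \<rho>" for z
    using that w \<rho> norm_triangle_ineq2[of z w] norm_triangle_ineq2[of w z]
    by (auto simp: dist_norm norm_minus_commute)
  have "compact (g ` cball w \<rho>)"
    using g sub by (intro compact_continuous_image holomorphic_on_imp_continuous_on)
      (auto intro: holomorphic_on_subset)
  hence "bounded (g ` cball w \<rho>)" by (rule compact_imp_bounded)
  then obtain G where G: "\<And>z. z \<in> cball w \<rho> \<Longrightarrow> norm (g z) \<le> G"
    unfolding bounded_iff by blast
  have G0: "0 \<le> G" using G[of w] \<rho> norm_ge_zero[of "g w"]
    by (metis centre_in_cball less_imp_le order_trans)

  \<comment> \<open>\<open>F N\<close> is the series shifted by \<open>N\<close>, and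
    \<open>S N\<close> the polynomial in \<open>1 / z\<close> split off by the shift;
    \<open>\<Phi> N\<close> glues the shift to its continuation.\<close>
  define F where "F = (\<lambda>N z. \<Sum>n. a (n + N) * z ^ n)"
  define S where "S = (\<lambda>N z. \<Sum>k\<in>{1..N}. a (N - k) * inverse z ^ k)"
  define \<Phi> where "\<Phi> = (\<lambda>N z. if norm z < 1 then F N z else inverse z ^ N * g z - S N z)"
  have summ: "summable (\<lambda>n. a (n + N) * z ^ n)" if "norm z < 1" for N z
    by (rule summable_comparison_test'[where g = "\<lambda>n. C * norm z ^ n"])
      (use C that in \<open>auto simp: norm_mult norm_power intro!: mult_right_mono summable_mult summable_geometric\<close>)
  have \<Phi>_ball: "\<Phi> N z = inverse z ^ N * g z - S N z" if z: "z \<in> cball w \<rho>" for N z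
  proof (cases "norm z < 1")
    case True
    have z0: "z \<noteq> 0" using znorm[OF z] by auto
    have sums: "(\<lambda>n. a n * z ^ n) sums g z" using eq True z sub by blast
    have "g z = (\<Sum>n. a (n + N) * z ^ (n + N)) + (\<Sum>n<N. a n * z ^ n)"
      using suminf_split_initial_segment[OF sums_summable[OF sums], of N] sums_unique[OF sums] by simp
    also have "(\<Sum>n. a (n + N) * z ^ (n + N)) = F N z * z ^ N"
      unfolding F_def using suminf_mult2[OF summ[OF True, of N], of "z ^ N"] by (simp add: power_add mult_ac)
    finally have "inverse z ^ N * g z = (inverse z * z) ^ N * F N z + inverse z ^ N * (\<Sum>n<N. a n * z ^ n)"
      by (simp add: algebra_simps power_mult_distrib)
    moreover have "inverse z ^ N * (\<Sum>n<N. a n * z ^ n) = S N z"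
    proof -
      have "inverse z ^ N * (\<Sum>n<N. a n * z ^ n) = (\<Sum>n<N. a n * inverse z ^ (N - n))"
        unfolding sum_distrib_left
      proof (intro sum.cong refl)
        fix n assume "n \<in> {..<N}"
        hence "N = (N - n) + n" by simp
        hence "inverse z ^ N = inverse z ^ (N - n) * inverse z ^ n" by (metis power_add)
        thus "inverse z ^ N * (a n * z ^ n) = a n * inverse z ^ (N - n)"
          using z0 by (simp add: power_mult_distrib[symmetric] field_simps)
      qed
      also have "\<dots> = S N z" unfolding S_def
        by (rule sum.reindex_bij_witness[of _ "\<lambda>k. N - k" "\<lambda>n. N - n"]) auto
      finally show ?thesis .
    qed
    ultimately show ?thesis using z0 True by (simp add: \<Phi>_def)
  qed (simp add: \<Phi>_def)
  define \<Omega> where "\<Omega> = ball 0 1 \<union> ball w \<rho>"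
  have open_\<Omega>: "open \<Omega>" unfolding \<Omega>_def by (intro open_Un open_ball)
  have \<Phi>_hol: "\<Phi> N holomorphic_on \<Omega>" for N
    unfolding \<Omega>_def
  proof (rule holomorphic_on_Un)
    let ?f = "Abs_fps (\<lambda>n. a (n + N))"
    have "1 \<le> fps_conv_radius ?f"
      unfolding fps_conv_radius_def
      by (rule conv_radius_geI_ex') (use summ in \<open>auto simp: dist_norm\<close>)
    hence "eval_fps ?f holomorphic_on ball 0 1"
      by (rule holomorphic_on_eval_fps_unit_ball)
    thus "\<Phi> N holomorphic_on ball 0 1"
      by (rule holomorphic_transform) (simp add: \<Phi>_def F_def eval_fps_def)
    have "0 \<notin> ball w \<rho>" using znorm[of 0] by auto
    hence "(\<lambda>z. inverse z ^ N * g z - S N z) holomorphic_on ball w \<rho>"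
      unfolding S_def using \<rho>
      by (intro holomorphic_intros holomorphic_on_subset[OF g]) auto
    thus "\<Phi> N holomorphic_on ball w \<rho>"
      by (rule holomorphic_transform) (simp add: \<Phi>_ball)
  qed auto
  have S_bound: "norm (S N z) \<le> 2 * C / (norm z - 1)" if "1 < norm z" "norm z \<le> 3 / 2" for N z
  proof -
    have "norm (S N z) \<le> C * norm (inverse z) ^ 0 / (1 - norm (inverse z))"
      unfolding S_def using that C by (intro norm_sum_geometric_le) (auto simp: norm_inverse inverse_less_1_iff)
    also have "\<dots> = C * norm z / (norm z - 1)"
    proof -
      have *: "C * inverse t ^ 0 / (1 - inverse t) = C * t / (t - 1)" if "1 < t" for t :: real
        using that by (simp add: field_simps)
      show ?thesis unfolding norm_inverse using that(1) by (rule *)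
    qed
    also have "\<dots> \<le> 2 * C / (norm z - 1)"
      using that C0 by (intro divide_right_mono) (auto simp: mult.commute[of 2] intro!: mult_left_mono)
    finally show ?thesis .
  qed
  have F_bound: "norm (F N z) \<le> C / (1 - norm z)" if "norm z < 1" for N z
  proof -
    have "norm (F N z) \<le> (\<Sum>n. C * norm z ^ n)"
      unfolding F_def by (rule norm_suminf_le)
        (use C that in \<open>auto simp: norm_mult norm_power intro!: mult_right_mono summable_mult summable_geometric\<close>)
    also have "\<dots> = C / (1 - norm z)"
      using that by (simp add: suminf_mult suminf_geometric summable_geometric)
    finally show ?thesis .
  qed
  define q where "q = (\<lambda>z. (z - w)\<^sup>2 + (of_real \<rho>)\<^sup>2 * w * z)"
  have q_hol: "q holomorphic_on A" for A unfolding q_def by (intro holomorphic_intros)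
  define K where "K = 2 * C + G"
  have K0: "0 \<le> K" using C0 G0 by (simp add: K_def)
  have circle: "norm (q z * \<Phi> N z) \<le> 3 * K" if z: "norm (z - w) = \<rho>" for N z
  proof (cases "norm z = 1")
    case True
    hence "q z = 0" using riesz_quadratic[OF w z] by (simp add: q_def)
    thus ?thesis using K0 by simp
  next
    case False
    have z': "z \<in> cball w \<rho>" using z by (simp add: dist_norm norm_minus_commute)
    note zn = znorm[OF z']
    have pos: "0 < \<bar>norm z - 1\<bar>" using False by simp
    have small: "\<bar>norm z - 1\<bar> \<le> 1" using zn by linarith
    \<comment> \<open>Inside the unit disc a geometric sum bounds the shift; outside,
      \<open>g\<close> is bounded by compactness and \<open>S N\<close> by a geometric sum in
      \<open>1 / z\<close>.\<close>
    have \<Phi>: "norm (\<Phi> N z) \<le> K / \<bar>norm z - 1\<bar>"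
    proof (cases "norm z < 1")
      case True
      have "norm (\<Phi> N z) \<le> C / (1 - norm z)" using F_bound[OF True] True by (simp add: \<Phi>_def)
      also have "\<dots> \<le> K / (1 - norm z)" using True C0 G0 by (intro divide_right_mono) (auto simp: K_def)
      finally show ?thesis using True by simp
    next
      case ge: False
      hence z1: "1 < norm z" using False by simp
      have "norm (\<Phi> N z) \<le> norm (inverse z ^ N * g z) + norm (S N z)"
        unfolding \<Phi>_ball[OF z'] by (rule norm_triangle_ineq4)
      also have "norm (inverse z ^ N * g z) \<le> 1 * G"
        unfolding norm_mult norm_power norm_inverse using z1 G[OF z'] G0
        by (intro mult_mono power_le_one) (auto simp: inverse_le_1_iff)
      also have "1 * G \<le> G / (norm z - 1)"
        using z1 small G0 by (simp add: le_divide_eq mult_left_le)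
      finally have "norm (\<Phi> N z) \<le> G / (norm z - 1) + 2 * C / (norm z - 1)"
        using S_bound[OF z1 zn(1), of N] by linarith
      thus ?thesis using z1 by (simp add: K_def add_divide_distrib add.commute)
    qed
    have "norm (q z) = \<rho> * (\<bar>norm z - 1\<bar> * (norm z + 1))"
    proof -
      have "(norm z)\<^sup>2 - 1 = (norm z - 1) * (norm z + 1)" by (simp add: power2_eq_square algebra_simps)
      hence "\<bar>(norm z)\<^sup>2 - 1\<bar> = \<bar>norm z - 1\<bar> * (norm z + 1)" by (simp add: abs_mult)
      thus ?thesis using riesz_quadratic[OF w z] by (simp add: q_def)
    qed
    also have "\<dots> \<le> 1 * (\<bar>norm z - 1\<bar> * 3)"
      using \<rho> zn by (intro mult_mono) auto
    finally have "norm (q z) * norm (\<Phi> N z) \<le> (\<bar>norm z - 1\<bar> * 3) * (K / \<bar>norm z - 1\<bar>)"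
      using \<Phi> by (intro mult_mono) auto
    thus ?thesis using pos by (simp add: norm_mult)
  qed
  have \<Phi>_q_bound: "norm (q z * \<Phi> N z) \<le> 3 * K" if z: "z \<in> ball w \<rho>" for N z
  proof (rule maximum_modulus_frontier[of "\<lambda>z. q z * \<Phi> N z" "ball w \<rho>"])
    show "(\<lambda>z. q z * \<Phi> N z) holomorphic_on interior (ball w \<rho>)"
      using \<Phi>_hol[of N] by (intro holomorphic_intros q_hol) (auto intro: holomorphic_on_subset simp: \<Omega>_def)
    have "0 \<notin> cball w \<rho>" using znorm[of 0] by auto
    hence "continuous_on (cball w \<rho>) (\<lambda>z. inverse z ^ N * g z - S N z)"
      unfolding S_def using sub
      by (intro holomorphic_on_imp_continuous_on holomorphic_intros holomorphic_on_subset[OF g]) auto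
    hence "continuous_on (cball w \<rho>) (\<Phi> N)"
      by (rule continuous_on_eq) (simp add: \<Phi>_ball)
    thus "continuous_on (closure (ball w \<rho>)) (\<lambda>z. q z * \<Phi> N z)"
      using \<rho> by (auto intro!: continuous_intros holomorphic_on_imp_continuous_on[OF q_hol])
    show "norm (q z * \<Phi> N z) \<le> 3 * K" if "z \<in> frontier (ball w \<rho>)" for z
      using that \<rho> by (intro circle) (auto simp: dist_norm norm_minus_commute)
  qed (use z in auto)

  have "\<forall>j. \<exists>M N. j \<le> M \<and> j \<le> N \<and> (\<forall>i. 1 \<le> i \<and> i \<le> j \<longrightarrow> a (M - i) = a (N - i)) \<and> a M \<noteq> a N"
    using divergent_continuations_ex[OF fin np] by blast
  then obtain M N where MN: "\<And>j. j \<le> M j" "\<And>j. j \<le> N j" "\<And>j. a (M j) \<noteq> a (N j)"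
     "\<And>j i. 1 \<le> i \<Longrightarrow> i \<le> j \<Longrightarrow> a (M j - i) = a (N j - i)"
    by metis
  \<comment> \<open>Agreement of the \<open>j\<close> preceding coefficients makes
    \<open>H j\<close> small outside the unit disc, while the differing coefficients keep it away
    from 0 at the origin.\<close>
  define H where "H = (\<lambda>j z. q z * \<Phi> (M j) z - q z * \<Phi> (N j) z)"
  have H_hol: "H j holomorphic_on \<Omega>" for j
    unfolding H_def by (intro holomorphic_intros q_hol \<Phi>_hol)
  obtain h k where h: "h holomorphic_on \<Omega>" "strict_mono (k :: nat \<Rightarrow> nat)"
      "\<And>z. z \<in> \<Omega> \<Longrightarrow> (\<lambda>n. H (k n) z) \<longlonglongrightarrow> h z"
  proof (rule Montel[of \<Omega> "range H" H])
    show "\<exists>B. \<forall>h\<in>range H. \<forall>z\<in>X. norm (h z) \<le> B" if X: "compact X" "X \<subseteq> \<Omega>" for X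
    proof -
      \<comment> \<open>Near \<open>w\<close> the maximum modulus bound applies; the rest of
        \<open>X\<close> is a compact subset of the unit disc, where the geometric bound is
        uniform.\<close>
      define Y where "Y = X - ball w \<rho>"
      have Y: "compact Y" "Y \<subseteq> ball 0 1" using X by (auto simp: Y_def \<Omega>_def compact_diff)
      obtain R where R: "R < 1" "\<And>z. z \<in> Y \<Longrightarrow> norm z \<le> R"
      proof (cases "Y = {}")
        case False
        then obtain y where "y \<in> Y" "\<And>z. z \<in> Y \<Longrightarrow> norm z \<le> norm y"
          using continuous_attains_sup[OF Y(1) False, of norm] continuous_on_norm_id by blast
        thus ?thesis using that[of "norm y"] Y by auto
      qed (auto intro: that[of 0])
      have "bounded (q ` Y)"
        using Y by (intro compact_imp_bounded compact_continuous_image holomorphic_on_imp_continuous_on q_hol)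
      then obtain Q where Q: "\<And>z. z \<in> Y \<Longrightarrow> norm (q z) \<le> Q" by (auto simp: bounded_iff)
      have \<Phi>Y: "norm (q z * \<Phi> n z) \<le> \<bar>Q\<bar> * (C / (1 - R))" if "z \<in> Y" for z n
      proof -
        have z1: "norm z < 1" using R that by fastforce
        have "norm (\<Phi> n z) \<le> C / (1 - norm z)" using F_bound[OF z1] z1 by (simp add: \<Phi>_def)
        also have "\<dots> \<le> C / (1 - R)" using R(1) R(2)[OF that] C0 z1
          by (intro divide_left_mono mult_pos_pos) auto
        finally show ?thesis unfolding norm_mult using Q[OF that] by (intro mult_mono) auto
      qed
      define B where "B = max (3 * K) (\<bar>Q\<bar> * (C / (1 - R)))"
      have "norm (q z * \<Phi> n z) \<le> B" if "z \<in> X" for z n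
        using \<Phi>_q_bound[of z n] \<Phi>Y[of z n] that by (cases "z \<in> ball w \<rho>") (auto simp: B_def Y_def)
      hence "norm (H j z) \<le> B + B" if "z \<in> X" for z j
        unfolding H_def using that norm_triangle_ineq4 by (meson add_mono order_trans)
      thus ?thesis by auto
    qed
  qed (use open_\<Omega> H_hol in auto)

  define V where "V = ball w \<rho> - cball 0 1"
  have h_V: "h z = 0" if z: "z \<in> V" for z
  proof (rule LIMSEQ_unique[OF h(3)])
    show "z \<in> \<Omega>" using z by (auto simp: V_def \<Omega>_def)
    have z': "z \<in> cball w \<rho>" "1 < norm z" using z by (auto simp: V_def)
    define x where "x = norm (inverse z)"
    have x: "0 \<le> x" "x < 1" using z' by (auto simp: x_def norm_inverse inverse_less_1_iff)
    have bd: "norm (H j z) \<le> norm (q z) * (2 * G + 2 * (C / (1 - x))) * x ^ j" for j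
    proof -
      \<comment> \<open>The first \<open>j\<close> terms of the two sums \<open>S\<close> cancel.
        The tails \<open>A\<close> and, as \<open>M j\<close> and \<open>N j\<close> are at least
        \<open>j\<close>, the terms with \<open>g\<close> all carry the factor
        \<open>x ^ j\<close>.\<close>
      define A where "A = (\<lambda>n. \<Sum>i\<in>{j+1..n}. a (n - i) * inverse z ^ i)"
      have A: "norm (A n) \<le> C * x ^ j / (1 - x)" for n
        unfolding A_def x_def using C x by (intro norm_sum_geometric_le) (auto simp: x_def)
      have S: "S n z = (\<Sum>i\<in>{1..j}. a (n - i) * inverse z ^ i) + A n" if "j \<le> n" for n
        unfolding S_def A_def using that by (subst sum.union_disjoint[symmetric]) (auto intro!: sum.cong)
      have "(\<Sum>i\<in>{1..j}. a (M j - i) * inverse z ^ i) = (\<Sum>i\<in>{1..j}. a (N j - i) * inverse z ^ i)"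
        using MN(4) by (intro sum.cong) auto
      hence "\<Phi> (M j) z - \<Phi> (N j) z =
          (inverse z ^ M j * g z - inverse z ^ N j * g z) - (A (M j) - A (N j))"
        unfolding \<Phi>_ball[OF z'(1)] S[OF MN(1)] S[OF MN(2)] by simp
      also have "norm \<dots> \<le> (norm (inverse z ^ M j * g z) + norm (inverse z ^ N j * g z)) + (norm (A (M j)) + norm (A (N j)))"
        by (intro order_trans[OF norm_triangle_ineq4] add_mono norm_triangle_ineq4)
      also have "\<dots> \<le> (x ^ j * G + x ^ j * G) + (C * x ^ j / (1 - x) + C * x ^ j / (1 - x))"
        unfolding norm_mult norm_power x_def[symmetric]
        using x MN(1,2) G[OF z'(1)] by (intro add_mono A mult_mono power_decreasing) auto
      also have "\<dots> = (2 * G + 2 * (C / (1 - x))) * x ^ j" by (simp add: distrib_right)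
      finally have "norm (q z) * norm (\<Phi> (M j) z - \<Phi> (N j) z) \<le>
          norm (q z) * ((2 * G + 2 * (C / (1 - x))) * x ^ j)"
        by (intro mult_left_mono) auto
      thus ?thesis unfolding H_def right_diff_distrib[symmetric] norm_mult by (simp only: mult.assoc)
    qed
    have "(\<lambda>j. norm (q z) * (2 * G + 2 * (C / (1 - x))) * x ^ j) \<longlonglongrightarrow> norm (q z) * (2 * G + 2 * (C / (1 - x))) * 0"
      using x by (intro tendsto_intros LIMSEQ_realpow_zero) auto
    hence lim: "(\<lambda>j. norm (q z) * (2 * G + 2 * (C / (1 - x))) * x ^ j) \<longlonglongrightarrow> 0"
      by (simp only: mult_zero_right)
    have "(\<lambda>j. H j z) \<longlonglongrightarrow> 0"
      by (rule Lim_null_comparison[OF always_eventually[OF allI[OF bd]] lim])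
    from LIMSEQ_subseq_LIMSEQ[OF this h(2)] show "(\<lambda>n. H (k n) z) \<longlonglongrightarrow> 0"
      by (simp only: o_def)
  qed
  have scaled: "norm ((1 + of_real t) * w) = \<bar>1 + t\<bar>" "dist w ((1 + of_real t) * w) = \<bar>t\<bar>" for t
  proof -
    show "norm ((1 + of_real t) * w) = \<bar>1 + t\<bar>"
      using w by (simp only: norm_mult) (metis mult.right_neutral norm_of_real of_real_1 of_real_add)
    have "w - (1 + of_real t) * w = - of_real t * w" by (simp add: algebra_simps)
    thus "dist w ((1 + of_real t) * w) = \<bar>t\<bar>" using w by (simp add: dist_norm norm_mult)
  qed
  \<comment> \<open>The identity theorem on the connected \<Omega> carries the zero limit from
    \<open>V\<close> to the origin.\<close>
  have h0: "h 0 = 0"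
  proof (rule analytic_continuation_open[of V \<Omega> h "\<lambda>_. 0"])
    show "open V" by (auto simp: V_def)
    have "(1 + of_real (\<rho> / 2)) * w \<in> V" using scaled[of "\<rho> / 2"] \<rho> by (auto simp: V_def)
    thus "V \<noteq> {}" by blast
    have "(1 + of_real (- (\<rho> / 2))) * w \<in> ball 0 1 \<inter> ball w \<rho>"
      using scaled[of "- (\<rho> / 2)"] \<rho> by auto
    thus "connected \<Omega>" unfolding \<Omega>_def by (intro connected_Un) auto
  qed (use open_\<Omega> h h_V in \<open>auto simp: V_def \<Omega>_def\<close>)
  have H0: "H j 0 = w\<^sup>2 * (a (M j) - a (N j))" for j
  proof -
    have "F n 0 = a n" for n
      unfolding F_def using suminf_finite[of "{0}" "\<lambda>i. a (i + n) * 0 ^ i"] by auto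
    thus ?thesis by (simp add: H_def \<Phi>_def q_def algebra_simps)
  qed
  \<comment> \<open>The values at 0 lie in this finite set, which omits 0, yet they converge to
    0.\<close>
  define E where "E = (\<lambda>(x, y). w\<^sup>2 * (x - y)) ` {(x, y). x \<in> range a \<and> y \<in> range a \<and> x \<noteq> y}"
  have "finite {(x, y). x \<in> range a \<and> y \<in> range a \<and> x \<noteq> y}"
    by (rule finite_subset[of _ "range a \<times> range a"]) (use fin in auto)
  hence "closed E" unfolding E_def by (intro finite_imp_closed finite_imageI)
  moreover have "H (k n) 0 \<in> E" for n unfolding E_def H0 using MN(3) by force
  moreover have "(\<lambda>n. H (k n) 0) \<longlonglongrightarrow> 0" using h(3)[of 0] h0 by (simp add: \<Omega>_def)
  ultimately have "0 \<in> E" by (rule closed_sequentially)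
  thus False using w by (auto simp: E_def)
qed

section \<open>From holomorphic to meromorphic continuation\<close>

lemma fps_conv_radius_ge_1:
  fixes F :: "complex fps"
  assumes "finite (range (fps_nth F))"
  shows "1 \<le> fps_conv_radius F"
proof -
  obtain C where C: "\<And>n. norm (fps_nth F n) \<le> C"
    using finite_imp_bounded[OF assms] by (auto simp: bounded_iff)
  have "summable (\<lambda>n. fps_nth F n * z ^ n)" if "norm z < 1" for z
    by (rule summable_comparison_test'[where g = "\<lambda>n. C * norm z ^ n"])
      (use C that in \<open>auto simp: norm_mult norm_power intro!: mult_right_mono summable_mult summable_geometric\<close>)
  thus ?thesis
    unfolding fps_conv_radius_def
    by (intro conv_radius_geI_ex') (auto simp: dist_norm)
qed

text \<open>The singularities of a meromorphic continuation do not accumulate at \<open>w\<close>,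
  so a nearby point of the circle has a disc on which the continuation is holomorphic, and the
  holomorphic case applies there.\<close>

theorem szego_natural_boundary:
  fixes F :: "complex fps"
  assumes fin: "finite (range (fps_nth F))"
    and np: "\<not> (\<exists>N p. 0 < p \<and> (\<forall>i>N. fps_nth F (i + p) = fps_nth F i))"
  shows "unit_circle_natural_boundary (eval_fps F)"
  unfolding unit_circle_natural_boundary_def
proof (intro conjI allI impI notI)
  have rad: "1 \<le> fps_conv_radius F" by (rule fps_conv_radius_ge_1[OF fin])
  have an: "eval_fps F analytic_on ball 0 1"
    using holomorphic_on_eval_fps_unit_ball[OF rad] by (simp add: analytic_on_open)
  thus "eval_fps F meromorphic_on ball 0 1" by (rule analytic_on_imp_meromorphic_on)
  fix w :: complex and r :: real
  assume wr: "norm w = 1 \<and> 0 < r"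
  assume "\<exists>g. g meromorphic_on ball w r \<and>
              (\<forall>\<^sub>F z in cosparse (ball w r \<inter> ball 0 1). g z = eval_fps F z)"
  then obtain g where g: "g meromorphic_on ball w r"
    and eq: "\<And>z. z \<in> ball w r \<inter> ball 0 1 \<Longrightarrow> \<forall>\<^sub>F z in at z. g z = eval_fps F z"
    by (auto simp: eventually_cosparse_open_eq open_Int)
  have "\<not> w islimpt {z. \<not> g analytic_on {z}}"
    using wr by (intro meromorphic_on_imp_not_islimpt_singularities[OF g]) auto
  then obtain e where e: "0 < e" "\<And>z. dist z w < e \<Longrightarrow> z \<noteq> w \<Longrightarrow> g analytic_on {z}"
    unfolding islimpt_approachable by blast
  define e' where "e' = min e r"
  have e': "0 < e'" using e wr by (simp add: e'_def)
  have "((\<lambda>t. w * cis t) \<longlongrightarrow> w * cis 0) (at_right 0)"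
    by (intro tendsto_intros)
  hence "\<forall>\<^sub>F t in at_right 0. dist (w * cis t) w < e'"
    using e' by (auto dest!: tendstoD)
  moreover have "\<forall>\<^sub>F t in at_right (0::real). t \<in> {0<..<pi}"
    by (rule eventually_at_right_real) simp
  ultimately have "\<forall>\<^sub>F t in at_right (0::real). dist (w * cis t) w < e' \<and> t \<in> {0<..<pi}"
    by eventually_elim simp
  then obtain t where t: "dist (w * cis t) w < e'" "0 < t" "t < pi"
    using eventually_happens'[OF trivial_limit_at_right_real] by fastforce
  define w' where "w' = w * cis t"
  have w': "norm w' = 1" using wr by (simp add: w'_def norm_mult)
  have ne: "w' \<noteq> w"
  proof
    assume "w' = w"
    hence "cis t = 1" using wr by (auto simp: w'_def)
    hence "sin t = 0" by (metis cis.sel(2) one_complex.sel(2))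
    thus False using sin_gt_zero[OF t(2,3)] by simp
  qed
  \<comment> \<open>The disc omits \<open>w\<close>, the only possible singularity within distance
    \<open>e'\<close>, and stays within that distance.\<close>
  define r' where "r' = min (dist w' w) (e' - dist w' w)"
  have r': "0 < r'" using ne t by (simp add: r'_def w'_def)
  have sub: "z \<noteq> w" "dist z w < e'" if "z \<in> ball w' r'" for z
  proof -
    have "dist w' z < dist w' w" using that by (simp add: r'_def)
    thus "z \<noteq> w" by auto
    have "dist z w \<le> dist w' z + dist w' w" by (metis dist_commute dist_triangle)
    also have "\<dots> < e'" using that by (simp add: r'_def)
    finally show "dist z w < e'" .
  qed
  have an_g: "g analytic_on {z}" if "z \<in> ball w' r'" for z
    using sub[OF that] by (intro e(2)) (auto simp: e'_def)
  have "g analytic_on ball w' r'" using an_g analytic_on_analytic_at by blast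
  hence hol: "g holomorphic_on ball w' r'" by (rule analytic_imp_holomorphic)
  have "(\<lambda>n. fps_nth F n * z ^ n) sums g z" if z: "z \<in> ball w' r'" "norm z < 1" for z
  proof -
    have g_lim: "g \<midarrow>z\<rightarrow> g z"
      using an_g[OF z(1)] analytic_at_imp_isCont isContD by blast
    have F_lim: "eval_fps F \<midarrow>z\<rightarrow> eval_fps F z"
      using an z(2) by (intro isContD analytic_at_imp_isCont) (auto intro: analytic_on_subset)
    have "\<forall>\<^sub>F z in at z. g z = eval_fps F z"
      using sub[OF z(1)] z(2) by (intro eq) (auto simp: e'_def dist_commute)
    from Lim_transform_eventually[OF g_lim this] F_lim have "g z = eval_fps F z"
      by (rule LIM_unique)
    thus ?thesis using sums_eval_fps[OF norm_less_conv_radius[OF rad z(2)]] by simp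
  qed
  from szego_holomorphic[OF fin np w' r' hol this] show False .
qed

lemma unit_circle_natural_boundary_cong:
  assumes "\<And>z. norm z < 1 \<Longrightarrow> F z = G z" "unit_circle_natural_boundary F"
  shows "unit_circle_natural_boundary G"
proof -
  have ev: "\<forall>\<^sub>F z in at z. F z = G z" if "z \<in> ball 0 1" for z
    using eventually_at_in_open'[OF open_ball that] by eventually_elim (use assms(1) in auto)
  have "F meromorphic_on ball 0 1 \<longleftrightarrow> G meromorphic_on ball 0 1"
    by (intro meromorphic_on_cong ev refl)
  moreover have "(\<forall>\<^sub>F z in cosparse (ball w r \<inter> ball 0 1). g z = F z) \<longleftrightarrow>
      (\<forall>\<^sub>F z in cosparse (ball w r \<inter> ball 0 1). g z = G z)" for g w r
  proof -
    have "(\<forall>\<^sub>F x in at z. g x = F x) \<longleftrightarrow> (\<forall>\<^sub>F x in at z. g x = G x)" if "z \<in> ball w r \<inter> ball 0 1" for z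
      by (rule eventually_subst) (use ev[of z] that in \<open>auto elim: eventually_mono\<close>)
    thus ?thesis by (simp add: eventually_cosparse_open_eq open_Int)
  qed
  ultimately show ?thesis using assms(2) unfolding unit_circle_natural_boundary_def by simp
qed

lemma poly_analytic_on: "poly (P :: complex poly) analytic_on A"
proof -
  have "poly P holomorphic_on UNIV"
    unfolding holomorphic_on_def field_differentiable_def using poly_DERIV by blast
  hence "poly P analytic_on UNIV" by (simp add: analytic_on_open)
  thus ?thesis by (rule analytic_on_subset) simp
qed

lemma eventually_poly_nonzero:
  fixes P :: "complex poly"
  assumes "P \<noteq> 0"
  shows "\<forall>\<^sub>F x in at z. poly P x \<noteq> 0"
proof -
  have "\<not> z islimpt {x. poly P x = 0}" using poly_roots_finite[OF assms] by (simp add: islimpt_finite)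
  thus ?thesis by (simp add: islimpt_conv_frequently_at frequently_def)
qed

text \<open>A continuation \<open>g\<close> of \<open>G\<close> would give the continuation
  \<open>P / g\<close> of \<open>F\<close>; the division is legitimate off the finitely many zeros
  of \<open>P\<close>.\<close>

lemma unit_circle_natural_boundary_quotient:
  fixes P :: "complex poly"
  assumes P: "P \<noteq> 0" and F: "unit_circle_natural_boundary F"
    and G: "G meromorphic_on ball 0 1"
    and eq: "\<And>z. z \<in> ball 0 1 \<Longrightarrow> \<forall>\<^sub>F x in at z. F x \<noteq> 0 \<and> G x = poly P x / F x"
  shows "unit_circle_natural_boundary G"
  unfolding unit_circle_natural_boundary_def
proof (intro conjI allI impI notI G)
  fix w :: complex and r :: real
  assume wr: "norm w = 1 \<and> 0 < r"
  assume "\<exists>g. g meromorphic_on ball w r \<and> (\<forall>\<^sub>F z in cosparse (ball w r \<inter> ball 0 1). g z = G z)"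
  then obtain g where g: "g meromorphic_on ball w r"
    and gG: "\<And>z. z \<in> ball w r \<inter> ball 0 1 \<Longrightarrow> \<forall>\<^sub>F z in at z. g z = G z"
    by (auto simp: eventually_cosparse_open_eq open_Int)
  have "(\<lambda>z. poly P z / g z) meromorphic_on ball w r"
    by (intro meromorphic_intros g analytic_on_imp_meromorphic_on poly_analytic_on)
  moreover have "\<forall>\<^sub>F z in cosparse (ball w r \<inter> ball 0 1). poly P z / g z = F z"
    unfolding eventually_cosparse_open_eq[OF open_Int[OF open_ball open_ball]]
  proof
    fix z assume z: "z \<in> ball w r \<inter> ball 0 1"
    show "\<forall>\<^sub>F x in at z. poly P x / g x = F x"
      using gG[OF z] eq[of z, OF IntD2[OF z]] eventually_poly_nonzero[OF P, of z]
      by eventually_elim auto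
  qed
  ultimately show False using F wr unfolding unit_circle_natural_boundary_def by blast
qed

section \<open>The quotient of a polynomial by a power series\<close>

text \<open>Serves both cases of the theorem: for a Parry number \<open>D\<close> is the plane and
  \<open>F\<close> is rational, otherwise \<open>D\<close> is the unit disc and \<open>F\<close> the
  sum of the series.\<close>

locale poly_quotient =
  fixes P :: "complex poly" and f U :: "complex fps" and F :: "complex \<Rightarrow> complex" and D :: "complex set"
  assumes D: "open D" "connected D" "ball 0 1 \<subseteq> D"
    and F: "F meromorphic_on D" and F_eq: "\<And>z. norm z < 1 \<Longrightarrow> F z = eval_fps f z"
    and rad: "1 \<le> fps_conv_radius f" and f0: "fps_nth f 0 \<noteq> 0"
    and Uf: "U * f = fps_of_poly P"
begin

text \<open>\<open>remove_sings\<close> fills removable singularities by limits and gives poles the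
  value 0, as nice meromorphy demands.\<close>

definition "Uz = remove_sings (\<lambda>z. poly P z / F z)"
definition "fz = remove_sings F"

lemma F_analytic: "F analytic_on ball 0 1"
proof -
  have "F holomorphic_on ball 0 1"
    by (rule holomorphic_transform[OF holomorphic_on_eval_fps_unit_ball[OF rad]]) (simp add: F_eq)
  thus ?thesis by (simp add: analytic_on_open)
qed

lemma F_analytic_at: "norm z < 1 \<Longrightarrow> F analytic_on {z}"
  by (rule analytic_on_subset[OF F_analytic]) auto

lemma fz_eq: "norm z < 1 \<Longrightarrow> fz z = eval_fps f z"
  using F_analytic_at[of z] F_eq[of z] by (simp add: fz_def)

lemma eval_fps_expansion: "eval_fps f has_fps_expansion f"
  using rad by (intro eval_fps_has_fps_expansion) (auto intro: less_le_trans[of 0 1])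

lemma eventually_norm_less_1: "\<forall>\<^sub>F z in nhds 0. norm (z :: complex) < 1"
  using eventually_nhds_in_open[of "ball 0 1" "0 :: complex"] by simp

lemma fz_expansion: "fz has_fps_expansion f"
proof -
  have "\<forall>\<^sub>F z in nhds 0. fz z = eval_fps f z"
    using eventually_norm_less_1 by eventually_elim (rule fz_eq)
  thus ?thesis using has_fps_expansion_cong[OF _ refl, of fz "eval_fps f" f] eval_fps_expansion by simp
qed

lemma quotient_meromorphic: "(\<lambda>z. poly P z / F z) meromorphic_on D"
  by (intro meromorphic_intros F analytic_on_imp_meromorphic_on poly_analytic_on)

lemma fz_nicely: "fz nicely_meromorphic_on D"
  unfolding fz_def by (rule remove_sings_nicely_meromorphic[OF F])

lemma Uz_nicely: "Uz nicely_meromorphic_on D"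
  unfolding Uz_def by (rule remove_sings_nicely_meromorphic[OF quotient_meromorphic])

lemma Uz_eq: "norm z < 1 \<Longrightarrow> eval_fps f z \<noteq> 0 \<Longrightarrow>
    Uz analytic_on {z} \<and> Uz z = poly P z / eval_fps f z"
proof -
  assume z: "norm z < 1" "eval_fps f z \<noteq> 0"
  have "(\<lambda>z. poly P z / F z) analytic_on {z}"
    using F_analytic_at[OF z(1)] z F_eq[OF z(1)]
    by (intro analytic_intros poly_analytic_on) auto
  thus ?thesis using F_eq[OF z(1)] by (simp add: Uz_def remove_sings_analytic_on)
qed

lemma Uz_expansion: "Uz has_fps_expansion U"
proof -
  have "U = fps_of_poly P * inverse f"
    using f0 by (simp add: Uf[symmetric] mult.assoc inverse_mult_eq_1')
  moreover have "poly P has_fps_expansion fps_of_poly P"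
    using eval_fps_has_fps_expansion[of "fps_of_poly P"] by (simp add: eval_fps_of_poly[abs_def])
  ultimately have exp: "(\<lambda>z. poly P z * inverse (eval_fps f z)) has_fps_expansion U"
    using eval_fps_expansion f0 by (auto intro!: fps_expansion_intros)
  have "isCont (eval_fps f) 0"
    using has_fps_expansion_imp_continuous[OF eval_fps_expansion] by simp
  hence "(eval_fps f \<longlongrightarrow> eval_fps f 0) (nhds 0)"
    by (simp only: isCont_def tendsto_at_iff_tendsto_nhds)
  hence "\<forall>\<^sub>F z in nhds 0. eval_fps f z \<noteq> 0"
    by (rule tendsto_imp_eventually_ne) (use f0 in \<open>simp add: eval_fps_at_0\<close>)
  hence "\<forall>\<^sub>F z in nhds 0. Uz z = poly P z * inverse (eval_fps f z)"
    using eventually_norm_less_1 by eventually_elim (use Uz_eq in \<open>auto simp: divide_inverse\<close>)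
  thus ?thesis using 
      has_fps_expansion_cong[OF _ refl, of Uz "\<lambda>z. poly P z * inverse (eval_fps f z)" U] exp by blast
qed

text \<open>\<open>F\<close> tends to a nonzero value at 0, so on the connected \<open>D\<close> it
  cannot vanish identically, and its zeros are isolated.\<close>

lemma F_nonzero: "z \<in> D \<Longrightarrow> \<forall>\<^sub>F x in at z. F x \<noteq> 0"
proof -
  have "\<not> (\<forall>\<^sub>F x in at 0. F x = 0)"
  proof
    assume ev: "\<forall>\<^sub>F x in at 0. F x = 0"
    have "isCont F 0" using F_analytic_at[of 0] analytic_at_imp_isCont by simp
    hence "F \<midarrow>0\<rightarrow> fps_nth f 0" using F_eq[of 0] by (simp add: isCont_def eval_fps_at_0)
    moreover have "F \<midarrow>0\<rightarrow> 0" using ev by (simp add: tendsto_eventually)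
    ultimately show False using f0 LIM_unique by blast
  qed
  hence "\<not> (\<forall>\<^sub>F x in cosparse D. F x = 0)"
    using D(3) unfolding eventually_cosparse_open_eq[OF D(1)] by force
  hence "\<forall>\<^sub>F x in cosparse D. F x \<noteq> 0"
    using meromorphic_imp_constant_or_avoid[OF F D(1,2), of 0] by blast
  thus "z \<in> D \<Longrightarrow> \<forall>\<^sub>F x in at z. F x \<noteq> 0" using D by (auto simp: eventually_cosparse_open_eq)
qed

lemma eventually_Uz_fz:
  assumes "z \<in> D"
  shows "\<forall>\<^sub>F x in at z. F x \<noteq> 0 \<and> Uz x = poly P x / F x \<and> fz x = F x"
proof -
  have "\<forall>\<^sub>F x in at z. Uz x = poly P x / F x" "\<forall>\<^sub>F x in at z. fz x = F x"
    unfolding Uz_def fz_def using assms quotient_meromorphic F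
    by (auto intro!: eventually_remove_sings_eq_at simp: meromorphic_on_altdef)
  thus ?thesis using F_nonzero[OF assms] by eventually_elim auto
qed

text \<open>The identity holds on a punctured neighbourhood by construction; without poles both
  factors are continuous, so it passes to the limit.\<close>

lemma product:
  assumes z: "z \<in> D" "\<not> is_pole Uz z" "\<not> is_pole fz z"
  shows "poly P z = Uz z * fz z"
proof -
  have "Uz analytic_on {z}" "fz analytic_on {z}"
    using nicely_meromorphic_on_imp_analytic_at Uz_nicely fz_nicely z by blast+
  hence "Uz \<midarrow>z\<rightarrow> Uz z" "fz \<midarrow>z\<rightarrow> fz z"
    using analytic_at_imp_isCont isContD by blast+
  hence "(\<lambda>x. Uz x * fz x) \<midarrow>z\<rightarrow> Uz z * fz z" by (rule tendsto_mult)
  moreover have "\<forall>\<^sub>F x in at z. Uz x * fz x = poly P x"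
    using eventually_Uz_fz[OF z(1)] by eventually_elim auto
  ultimately have "poly P \<midarrow>z\<rightarrow> Uz z * fz z" by (rule Lim_transform_eventually)
  moreover have "poly P \<midarrow>z\<rightarrow> poly P z" using poly_isCont isContD by blast
  ultimately show ?thesis using LIM_unique by blast
qed

lemma Uz_holomorphic:
  assumes "R \<le> 1" "\<And>z. norm z < R \<Longrightarrow> eval_fps f z \<noteq> 0"
  shows "Uz holomorphic_on ball 0 R"
proof -
  have "Uz analytic_on {z}" if "z \<in> ball 0 R" for z
    using Uz_eq[of z] assms that by auto
  hence "Uz analytic_on ball 0 R" using analytic_on_analytic_at by blast
  thus ?thesis by (rule analytic_imp_holomorphic)
qed

end

section \<open>The Parry Upper function\<close>

lemma periodic_fps_rational:
  fixes f :: "complex fps"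
  assumes per: "\<And>i. i > N \<Longrightarrow> fps_nth f (i + p) = fps_nth f i"
  obtains R :: "complex poly" where "f * (1 - fps_X ^ p) = fps_of_poly R"
proof
  let ?g = "f * (1 - fps_X ^ p)"
  \<comment> \<open>Multiplication by \<open>1 - X^p\<close> takes differences at distance
    \<open>p\<close>; the earlier index \<open>i - p\<close> must itself exceed
    \<open>N\<close>.\<close>
  have zero: "fps_nth ?g i = 0" if "i > N + p" for i
  proof -
    have "fps_nth ?g i = fps_nth f i - fps_nth f (i - p)"
      using that by (simp add: right_diff_distrib fps_X_power_mult_right_nth)
    thus ?thesis using per[of "i - p"] that by simp
  qed
  show "?g = fps_of_poly (\<Sum>i\<le>N + p. Polynomial.monom (fps_nth ?g i) i)"
  proof (rule fps_ext)
    fix n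
    have "Polynomial.coeff (\<Sum>i\<le>N + p. Polynomial.monom (fps_nth ?g i) i) n =
        (\<Sum>i\<le>N + p. if i = n then fps_nth ?g i else 0)"
      by (simp add: coeff_sum)
    also have "\<dots> = fps_nth ?g n" using zero[of n] by (auto simp: not_le)
    finally show "fps_nth ?g n = fps_nth (fps_of_poly (\<Sum>i\<le>N + p. Polynomial.monom (fps_nth ?g i) i)) n"
      by simp
  qed
qed

lemma parry_upper_nonzero:
  assumes \<beta>: "1 < \<beta>" "\<beta> < 4 / 3" and rad: "1 \<le> fps_conv_radius (complex_fps (parry_upper \<beta>))"
    and z: "norm z < inverse \<beta>"
  shows "eval_fps (complex_fps (parry_upper \<beta>)) z \<noteq> 0"
proof
  let ?f = "complex_fps (parry_upper \<beta>)"
  assume zero: "eval_fps ?f z = 0"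
  define y where "y = inverse \<beta>"
  have y: "0 < y" "y < 1" using \<beta> by (auto simp: y_def inverse_less_1_iff)
  have z1: "norm z < 1" using z y by (simp add: y_def)
  have "(\<lambda>n. fps_nth ?f n * z ^ n) sums 0"
    using sums_eval_fps[OF norm_less_conv_radius[OF rad z1]] zero by simp
  hence "(\<lambda>n. \<Sum>i\<le>n. fps_nth ?f i * z ^ i) \<longlonglongrightarrow> 0" by (simp add: sums_def_le)
  moreover have split: "(\<Sum>i\<le>n. fps_nth ?f i * z ^ i) = -1 + (\<Sum>i=1..n. of_int (renyi_digit \<beta> i) * z ^ i)" for n
  proof -
    have "{..n} = insert 0 {1..n}" by auto
    thus ?thesis by (simp add: parry_upper_nth[OF \<beta>])
  qed
  ultimately have "(\<lambda>n. -1 + (\<Sum>i=1..n. of_int (renyi_digit \<beta> i) * z ^ i)) \<longlonglongrightarrow> 0" by simp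
  hence "(\<lambda>n. 1 + (-1 + (\<Sum>i=1..n. of_int (renyi_digit \<beta> i) * z ^ i))) \<longlonglongrightarrow> 1 + 0"
    by (intro tendsto_intros)
  hence lim: "(\<lambda>n. \<Sum>i=1..n. of_int (renyi_digit \<beta> i) * z ^ i) \<longlonglongrightarrow> 1" by simp
  have bound: "norm (\<Sum>i=1..n. of_int (renyi_digit \<beta> i) * z ^ i) \<le> norm z / y" for n
  proof -
    have "norm (\<Sum>i=1..n. of_int (renyi_digit \<beta> i) * z ^ i) \<le>
        (\<Sum>i=1..n. norm z / y * (of_int (renyi_digit \<beta> i) * y ^ i))"
    proof (rule sum_norm_le)
      fix i assume i: "i \<in> {1..n}"
      then obtain k where k: "i = Suc k" by (cases i) auto
      have d: "0 \<le> renyi_digit \<beta> i" using renyi_digit_cases[OF \<beta>, of i] i by auto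
      have "norm z ^ k \<le> y ^ k" using z by (intro power_mono) (auto simp: y_def)
      \<comment> \<open>One power is set aside as the constant \<open>|z| / y < 1\<close>, so that
        the limit of the partial sums stays strictly below 1 in modulus.\<close>
      hence "norm z ^ i \<le> norm z / y * y ^ i"
        using y by (simp add: k mult_left_mono)
      hence "of_int (renyi_digit \<beta> i) * norm z ^ i \<le> of_int (renyi_digit \<beta> i) * (norm z / y * y ^ i)"
        using d by (intro mult_left_mono) auto
      thus "norm (of_int (renyi_digit \<beta> i) * z ^ i) \<le> norm z / y * (of_int (renyi_digit \<beta> i) * y ^ i)"
        using d by (simp add: norm_mult norm_power mult_ac)
    qed
    also have "\<dots> = norm z / y * (1 - y ^ n * (beta_transform \<beta> ^^ n) 1)"
      unfolding y_def sum_distrib_left[symmetric] sum_renyi_digits[OF \<beta>] ..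
    also have "\<dots> \<le> norm z / y * 1"
      using y orbit_bounds(1)[OF \<beta>, of n] by (intro mult_left_mono) auto
    finally show ?thesis by simp
  qed
  have "norm (1 :: complex) \<le> norm z / y"
    by (rule tendsto_upperbound[OF tendsto_norm[OF lim]]) (use bound in auto)
  thus False using z y by (simp add: y_def[symmetric])
qed

theorem theorem5p5:
  fixes \<beta> :: real
  assumes "1 < \<beta>" and "algebraic_int \<beta>" and "Mahler \<beta> < smallest_pisot"
  shows "reflect_poly (min_int_poly \<beta>) = min_int_poly \<beta> \<and>
         (\<exists>m :: nat \<Rightarrow> nat. m 0 = dyg \<beta> \<and>
           ((\<exists>N. (\<forall>q<N. m q + (dyg \<beta> - 1) \<le> m (q + 1)) \<and>
                 parry_upper \<beta> = fps_of_poly (trinomial (dyg \<beta>)) + (\<Sum>q=1..N. fps_X ^ m q)) \<or>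
            (\<forall>q. m q + (dyg \<beta> - 1) \<le> m (q + 1)) \<and>
            (\<lambda>q. fps_X ^ m (q + 1)) sums (parry_upper \<beta> - fps_of_poly (trinomial (dyg \<beta>))))) \<and>
         (\<exists>U :: int fps. U dvd 1 \<and>
           fps_of_poly (min_int_poly \<beta>) = U * parry_upper \<beta> \<and>
           (\<exists>Uz fz :: complex \<Rightarrow> complex.
              Uz has_fps_expansion complex_fps U \<and>
              fz has_fps_expansion complex_fps (parry_upper \<beta>) \<and>
              (parry_number \<beta> \<longrightarrow>
                 Uz nicely_meromorphic_on UNIV \<and> fz nicely_meromorphic_on UNIV \<and>
                 (\<forall>z. \<not> is_pole Uz z \<and> \<not> is_pole fz z \<longrightarrow>
                    poly (map_poly of_int (min_int_poly \<beta>)) z = Uz z * fz z)) \<and>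
              (\<not> parry_number \<beta> \<longrightarrow>
                 Uz nicely_meromorphic_on ball 0 1 \<and> fz holomorphic_on ball 0 1 \<and>
                 (\<forall>z\<in>ball 0 1. \<not> is_pole Uz z \<longrightarrow>
                    poly (map_poly of_int (min_int_poly \<beta>)) z = Uz z * fz z) \<and>
                 unit_circle_natural_boundary Uz \<and> unit_circle_natural_boundary fz) \<and>
              Uz holomorphic_on ball 0 (theta (dyg \<beta> - 1))))"
proof -
  define p where "p = min_int_poly \<beta>"
  define f where "f = complex_fps (parry_upper \<beta>)"
  define P where "P = map_poly complex_of_int p"
  have p: "is_min_int_poly \<beta> p"
    unfolding p_def by (rule is_min_int_poly_min_int_poly[OF assms(2)])
  have recip: "reflect_poly p = p" and \<beta>: "1 < \<beta>" "\<beta> < 4 / 3"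
    using small_Mahler_imp_reciprocal[OF assms] assms(1) by (auto simp: p_def)
  have p0: "Polynomial.coeff p 0 = 1"
    using recip p unfolding is_min_int_poly_def by (metis coeff_0_reflect_poly)
  have P_ne: "P \<noteq> 0" using p0 by (auto simp: P_def poly_of_int_eq_0_iff)
  have pu0: "fps_nth (parry_upper \<beta>) 0 = -1" by (simp add: parry_upper_def)
  obtain G where G: "G * parry_upper \<beta> = 1"
    using fps_unit_inverse_ex[of "-1" "parry_upper \<beta>"] pu0 by auto
  obtain Q where Q: "Q * fps_of_poly p = 1"
    using fps_unit_inverse_ex[of 1 "fps_of_poly p"] p0 by auto
  define U where "U = fps_of_poly p * G"
  have U: "fps_of_poly p = U * parry_upper \<beta>"
    using G by (simp add: U_def mult.assoc)
  \<comment> \<open>By reciprocity the constant coefficient of the monic minimal polynomial is 1, so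
    it is invertible as a series, and so is its factor \<open>U\<close>.\<close>
  have "U * (parry_upper \<beta> * Q) = 1"
    using Q unfolding mult.assoc[symmetric] U[symmetric] by (simp add: mult.commute)
  hence U_unit: "U dvd 1" by (metis dvd_triv_left)
  have Uf: "complex_fps U * f = fps_of_poly P"
    unfolding f_def P_def complex_fps_mult[symmetric] U[symmetric] by (rule complex_fps_of_poly)
  have digits: "fps_nth f i \<in> {-1, 0, 1}" for i
    using renyi_digit_cases[OF \<beta>, of i] by (cases "i = 0") (auto simp: f_def parry_upper_nth[OF \<beta>])
  have fin: "finite (range (fps_nth f))"
    by (rule finite_subset[of _ "{-1, 0, 1}"]) (use digits in auto)
  have rad: "1 \<le> fps_conv_radius f" by (rule fps_conv_radius_ge_1[OF fin])
  have f0: "fps_nth f 0 \<noteq> 0" by (simp add: f_def pu0)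
  have f_digit: "fps_nth f i = of_int (renyi_digit \<beta> i)" if "i > 0" for i
    using that by (simp add: f_def parry_upper_nth[OF \<beta>])
  have n: "3 \<le> dyg \<beta>" and \<theta>: "theta (dyg \<beta> - 1) < inverse \<beta>"
    by (rule dyg_bounds[OF \<beta>])+
  have "1 \<le> dyg \<beta> - 1" using n by simp
  hence \<theta>1: "theta (dyg \<beta> - 1) \<le> 1" by (rule less_imp_le[OF theta_root(2)])
  \<comment> \<open>The disc lies inside the one of radius \<open>1 / \<beta>\<close>, where the
    Parry Upper function has no zero.\<close>
  have nz: "eval_fps f z \<noteq> 0" if "norm z < theta (dyg \<beta> - 1)" for z
    unfolding f_def using that \<theta> rad by (intro parry_upper_nonzero \<beta>) (auto simp: f_def)
  \<comment> \<open>A terminating expansion is periodic with period 1. Index 0, whose coefficient is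
    -1 instead of a digit, is excluded by \<open>i > N\<close>.\<close>
  have periodic_iff: "parry_number \<beta> \<longleftrightarrow> (\<exists>N q. 0 < q \<and> (\<forall>i>N. fps_nth f (i + q) = fps_nth f i))"
  proof
    assume "parry_number \<beta>"
    then obtain N q where Nq: "0 < q" "\<And>i. i > N \<Longrightarrow> renyi_digit \<beta> (i + q) = renyi_digit \<beta> i"
    proof (unfold parry_number_def, elim disjE exE conjE)
      fix N assume "\<forall>i>N. renyi_digit \<beta> i = 0"
      thus ?thesis by (intro that[of 1 N]) auto
    qed (use that in blast)
    have "fps_nth f (i + q) = fps_nth f i" if "i > N" for i
      using Nq(2)[OF that] that by (simp add: f_digit)
    thus "\<exists>N q. 0 < q \<and> (\<forall>i>N. fps_nth f (i + q) = fps_nth f i)" using Nq(1) by blast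
  next
    assume "\<exists>N q. 0 < q \<and> (\<forall>i>N. fps_nth f (i + q) = fps_nth f i)"
    then obtain N q where Nq: "0 < q" "\<forall>i>N. fps_nth f (i + q) = fps_nth f i" by blast
    have "renyi_digit \<beta> (i + q) = renyi_digit \<beta> i" if "i > N" for i
      using Nq(2)[rule_format, OF that] that by (simp add: f_digit)
    thus "parry_number \<beta>" unfolding parry_number_def using Nq(1) by blast
  qed

  have "\<exists>Uz fz :: complex \<Rightarrow> complex.
          Uz has_fps_expansion complex_fps U \<and> fz has_fps_expansion f \<and>
          (parry_number \<beta> \<longrightarrow>
             Uz nicely_meromorphic_on UNIV \<and> fz nicely_meromorphic_on UNIV \<and>
             (\<forall>z. \<not> is_pole Uz z \<and> \<not> is_pole fz z \<longrightarrow> poly P z = Uz z * fz z)) \<and>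
          (\<not> parry_number \<beta> \<longrightarrow>
             Uz nicely_meromorphic_on ball 0 1 \<and> fz holomorphic_on ball 0 1 \<and>
             (\<forall>z\<in>ball 0 1. \<not> is_pole Uz z \<longrightarrow> poly P z = Uz z * fz z) \<and>
             unit_circle_natural_boundary Uz \<and> unit_circle_natural_boundary fz) \<and>
          Uz holomorphic_on ball 0 (theta (dyg \<beta> - 1))"
  proof (cases "parry_number \<beta>")
    case True
    then obtain N q where Nq: "0 < q" "\<And>i. i > N \<Longrightarrow> fps_nth f (i + q) = fps_nth f i"
      unfolding periodic_iff by blast
    obtain R where R: "f * (1 - fps_X ^ q) = fps_of_poly R"
      using periodic_fps_rational[of N f q] Nq(2) by blast
    \<comment> \<open>Periodic coefficients make the series rational, which continues it to the
      whole plane.\<close>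
    define F where "F = (\<lambda>z. poly R z / (1 - z ^ q))"
    interpret poly_quotient P f "complex_fps U" F UNIV
    proof
      show "F meromorphic_on UNIV"
        unfolding F_def by (intro meromorphic_intros analytic_on_imp_meromorphic_on poly_analytic_on)
      fix z :: complex assume z: "norm z < 1"
      define S where "S = 1 - Polynomial.monom (1 :: complex) q"
      have "1 - fps_X ^ q = fps_of_poly S"
        unfolding S_def by (simp add: fps_of_poly_diff fps_of_poly_monom')
      with R have "f * fps_of_poly S = fps_of_poly R" by (simp only:)
      hence "poly R z = eval_fps f z * poly S z"
        using eval_fps_mult[of z f "fps_of_poly S"] norm_less_conv_radius[OF rad z] by simp
      hence "poly R z = eval_fps f z * (1 - z ^ q)" by (simp add: S_def poly_monom)
      moreover have "1 - z ^ q \<noteq> 0"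
      proof
        assume "1 - z ^ q = 0"
        hence "norm z ^ q = 1" by (metis norm_one norm_power right_minus_eq)
        thus False using z Nq(1) power_less_one_iff[of "norm z" q] by auto
      qed
      ultimately show "F z = eval_fps f z" by (simp add: F_def)
    qed (use rad f0 Uf in auto)
    show ?thesis
      using True Uz_expansion fz_expansion Uz_nicely fz_nicely product Uz_holomorphic[OF \<theta>1 nz]
      by (intro exI[of _ Uz] exI[of _ fz]) auto
  next
    case False
    interpret poly_quotient P f "complex_fps U" "eval_fps f" "ball 0 1"
      by unfold_locales (use rad f0 Uf in \<open>auto intro!: analytic_on_imp_meromorphic_on
        simp: analytic_on_open holomorphic_on_eval_fps_unit_ball\<close>)
    have NB: "unit_circle_natural_boundary (eval_fps f)"
      using False unfolding periodic_iff by (intro szego_natural_boundary fin)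
    have "unit_circle_natural_boundary fz"
      by (rule unit_circle_natural_boundary_cong[OF _ NB]) (simp add: fz_eq)
    moreover have "unit_circle_natural_boundary Uz"
    proof (rule unit_circle_natural_boundary_quotient[OF P_ne NB])
      show "Uz meromorphic_on ball 0 1" using Uz_nicely by (simp add: nicely_meromorphic_on_def)
      show "\<forall>\<^sub>F x in at z. eval_fps f x \<noteq> 0 \<and> Uz x = poly P x / eval_fps f x" if "z \<in> ball 0 1" for z
        using eventually_Uz_fz[OF that] by eventually_elim auto
    qed
    moreover have fz_an: "fz analytic_on ball 0 1"
      unfolding fz_def by (intro remove_sings_analytic_on F_analytic)
    moreover have "\<not> is_pole fz z" if "z \<in> ball 0 1" for z
      using fz_an that by (intro analytic_at_imp_no_pole) (auto intro: analytic_on_subset)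
    ultimately show ?thesis
      using False Uz_expansion fz_expansion Uz_nicely product Uz_holomorphic[OF \<theta>1 nz]
      by (intro exI[of _ Uz] exI[of _ fz]) (auto intro: analytic_imp_holomorphic)
  qed
  thus ?thesis
    using recip U U_unit parry_upper_form[OF \<beta>] unfolding p_def f_def P_def by blast
qed

end
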